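(* Let $m_1,m_2,m_3\in\mathbb N$ and $m=m_1+m_2+m_3$. Let $\mathcal{UC}_{2,4}$ be the set of partitions $\pi$ of $[m]$ such that $T^\pi_{m_1,m_2,m_3}$ is of $2$-$4$ unicircuit type. Then $$|\mathcal{UC}_{2,4}|=2|\mathcal{PS}^{(1,1)}_{NC_2}(m_1,m_2,m_3)|-2|\mathcal{PS}^{(1,1)}_{NC_2^{(2)}}(m_1,m_2,m_3)|-2|\mathcal{PS}^{(1,1)(t)}_{NC_2}(m_1,m_2,m_3)|.$$
   Context: **Graphs.** $\gamma=\gamma_{m_1,m_2,m_3}$ is the permutation of $[m]$ with three cycles, the $j$-th being $[\![m_j]\!]=(m_1+\cdots+m_{j-1}+1,\dots,m_1+\cdots+m_j)$. $T_{m_1,m_2,m_3}$ is the oriented graph with vertex set $[m]$ and edges $e_1,\dots,e_m$, $e_i$ going from $\gamma(i)$ to $i$; it is the disjoint union of basic cycles $T_{m_1},T_{m_2},T_{m_3}$, and $E_j=\{e_i:i\in[\![m_j]\!]\}$. For a partition $\pi$ of $[m]$, the quotient graph $T^\pi_{m_1,m_2,m_3}$ has the blocks of $\pi$ as vertices and edges $e_1,\dots,e_m$, $e_i$ going from the block of $\gamma(i)$ to the block of $i$; for $J\subset\{1,2,3\}$, $T^\pi_{m_j,\,j\in J}$ is the quotient of $\bigcup_{j\in J}T_{m_j}$ by the restriction of $\pi$. Two edges are equivalent if they join the same unordered pair of vertices; the elementarization (denoted by an overline) is the unoriented graph on the same vertices whose edges are the equivalence classes; multiplicity is the cardinality of the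 class. Equivalent edges have opposite orientations if the source of each is the target of the other (two loops at a vertex satisfy this). $T^\pi_{m_i}$ is a double tree if $\overline{T^\pi_{m_i}}$ is a tree with every edge of multiplicity 2 consisting of two edges with opposite orientations. A circuit is a connected subgraph all of whose vertices have degree 2 (a loop contributes 2). $T^\pi_{m_j,m_k}$ is a double unicircuit graph if its elementarization is connected with exactly one circuit, every edge has multiplicity 2 and consists of two edges with opposite orientations, and every edge of the circuit consists of one edge from $E_j$ and one from $E_k$. $T^\pi_{m_1,m_2,m_3}$ is of $2$-$4$ unicircuit type if for some $\{i,j,k\}=\{1,2,3\}$, $T^\pi_{m_i}$ is a double tree, $T^\pi_{m_j,m_k}$ is a double unicircuit graph, and $T^\pi_{m_1,m_2,m_3}$ is obtained by joining $T^\pi_{m_i}$ and $T^\pi_{m_j,m_k}$ along some edge (one edge of each is glued, with no other vertex identifications between them). **Partitioned permutations.** For a permutation $\tau$ of an $n$-element set, $|\tau|=n$ minus the number of cycles. $NC_2(m_i)$ is the set of non-crossing pairings of the cyclically ordered set $[\![m_i]\!]$, regarded as permutations. $NC_2(m_{i_1},m_{i_2})$ is the set of permutations $\tau$ of $[\![m_{i_1}]\!]\cup[\![m_{i_2}]\!]$ with all cycles of size 2, $|\tau|+|\tau^{-1}\gamma'|=|\gamma'|+2$ and $\tau\vee\gamma'$ the one-block partition, where $\gamma'$ is the product of the cycles $[\![m_{i_1}]\!],[\![m_{i_2}]\!]$; a through string of $\tau$ is a cycle meeting both cycles of $\gamma'$. - $\mathcal{PS}^{(1,1)}_{NC_2}(m_1,m_2,m_3)$: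 pairs $(\mathcal V,\pi)$ such that for some permutation $(i_1,i_2,i_3)$ of $(1,2,3)$, $\pi=\pi_1\times\pi_2$ with $\pi_1\in NC_2(m_{i_1},m_{i_2})$ and $\pi_2\in NC_2(m_{i_3})$, and $\mathcal V$ is a partition of $[m]$ each of whose blocks is a cycle of $\pi$ except one block which is the union of one cycle of $\pi_1$ and one cycle of $\pi_2$. - $\mathcal{PS}^{(1,1)}_{NC_2^{(2)}}(m_1,m_2,m_3)$: the subset of those $(\mathcal V,\pi)$ for which $\pi_1$ has exactly two through strings. - $\mathcal{PS}^{(1,1)(t)}_{NC_2}(m_1,m_2,m_3)$: the subset of those $(\mathcal V,\pi)$ for which $\pi_1$ has exactly one through string and the exceptional block of $\mathcal V$ is the union of this through string and one cycle of $\pi_2$. *)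

theory Defs
  imports
    "HOL-Library.Disjoint_Sets"
    "HOL-Combinatorics.Orbits"
    "HOL-Combinatorics.Cycles"
    "Graph_Theory.Digraph"
begin

section \<open>The permutation with three cycles\<close>

text \<open>
  The numbers \<open>m\<^sub>1, m\<^sub>2, m\<^sub>3\<close> are given as \<open>m 1, m 2, m 3\<close> for a function \<open>m\<close>, so that the
  index can be quantified over. All other values of \<open>m\<close> are irrelevant.
\<close>

definition cycle_list :: "(nat \<Rightarrow> nat) \<Rightarrow> nat \<Rightarrow> nat list" where
  "cycle_list m j = [(\<Sum>k = 1..<j. m k) + 1 ..< (\<Sum>k = 1..j. m k) + 1]"

definition segment :: "(nat \<Rightarrow> nat) \<Rightarrow> nat \<Rightarrow> nat set" where
  "segment m j = set (cycle_list m j)"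

definition basic_cycle :: "(nat \<Rightarrow> nat) \<Rightarrow> nat \<Rightarrow> nat \<Rightarrow> nat" where
  "basic_cycle m j = cycle_of_list (cycle_list m j)"

definition gamma :: "(nat \<Rightarrow> nat) \<Rightarrow> nat \<Rightarrow> nat" where
  "gamma m = basic_cycle m 1 \<circ> basic_cycle m 2 \<circ> basic_cycle m 3"


section \<open>Unoriented graphs\<close>

text \<open>
  Every edge carries its set of end points, a singleton in the case of a loop.
\<close>

record ('v, 'e) ugraph =
  uverts :: "'v set"
  uedges :: "'e set"
  uends :: "'e \<Rightarrow> 'v set"

definition uconnected :: "('v, 'e) ugraph \<Rightarrow> bool" where
  "uconnected G \<longleftrightarrow> uverts G \<noteq> {} \<and>
     (\<forall>u \<in> uverts G. \<forall>v \<in> uverts G. (u, v) \<in> {(x, y). \<exists>e \<in> uedges G. uends G e = {x, y}}\<^sup>*)"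

definition udegree :: "('v, 'e) ugraph \<Rightarrow> 'v \<Rightarrow> nat" where
  "udegree G v = (\<Sum>e | e \<in> uedges G \<and> v \<in> uends G e. if uends G e = {v} then 2 else 1)"

definition usubgraph :: "('v, 'e) ugraph \<Rightarrow> ('v, 'e) ugraph \<Rightarrow> bool" where
  "usubgraph H G \<longleftrightarrow> uverts H \<subseteq> uverts G \<and> uedges H \<subseteq> uedges G \<and> uends H = uends G \<and>
     (\<forall>e \<in> uedges H. uends H e \<subseteq> uverts H)"

definition circuits :: "('v, 'e) ugraph \<Rightarrow> ('v, 'e) ugraph set" where
  "circuits G = {H. usubgraph H G \<and> uconnected H \<and> (\<forall>v \<in> uverts H. udegree H v = 2)}"

definition utree :: "('v, 'e) ugraph \<Rightarrow> bool" where
  "utree G \<longleftrightarrow> uconnected G \<and> circuits G = {}"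


section \<open>Quotient graphs and elementarization\<close>

definition equivalent_edges :: "('v, 'e) pre_digraph \<Rightarrow> 'e \<Rightarrow> 'e \<Rightarrow> bool" where
  "equivalent_edges G e f \<longleftrightarrow> {tail G e, head G e} = {tail G f, head G f}"

definition opposite_edges :: "('v, 'e) pre_digraph \<Rightarrow> 'e \<Rightarrow> 'e \<Rightarrow> bool" where
  "opposite_edges G e f \<longleftrightarrow> tail G e = head G f \<and> head G e = tail G f"

text \<open>
  The edges of the elementarization are the classes of equivalent edges; all members of a class
  have the same end points, so the union below is just this common set of end points.
  The multiplicity of an edge \<open>c\<close> of the elementarization is \<open>card c\<close>.
\<close>

definition elementarization :: "('v, 'e) pre_digraph \<Rightarrow> ('v, 'e set) ugraph" where
  "elementarization G =
     \<lparr>uverts = verts G,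
      uedges = arcs G // {(e, f). e \<in> arcs G \<and> f \<in> arcs G \<and> equivalent_edges G e f},
      uends = (\<lambda>c. \<Union>e \<in> c. {tail G e, head G e})\<rparr>"

definition all_edges_double_opposite :: "('v, 'e) pre_digraph \<Rightarrow> bool" where
  "all_edges_double_opposite G \<longleftrightarrow>
     (\<forall>c \<in> uedges (elementarization G).
        card c = 2 \<and> (\<forall>e \<in> c. \<forall>f \<in> c. e \<noteq> f \<longrightarrow> opposite_edges G e f))"

definition block_of :: "'a set set \<Rightarrow> 'a \<Rightarrow> 'a set" where
  "block_of P x = (THE B. B \<in> P \<and> x \<in> B)"

definition quotient_digraph :: "('v, 'e) pre_digraph \<Rightarrow> 'v set set \<Rightarrow> ('v set, 'e) pre_digraph" where
  "quotient_digraph G P =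
     \<lparr>verts = P, arcs = arcs G,
      tail = (\<lambda>e. block_of P (tail G e)), head = (\<lambda>e. block_of P (head G e))\<rparr>"

definition restrict_partition :: "'a set set \<Rightarrow> 'a set \<Rightarrow> 'a set set" where
  "restrict_partition P S = (\<lambda>B. B \<inter> S) ` P - {{}}"

text \<open>
  The union of the basic cycles with index in \<open>J\<close>. The edge \<open>e\<^sub>i\<close>, going from \<open>gamma m i\<close> to \<open>i\<close>,
  is represented by its index \<open>i\<close>; so \<open>segment m j\<close> is also the set \<open>E\<^sub>j\<close> of edges.
\<close>

definition cycle_graph :: "(nat \<Rightarrow> nat) \<Rightarrow> nat set \<Rightarrow> (nat, nat) pre_digraph" where
  "cycle_graph m J =
     \<lparr>verts = (\<Union>j \<in> J. segment m j), arcs = (\<Union>j \<in> J. segment m j),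
      tail = gamma m, head = (\<lambda>i. i)\<rparr>"

definition quotient_cycle_graph ::
  "(nat \<Rightarrow> nat) \<Rightarrow> nat set set \<Rightarrow> nat set \<Rightarrow> (nat set, nat) pre_digraph" where
  "quotient_cycle_graph m P J =
     quotient_digraph (cycle_graph m J) (restrict_partition P (\<Union>j \<in> J. segment m j))"


section \<open>Graphs of 2-4 unicircuit type\<close>

definition double_tree :: "('v, 'e) pre_digraph \<Rightarrow> bool" where
  "double_tree G \<longleftrightarrow> utree (elementarization G) \<and> all_edges_double_opposite G"

definition double_unicircuit :: "(nat \<Rightarrow> nat) \<Rightarrow> nat set set \<Rightarrow> nat \<Rightarrow> nat \<Rightarrow> bool" where
  "double_unicircuit m P j k \<longleftrightarrow>
     (let G = quotient_cycle_graph m P {j, k} in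
        uconnected (elementarization G) \<and>
        all_edges_double_opposite G \<and>
        (\<exists>C. circuits (elementarization G) = {C} \<and>
             (\<forall>c \<in> uedges C. \<exists>e \<in> segment m j. \<exists>f \<in> segment m k. c = {e, f})))"

text \<open>
  The blocks of \<open>P\<close> meeting \<open>segment m i\<close> are the vertices of the quotient of the \<open>i\<close>-th cycle
  as seen in the whole graph, and similarly for \<open>j, k\<close>. Gluing along an edge, with no other
  vertex identification, means that an edge of one part has become equivalent to an edge of the
  other part and that the vertices common to both parts are exactly the end points of this edge.
\<close>

definition joined_along_edge ::
  "(nat \<Rightarrow> nat) \<Rightarrow> nat set set \<Rightarrow> nat \<Rightarrow> nat \<Rightarrow> nat \<Rightarrow> bool" where
  "joined_along_edge m P i j k \<longleftrightarrow>
     (let G = quotient_cycle_graph m P {i, j, k} in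
        \<exists>a \<in> segment m i. \<exists>b \<in> segment m j \<union> segment m k.
          equivalent_edges G a b \<and>
          {B \<in> verts G. B \<inter> segment m i \<noteq> {} \<and> B \<inter> (segment m j \<union> segment m k) \<noteq> {}}
            = {tail G a, head G a})"

definition unicircuit_type_2_4 :: "(nat \<Rightarrow> nat) \<Rightarrow> nat set set \<Rightarrow> bool" where
  "unicircuit_type_2_4 m P \<longleftrightarrow>
     (\<exists>i j k. {i, j, k} = {1, 2, 3} \<and>
        double_tree (quotient_cycle_graph m P {i}) \<and>
        double_unicircuit m P j k \<and>
        joined_along_edge m P i j k)"

definition UC_2_4 :: "(nat \<Rightarrow> nat) \<Rightarrow> nat set set set" where
  "UC_2_4 m = {P. partition_on {1..m 1 + m 2 + m 3} P \<and> unicircuit_type_2_4 m P}"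


section \<open>Non-crossing pairings\<close>

text \<open>The cycles of a permutation of \<open>S\<close>, fixed points included, as subsets of \<open>S\<close>.\<close>

definition perm_cycles :: "'a set \<Rightarrow> ('a \<Rightarrow> 'a) \<Rightarrow> 'a set set" where
  "perm_cycles S \<tau> = orbit \<tau> ` S"

definition perm_length :: "'a set \<Rightarrow> ('a \<Rightarrow> 'a) \<Rightarrow> nat" where
  "perm_length S \<tau> = card S - card (perm_cycles S \<tau>)"

text \<open>The finest partition of \<open>S\<close> that is coarser than both partitions \<open>P\<close> and \<open>Q\<close> of \<open>S\<close>.\<close>

definition partition_join :: "'a set \<Rightarrow> 'a set set \<Rightarrow> 'a set set \<Rightarrow> 'a set set" where
  "partition_join S P Q = S // (\<Union>B \<in> P \<union> Q. B \<times> B)\<^sup>+"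

text \<open>
  Being non-crossing with respect to the cyclic order of a segment is the same as being
  non-crossing with respect to its linear order.
\<close>

definition NC2 :: "(nat \<Rightarrow> nat) \<Rightarrow> nat \<Rightarrow> (nat \<Rightarrow> nat) set" where
  "NC2 m i =
     {\<tau>. \<tau> permutes segment m i \<and>
         (\<forall>C \<in> perm_cycles (segment m i) \<tau>. card C = 2) \<and>
         \<not> (\<exists>a \<in> segment m i. \<exists>b \<in> segment m i. a < b \<and> b < \<tau> a \<and> \<tau> a < \<tau> b)}"

definition NC2_annular :: "(nat \<Rightarrow> nat) \<Rightarrow> nat \<Rightarrow> nat \<Rightarrow> (nat \<Rightarrow> nat) set" where
  "NC2_annular m i j =
     (let S = segment m i \<union> segment m j; \<gamma>' = basic_cycle m i \<circ> basic_cycle m j in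
       {\<tau>. \<tau> permutes S \<and>
           (\<forall>C \<in> perm_cycles S \<tau>. card C = 2) \<and>
           perm_length S \<tau> + perm_length S (inv \<tau> \<circ> \<gamma>') = perm_length S \<gamma>' + 2 \<and>
           partition_join S (perm_cycles S \<tau>) (perm_cycles S \<gamma>') = {S}})"

definition through_strings :: "(nat \<Rightarrow> nat) \<Rightarrow> nat \<Rightarrow> nat \<Rightarrow> (nat \<Rightarrow> nat) \<Rightarrow> nat set set" where
  "through_strings m i j \<tau> =
     {C \<in> perm_cycles (segment m i \<union> segment m j) \<tau>.
        C \<inter> segment m i \<noteq> {} \<and> C \<inter> segment m j \<noteq> {}}"


section \<open>Partitioned permutations\<close>

text \<open>
  \<open>ps11 m i1 i2 i3 \<pi>1 \<pi>2 C1 C2 V \<pi>\<close>: the pair \<open>(V, \<pi>)\<close> arises from the index permutation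
  \<open>(i1, i2, i3)\<close>, with \<open>\<pi> = \<pi>1 \<times> \<pi>2\<close>, and the exceptional block of \<open>V\<close> is \<open>C1 \<union> C2\<close> for a cycle
  \<open>C1\<close> of \<open>\<pi>1\<close> and a cycle \<open>C2\<close> of \<open>\<pi>2\<close>.
  Permutations being the identity outside their domain, \<open>\<pi>1 \<times> \<pi>2\<close> is \<open>\<pi>1 \<circ> \<pi>2\<close>.
\<close>

definition ps11 ::
  "(nat \<Rightarrow> nat) \<Rightarrow> nat \<Rightarrow> nat \<Rightarrow> nat \<Rightarrow> (nat \<Rightarrow> nat) \<Rightarrow> (nat \<Rightarrow> nat) \<Rightarrow> nat set \<Rightarrow> nat set
     \<Rightarrow> nat set set \<Rightarrow> (nat \<Rightarrow> nat) \<Rightarrow> bool" where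
  "ps11 m i1 i2 i3 \<pi>1 \<pi>2 C1 C2 V \<pi> \<longleftrightarrow>
     {i1, i2, i3} = {1, 2, 3} \<and>
     \<pi>1 \<in> NC2_annular m i1 i2 \<and> \<pi>2 \<in> NC2 m i3 \<and> \<pi> = \<pi>1 \<circ> \<pi>2 \<and>
     C1 \<in> perm_cycles (segment m i1 \<union> segment m i2) \<pi>1 \<and>
     C2 \<in> perm_cycles (segment m i3) \<pi>2 \<and>
     partition_on {1..m 1 + m 2 + m 3} V \<and>
     C1 \<union> C2 \<in> V \<and>
     (\<forall>B \<in> V - {C1 \<union> C2}. B \<in> perm_cycles {1..m 1 + m 2 + m 3} \<pi>)"

definition PS11_NC2 :: "(nat \<Rightarrow> nat) \<Rightarrow> (nat set set \<times> (nat \<Rightarrow> nat)) set" where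
  "PS11_NC2 m =
     {(V, \<pi>). \<exists>i1 i2 i3 \<pi>1 \<pi>2 C1 C2. ps11 m i1 i2 i3 \<pi>1 \<pi>2 C1 C2 V \<pi>}"

definition PS11_NC2_two :: "(nat \<Rightarrow> nat) \<Rightarrow> (nat set set \<times> (nat \<Rightarrow> nat)) set" where
  "PS11_NC2_two m =
     {(V, \<pi>). \<exists>i1 i2 i3 \<pi>1 \<pi>2 C1 C2. ps11 m i1 i2 i3 \<pi>1 \<pi>2 C1 C2 V \<pi> \<and>
        card (through_strings m i1 i2 \<pi>1) = 2}"

definition PS11_NC2_through :: "(nat \<Rightarrow> nat) \<Rightarrow> (nat set set \<times> (nat \<Rightarrow> nat)) set" where
  "PS11_NC2_through m =
     {(V, \<pi>). \<exists>i1 i2 i3 \<pi>1 \<pi>2 C1 C2. ps11 m i1 i2 i3 \<pi>1 \<pi>2 C1 C2 V \<pi> \<and>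
        card (through_strings m i1 i2 \<pi>1) = 1 \<and> C1 \<in> through_strings m i1 i2 \<pi>1}"

end

theory Submission
  imports Defs
begin

text \<open>
  A partition all of whose edges are double with opposite orientations determines a pairing \<open>\<tau>\<close>
  of the edges, and \<open>\<gamma> \<circ> \<tau>\<close> preserves its blocks; comparing the number of blocks with the number of
  edges of a connected graph forces the blocks to be exactly the cycles of \<open>\<gamma> \<circ> \<tau>\<close>. So double trees
  are non-crossing pairings, a pair being a bridge precisely when it separates a cyclic interval
  from the rest. Unicircuit graphs are annular pairings: a cut crossed by a single edge cannot
  separate two points of different \<open>\<gamma>\<close>-cycles, and the circuit consists of the through strings.
  Two through strings would be parallel edges and are excluded; a single through string is a loop,
  and no edge of a tree can be glued to a loop.

  Finally, choosing an orientation of one edge \<open>a\<close> of the tree and of one edge \<open>b\<close>, not a loop, of the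
  unicircuit graph determines a glued graph, where reversing both edges gives the same graph. The
  same data determine a partitioned permutation that does not see the orientations at all. So every
  graph arises twice and every partitioned permutation four times.
\<close>


section \<open>Cuts, spanning trees and circuits\<close>

text \<open>Planarity arguments are replaced by one parity fact. Since \<open>\<gamma> x\<close> and
  \<open>\<tau> x\<close> share a block, a closed walk along a cycle of \<gamma> crosses every
  vertex cut equally often in either direction; this is why a pair joining two cycles of \<gamma> is
  never a bridge. Connectedness is therefore handled through cuts rather than paths. Blocks are at
  first only known to be unions of cycles of \<open>\<gamma> \<circ> \<tau>\<close>, so equality
  needs an upper bound on the number of cycles. It comes from the spanning tree inequality for the
  graph on the cycles themselves: at most one vertex more than edges. A double tree already attains
  this. A unicircuit graph has one block less, and the extreme value is ruled out because a tree
  would make a through string a bridge. The graph whose edges are the cycles of \<tau> keeps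
  parallel pairs apart, so its number of edges is known in advance; it agrees with the
  elementarization only if no two pairs are parallel. For annular pairings with the right number of
  vertices, two through strings are exactly the case where this agreement fails.\<close>

definition crosses :: "'v set \<Rightarrow> 'v set \<Rightarrow> bool" where
  "crosses B W \<longleftrightarrow> B \<inter> W \<noteq> {} \<and> \<not> B \<subseteq> W"

definition udelete :: "('v, 'e) ugraph \<Rightarrow> 'e \<Rightarrow> ('v, 'e) ugraph" where
  "udelete G e = G\<lparr>uedges := uedges G - {e}\<rparr>"

lemma udelete_simps [simp]:
  "uverts (udelete G e) = uverts G" "uedges (udelete G e) = uedges G - {e}"
  "uends (udelete G e) = uends G"
  by (simp_all add: udelete_def)

text \<open>The record type constrains nothing: finiteness and end sets of one or two vertices of
  the graph have to be demanded.\<close>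

definition ugraph_on :: "('v, 'e) ugraph \<Rightarrow> bool" where
  "ugraph_on G \<longleftrightarrow> finite (uverts G) \<and> finite (uedges G) \<and>
     (\<forall>e \<in> uedges G. \<exists>u \<in> uverts G. \<exists>v \<in> uverts G. uends G e = {u, v})"

lemma ugraph_onE:
  assumes "ugraph_on G" "e \<in> uedges G"
  obtains u v where "u \<in> uverts G" "v \<in> uverts G" "uends G e = {u, v}"
  using assms unfolding ugraph_on_def by blast

lemma ugraph_on_finite:
  assumes "ugraph_on G"
  shows "finite (uverts G)" "finite (uedges G)"
  using assms by (auto simp: ugraph_on_def)

lemma ugraph_on_ends_subset: "ugraph_on G \<Longrightarrow> e \<in> uedges G \<Longrightarrow> uends G e \<subseteq> uverts G"
  by (auto simp: ugraph_on_def)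

lemma ugraph_on_udelete [simp]: "ugraph_on G \<Longrightarrow> ugraph_on (udelete G e)"
  by (auto simp: ugraph_on_def)

lemma usubgraphD:
  assumes "usubgraph H G"
  shows "uverts H \<subseteq> uverts G" "uedges H \<subseteq> uedges G" "uends H = uends G"
    "e \<in> uedges H \<Longrightarrow> uends H e \<subseteq> uverts H"
  using assms unfolding usubgraph_def by metis+

lemma circuits_mono:
  assumes "usubgraph H G"
  shows "circuits H \<subseteq> circuits G"
proof
  fix C assume C: "C \<in> circuits H"
  then have "usubgraph C H" by (simp add: circuits_def)
  then have "usubgraph C G"
    using assms unfolding usubgraph_def by (metis order_trans)
  then show "C \<in> circuits G" using C by (simp add: circuits_def)
qed

lemma ugraph_on_usubgraph:
  assumes "ugraph_on G" "usubgraph H G"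
  shows "ugraph_on H"
proof -
  have "\<exists>u \<in> uverts H. \<exists>v \<in> uverts H. uends H e = {u, v}" if e: "e \<in> uedges H" for e
  proof -
    have "e \<in> uedges G" using assms(2) e by (auto simp: usubgraph_def)
    then obtain u v where "uends G e = {u, v}" using assms(1) by (meson ugraph_onE)
    moreover have "uends H e \<subseteq> uverts H" "uends H = uends G" using usubgraphD[OF assms(2)] e by blast+
    ultimately show ?thesis using e by (intro bexI[of _ u] bexI[of _ v]) auto
  qed
  moreover have "finite (uverts H)" "finite (uedges H)"
    using finite_subset[OF usubgraphD(1)[OF assms(2)]] finite_subset[OF usubgraphD(2)[OF assms(2)]] assms(1)
    by (simp_all add: ugraph_on_def)
  ultimately show ?thesis unfolding ugraph_on_def by simp
qed

section \<open>Connectedness and bridges in terms of cuts\<close>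

text \<open>The vertices reachable from u form a set that no edge crosses, while a path leaving W
  contains an edge crossing it.\<close>

lemma uconnected_iff_cuts:
  assumes "ugraph_on G"
  shows "uconnected G \<longleftrightarrow> uverts G \<noteq> {} \<and>
    (\<forall>W. W \<subseteq> uverts G \<longrightarrow> W \<noteq> {} \<longrightarrow> W \<noteq> uverts G \<longrightarrow> (\<exists>e \<in> uedges G. crosses (uends G e) W))"
    (is "_ \<longleftrightarrow> _ \<and> ?cuts")
proof -
  define R where "R = {(x, y). \<exists>e \<in> uedges G. uends G e = {x, y}}"
  have conn: "uconnected G \<longleftrightarrow> uverts G \<noteq> {} \<and> (\<forall>u \<in> uverts G. \<forall>v \<in> uverts G. (u, v) \<in> R\<^sup>*)"
    by (simp add: uconnected_def R_def)
  have step: "\<exists>e \<in> uedges G. crosses (uends G e) W" if "(u, v) \<in> R\<^sup>*" "u \<in> W" "v \<notin> W" for u v W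
    using that
  proof (induction rule: rtrancl_induct)
    case (step y z)
    show ?case
    proof (cases "y \<in> W")
      case True
      obtain e where e: "e \<in> uedges G" "uends G e = {y, z}" using step.hyps(2) by (auto simp: R_def)
      then have "crosses (uends G e) W" using True step.prems by (auto simp: crosses_def)
      then show ?thesis using e by blast
    qed (use step in blast)
  qed simp
  have "?cuts" if c: "uconnected G"
  proof (intro allI impI)
    fix W assume W: "W \<subseteq> uverts G" "W \<noteq> {}" "W \<noteq> uverts G"
    then obtain u v where "u \<in> W" "v \<in> uverts G" "v \<notin> W" by blast
    moreover have "(u, v) \<in> R\<^sup>*" using c conn calculation W by blast
    ultimately show "\<exists>e \<in> uedges G. crosses (uends G e) W" using step by blast
  qed
  moreover have "(u, v) \<in> R\<^sup>*" if c: "?cuts" and uv: "u \<in> uverts G" "v \<in> uverts G" for u v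
  proof -
    define W where "W = {x \<in> uverts G. (u, x) \<in> R\<^sup>*}"
    have "\<not> crosses (uends G e) W" if e: "e \<in> uedges G" for e
    proof
      assume cr: "crosses (uends G e) W"
      obtain a b where ab: "a \<in> uverts G" "b \<in> uverts G" "uends G e = {a, b}"
        using ugraph_onE[OF assms e] by blast
      then have "(a, b) \<in> R" "(b, a) \<in> R" using e by (auto simp: R_def intro!: bexI[of _ e])
      then have "a \<in> W \<longleftrightarrow> b \<in> W"
        using ab by (auto simp: W_def intro: rtrancl_into_rtrancl)
      then show False using cr ab by (auto simp: crosses_def)
    qed
    moreover have "W \<noteq> {}" "W \<subseteq> uverts G" using uv by (auto simp: W_def)
    ultimately have "W = uverts G" using c by blast
    then show ?thesis using uv by (auto simp: W_def)
  qed
  ultimately have "uconnected G \<longleftrightarrow> uverts G \<noteq> {} \<and> ?cuts" unfolding conn by metis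
  then show ?thesis .
qed

lemma uconnected_mono:
  assumes "uconnected G" "uverts H = uverts G" "uends H = uends G" "uedges G \<subseteq> uedges H"
  shows "uconnected H"
proof -
  have "{(x, y). \<exists>e \<in> uedges G. uends G e = {x, y}} \<subseteq> {(x, y). \<exists>e \<in> uedges H. uends H e = {x, y}}"
    using assms(3,4) by auto
  note mono = subsetD[OF rtrancl_mono[OF this]]
  show ?thesis
    using assms(1) unfolding uconnected_def assms(2) by (intro conjI ballI mono) simp_all
qed

lemma uconnectedD_cut:
  assumes "ugraph_on G" "uconnected G" "W \<subseteq> uverts G" "W \<noteq> {}" "W \<noteq> uverts G"
  obtains e where "e \<in> uedges G" "crosses (uends G e) W"
proof -
  have "\<exists>e \<in> uedges G. crosses (uends G e) W"
    using uconnected_iff_cuts[OF assms(1)] assms(2-) by simp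
  then show ?thesis using that by metis
qed

lemma not_uconnectedE:
  assumes "ugraph_on G" "\<not> uconnected G" "uverts G \<noteq> {}"
  obtains W where "W \<subseteq> uverts G" "W \<noteq> {}" "W \<noteq> uverts G"
    "\<And>e. e \<in> uedges G \<Longrightarrow> \<not> crosses (uends G e) W"
proof -
  have "\<exists>W. W \<subseteq> uverts G \<and> W \<noteq> {} \<and> W \<noteq> uverts G \<and> (\<forall>e \<in> uedges G. \<not> crosses (uends G e) W)"
    using uconnected_iff_cuts[OF assms(1)] assms(2,3) by simp
  then show ?thesis using that by metis
qed

text \<open>A cut that no edge crosses after the deletion is still crossed in G, so \<open>e\<close>
  alone crosses it. Bridges enter the later arguments in this form.\<close>

lemma bridge_cutE:
  assumes "ugraph_on G" "uconnected G" "\<not> uconnected (udelete G e)"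
  obtains W where "W \<subseteq> uverts G" "W \<noteq> {}" "W \<noteq> uverts G" "e \<in> uedges G"
    "\<And>f. f \<in> uedges G \<Longrightarrow> crosses (uends G f) W \<longleftrightarrow> f = e"
proof -
  have "uverts G \<noteq> {}" using assms(2) by (simp add: uconnected_def)
  then obtain W where W: "W \<subseteq> uverts G" "W \<noteq> {}" "W \<noteq> uverts G"
    "\<And>f. f \<in> uedges G - {e} \<Longrightarrow> \<not> crosses (uends G f) W"
    using not_uconnectedE[of "udelete G e"] assms by auto
  obtain f where "f \<in> uedges G" "crosses (uends G f) W"
    using uconnectedD_cut[OF assms(1,2) W(1-3)] .
  then have "e \<in> uedges G" "crosses (uends G e) W" using W(4) by blast+
  then show ?thesis using that W by blast
qed

lemma bridgeI:
  assumes "ugraph_on G" "W \<subseteq> uverts G" "W \<noteq> {}" "W \<noteq> uverts G"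
    "\<And>f. f \<in> uedges G \<Longrightarrow> f \<noteq> e \<Longrightarrow> \<not> crosses (uends G f) W"
  shows "\<not> uconnected (udelete G e)"
proof
  assume "uconnected (udelete G e)"
  then obtain f where "f \<in> uedges (udelete G e)" "crosses (uends (udelete G e) f) W"
    using uconnectedD_cut[of "udelete G e" W] assms(1-4) by auto
  then show False using assms(5) by simp
qed

text \<open>A loop has a single end and crosses no cut, whereas a bridge has to cross one.\<close>

lemma uconnected_udelete_loop:
  assumes "ugraph_on G" "uconnected G" "uends G e = {v}"
  shows "uconnected (udelete G e)"
proof (rule ccontr)
  assume "\<not> ?thesis"
  then obtain W where "e \<in> uedges G" "\<And>f. f \<in> uedges G \<Longrightarrow> crosses (uends G f) W \<longleftrightarrow> f = e"
    using bridge_cutE[OF assms(1,2)] by metis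
  then have "crosses (uends G e) W" by blast
  then show False using assms(3) by (auto simp: crosses_def)
qed

text \<open>Edges with equal ends cross the same cuts, so neither can be the only one
  across.\<close>

lemma uconnected_udelete_parallel:
  assumes "ugraph_on G" "uconnected G" "f \<in> uedges G" "f \<noteq> e" "uends G e = uends G f"
  shows "uconnected (udelete G e)"
proof (rule ccontr)
  assume "\<not> ?thesis"
  then obtain W where "e \<in> uedges G" "\<And>f. f \<in> uedges G \<Longrightarrow> crosses (uends G f) W \<longleftrightarrow> f = e"
    using bridge_cutE[OF assms(1,2)] by metis
  then have "crosses (uends G e) W" "\<not> crosses (uends G f) W" using assms(3,4) by blast+
  then show False using assms(5) by simp
qed

section \<open>Spanning trees and edge counts\<close>

text \<open>Grow a vertex set from a point, each time adding one edge that leaves it; the edges used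
  stay one fewer than the vertices reached.\<close>

lemma ex_spanning_tree:
  fixes G :: "('v, 'e) ugraph"
  assumes G: "ugraph_on G" and conn: "uconnected G"
  obtains F where "F \<subseteq> uedges G" "card (uverts G) = card F + 1" "uconnected (G\<lparr>uedges := F\<rparr>)"
proof -
  \<comment> \<open>The last clause is connectedness of W with the edges F in terms of cuts, which
    avoids building an intermediate graph.\<close>
  define grown where "grown W F \<longleftrightarrow> W \<subseteq> uverts G \<and> F \<subseteq> uedges G \<and> card W = card F + 1 \<and>
      (\<forall>e \<in> F. uends G e \<subseteq> W) \<and>
      (\<forall>U. U \<subseteq> W \<longrightarrow> U \<noteq> {} \<longrightarrow> U \<noteq> W \<longrightarrow> (\<exists>e \<in> F. crosses (uends G e) U))" for W F
  have fin: "finite (uverts G)" "finite (uedges G)" using G by (auto simp: ugraph_on_def)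
  have "\<exists>W F. card W = Suc n \<and> grown W F" if "Suc n \<le> card (uverts G)" for n
    using that
  proof (induction n)
    case 0
    obtain v where v: "v \<in> uverts G" using conn by (auto simp: uconnected_def)
    have "U = {} \<or> U = {v}" if "U \<subseteq> {v}" for U using that by blast
    then have "grown {v} {}" using v by (simp add: grown_def) blast
    then show ?case by (intro exI[of _ "{v}"] exI[of _ "{}"]) simp
  next
    case (Suc n)
    then obtain W F where WF: "card W = Suc n" "grown W F" by auto
    then have W: "W \<subseteq> uverts G" "F \<subseteq> uedges G" "card W = Suc n" "card F + 1 = Suc n"
      "\<forall>e \<in> F. uends G e \<subseteq> W"
      unfolding grown_def by simp_all
    have cut: "\<exists>e \<in> F. crosses (uends G e) U" if "U \<subseteq> W" "U \<noteq> {}" "U \<noteq> W" for U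
      using WF(2) that unfolding grown_def by simp
    have "W \<noteq> {}" "W \<noteq> uverts G" using W Suc.prems by auto
    then obtain e where e: "e \<in> uedges G" "crosses (uends G e) W"
      using uconnectedD_cut[OF G conn W(1)] by blast
    obtain u v where uv: "uends G e = {u, v}" "u \<in> W" "v \<notin> W" "v \<in> uverts G"
    proof -
      obtain a b where ab: "a \<in> uverts G" "b \<in> uverts G" "uends G e = {a, b}"
        using ugraph_onE[OF G e(1)] .
      then have "a \<in> W \<and> b \<notin> W \<or> b \<in> W \<and> a \<notin> W" using e(2) by (auto simp: crosses_def)
      then show ?thesis using that ab by (metis insert_commute)
    qed
    have "e \<notin> F" using W(5) uv by auto
    \<comment> \<open>Either U separates \<open>v\<close> from all of W, and the new edge crosses
      it, or U cuts W properly and an old edge, whose ends avoid \<open>v\<close>, crosses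
      it.\<close>
    have "\<exists>f \<in> insert e F. crosses (uends G f) U" if U: "U \<subseteq> insert v W" "U \<noteq> {}" "U \<noteq> insert v W" for U
    proof (cases "U - {v} = {} \<or> U - {v} = W")
      case True
      then have "U = {v} \<or> U = W" using U by auto
      then have "crosses (uends G e) U" using uv by (auto simp: crosses_def)
      then show ?thesis by blast
    next
      case False
      then obtain f where f: "f \<in> F" "crosses (uends G f) (U - {v})" using cut[of "U - {v}"] U by auto
      then have "crosses (uends G f) U" using W(5) uv(3) unfolding crosses_def by blast
      then show ?thesis using f by blast
    qed
    moreover have "card (insert v W) = Suc (Suc n)" "card (insert e F) + 1 = Suc (Suc n)"
      using W uv \<open>e \<notin> F\<close> fin by (auto simp: card_insert_if finite_subset)
    ultimately have "grown (insert v W) (insert e F)"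
      unfolding grown_def using W(1,2,5) e(1) uv by (intro conjI allI impI) auto
    then show ?case using \<open>card (insert v W) = Suc (Suc n)\<close> by blast
  qed
  moreover have "card (uverts G) > 0" using conn fin by (auto simp: uconnected_def card_gt_0_iff)
  ultimately obtain W F where WF: "card W = card (uverts G)" "grown W F"
    by (metis Suc_pred order_refl)
  have W: "W \<subseteq> uverts G" "F \<subseteq> uedges G" "card F + 1 = card (uverts G)"
    using WF unfolding grown_def by simp_all
  have cut: "\<exists>e \<in> F. crosses (uends G e) U" if "U \<subseteq> W" "U \<noteq> {}" "U \<noteq> W" for U
    using WF(2) that unfolding grown_def by simp
  have WV: "W = uverts G" using W WF fin by (simp add: card_subset_eq)
  have "ugraph_on (G\<lparr>uedges := F\<rparr>)" using G W(2) fin unfolding ugraph_on_def by (auto intro: finite_subset)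
  then have "uconnected (G\<lparr>uedges := F\<rparr>)"
    using cut conn WV by (subst uconnected_iff_cuts) (simp_all add: uconnected_def)
  then show ?thesis using that W by simp
qed

text \<open>A spanning tree uses only edges of G. This inequality later bounds the number of cycles
  of \<open>\<gamma> \<circ> \<tau>\<close>.\<close>

lemma uconnected_card_le:
  assumes "ugraph_on G" "uconnected G"
  shows "card (uverts G) \<le> card (uedges G) + 1"
proof -
  obtain F where "F \<subseteq> uedges G" "card (uverts G) = card F + 1"
    using ex_spanning_tree[OF assms] by blast
  then show ?thesis using card_mono[OF ugraph_on_finite(2)[OF assms(1)]] by simp
qed

lemma tree_edge_bridge:
  assumes "ugraph_on G" "uconnected G" "card (uverts G) = card (uedges G) + 1" "e \<in> uedges G"
  shows "\<not> uconnected (udelete G e)"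
proof
  assume "uconnected (udelete G e)"
  then have "card (uverts G) \<le> card (uedges G - {e}) + 1"
    using uconnected_card_le[of "udelete G e"] assms(1) by simp
  moreover have "card (uedges G) > 0" using assms(1,4) by (auto simp: ugraph_on_def card_gt_0_iff)
  ultimately show False using assms(3,4) by simp
qed

text \<open>An edge outside a spanning tree could be deleted without disconnecting, so here the
  spanning tree is everything.\<close>

lemma all_bridges_card:
  assumes G: "ugraph_on G" "uconnected G"
    and bridges: "\<And>e. e \<in> uedges G \<Longrightarrow> \<not> uconnected (udelete G e)"
  shows "card (uverts G) = card (uedges G) + 1"
proof -
  obtain F where F: "F \<subseteq> uedges G" "card (uverts G) = card F + 1" "uconnected (G\<lparr>uedges := F\<rparr>)"
    using ex_spanning_tree[OF G] .
  have "F = uedges G"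
  proof (rule ccontr)
    assume "F \<noteq> uedges G"
    then obtain e where e: "e \<in> uedges G" "e \<notin> F" using F by blast
    have GF: "ugraph_on (G\<lparr>uedges := F\<rparr>)" using G F(1) unfolding ugraph_on_def by (auto intro: finite_subset)
    have "uconnected (udelete G e)"
      using e F(1) by (intro uconnected_mono[OF F(3)]) auto
    then show False using bridges e by blast
  qed
  then show ?thesis using F by simp
qed

section \<open>Degree sums and circuits\<close>

text \<open>Double counting of edge ends: an edge inside W has both ends there, a loop being counted
  twice by definition, and a crossing edge has one.\<close>

lemma udegree_sum:
  assumes G: "ugraph_on G" and W: "W \<subseteq> uverts G"
  shows "(\<Sum>v \<in> W. udegree G v) =
    2 * card {e \<in> uedges G. uends G e \<subseteq> W} + card {e \<in> uedges G. crosses (uends G e) W}"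
proof -
  have fin: "finite W" "finite (uedges G)" using G W by (auto simp: ugraph_on_def intro: finite_subset)
  define d where "d e v = (if v \<in> uends G e then if uends G e = {v} then 2 else 1 else 0 :: nat)" for e v
  have "(\<Sum>v \<in> W. udegree G v) = (\<Sum>v \<in> W. \<Sum>e \<in> uedges G. d e v)"
    unfolding udegree_def d_def using fin by (intro sum.cong refl sum.mono_neutral_cong_left) auto
  also have "\<dots> = (\<Sum>e \<in> uedges G. \<Sum>v \<in> W. d e v)" by (rule sum.swap)
  also have "\<dots> = (\<Sum>e \<in> uedges G. (if uends G e \<subseteq> W then 2 else 0) + (if crosses (uends G e) W then 1 else 0))"
  proof (rule sum.cong[OF refl])
    fix e assume "e \<in> uedges G"
    then obtain u v where uv: "uends G e = {u, v}" using ugraph_onE[OF G] by metis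
    have "(\<Sum>v \<in> W. d e v) = (\<Sum>v \<in> W \<inter> uends G e. d e v)"
      using fin by (intro sum.mono_neutral_right) (auto simp: d_def)
    also have "\<dots> = (if uends G e \<subseteq> W then 2 else 0) + (if crosses (uends G e) W then 1 else 0)"
    proof (cases "u = v")
      case True
      then show ?thesis using uv by (cases "u \<in> W") (auto simp: d_def crosses_def)
    next
      case False
      then have "d e u = 1" "d e v = 1" by (auto simp: d_def uv)
      moreover have "W \<inter> {u, v} = (if u \<in> W then {u} else {}) \<union> (if v \<in> W then {v} else {})" by auto
      ultimately show ?thesis using uv False by (auto simp: crosses_def)
    qed
    finally show "(\<Sum>v \<in> W. d e v) = (if uends G e \<subseteq> W then 2 else 0) + (if crosses (uends G e) W then 1 else 0)" .
  qed
  also have "\<dots> = 2 * card {e \<in> uedges G. uends G e \<subseteq> W} + card {e \<in> uedges G. crosses (uends G e) W}"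
    using fin by (simp add: sum.distrib sum.If_cases Collect_conj_eq[symmetric] Int_def)
  finally show ?thesis .
qed

lemma handshake:
  assumes "ugraph_on G"
  shows "(\<Sum>v \<in> uverts G. udegree G v) = 2 * card (uedges G)"
proof -
  have "{e \<in> uedges G. uends G e \<subseteq> uverts G} = uedges G" "{e \<in> uedges G. crosses (uends G e) (uverts G)} = {}"
    using ugraph_on_ends_subset[OF assms] by (auto simp: crosses_def)
  then show ?thesis using udegree_sum[OF assms order_refl] by (simp only: card.empty add_0_right)
qed

text \<open>Parity: on one side of a cut crossed by \<open>e\<close> alone the degrees within the
  circuit would sum to an odd number, while they are all 2.\<close>

lemma circuit_edge_not_bridge:
  assumes G: "ugraph_on G" "uconnected G" and H: "H \<in> circuits G" and e: "e \<in> uedges H"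
  shows "uconnected (udelete G e)"
proof (rule ccontr)
  assume "\<not> ?thesis"
  then obtain W where W: "W \<subseteq> uverts G" "\<And>f. f \<in> uedges G \<Longrightarrow> crosses (uends G f) W \<longleftrightarrow> f = e"
    using bridge_cutE[OF G] by metis
  have sub: "usubgraph H G" and deg: "\<And>v. v \<in> uverts H \<Longrightarrow> udegree H v = 2"
    using H by (auto simp: circuits_def)
  have Hg: "ugraph_on H" using ugraph_on_usubgraph G sub by blast
  define U where "U = W \<inter> uverts H"
  have "crosses (uends H f) U \<longleftrightarrow> f = e" if "f \<in> uedges H" for f
  proof -
    have "uends H f \<subseteq> uverts H" "f \<in> uedges G" "uends H f = uends G f"
      using usubgraphD[OF sub] that by auto
    then show ?thesis using W(2)[of f] unfolding U_def crosses_def by blast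
  qed
  then have "{f \<in> uedges H. crosses (uends H f) U} = {e}" using e by blast
  then have "(\<Sum>v \<in> U. udegree H v) = 2 * card {f \<in> uedges H. uends H f \<subseteq> U} + 1"
    using udegree_sum[OF Hg, of U] by (simp add: U_def)
  moreover have "(\<Sum>v \<in> U. udegree H v) = 2 * card U"
    using deg by (simp add: U_def)
  ultimately show False by presburger
qed

text \<open>The average degree is 2. Either all degrees are 2 and G itself is a circuit, or there is
  a leaf, which is pruned together with its edge; both counts drop by one.\<close>

lemma ex_circuit:
  assumes "ugraph_on G" "uconnected G" "card (uverts G) = card (uedges G)"
  shows "circuits G \<noteq> {}"
  using assms
proof (induction "card (uverts G)" arbitrary: G rule: less_induct)
  case less
  note G = less.prems
  have fin: "finite (uverts G)" "finite (uedges G)" using G by (auto simp: ugraph_on_def)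
  show ?case
  proof (cases "\<exists>w \<in> uverts G. udegree G w < 2")
    case False
    then have ge: "\<And>v. v \<in> uverts G \<Longrightarrow> udegree G v \<ge> 2" by force
    have "(\<Sum>v \<in> uverts G. udegree G v) = (\<Sum>v \<in> uverts G. 2)"
      using handshake[OF G(1)] G(3) by simp
    then have "udegree G v = 2" if "v \<in> uverts G" for v
      using that ge sum_mono_inv[of "\<lambda>_. 2" "uverts G" "udegree G" v] fin by simp
    then have "G \<in> circuits G"
      using G ugraph_on_ends_subset[OF G(1)] by (auto simp: circuits_def usubgraph_def)
    then show ?thesis by blast
  next
    case True
    then obtain w where w: "w \<in> uverts G" "udegree G w < 2" by blast
    define E where "E = {e \<in> uedges G. w \<in> uends G e}"
    have deg: "udegree G w = (\<Sum>e \<in> E. if uends G e = {w} then 2 else 1)" by (simp add: udegree_def E_def)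
    have finE: "finite E" using fin by (simp add: E_def)
    \<comment> \<open>On one vertex the single edge would be a loop, which contributes 2 to the
      degree.\<close>
    have "card (uverts G) > 1"
    proof (rule ccontr)
      assume "\<not> ?thesis"
      moreover have "card (uverts G) > 0" using w fin by (auto simp: card_gt_0_iff)
      ultimately have "card (uverts G) = 1" by simp
      then have "uverts G = {w}" using w(1) by (metis card_1_singletonE singletonD)
      then have "card (uedges G) = 1" using G by simp
      then obtain e where e: "uedges G = {e}" using card_1_singletonE by blast
      then have "uends G e = {w}" using ugraph_onE[OF G(1), of e] \<open>uverts G = {w}\<close> by auto
      then show False using w deg e by (simp add: E_def)
    qed
    then have "{w} \<noteq> uverts G" by (metis One_nat_def card.empty card.insert empty_iff finite.emptyI less_irrefl)
    then obtain f where f: "f \<in> uedges G" "crosses (uends G f) {w}" using uconnectedD_cut[OF G(1,2), of "{w}"] w by auto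
    then have fE: "f \<in> E" by (auto simp: E_def crosses_def)
    have "card E \<le> (\<Sum>e \<in> E. if uends G e = {w} then 2 else 1)"
      using sum_mono[of E "\<lambda>_. 1::nat"] by simp
    then have "card E \<le> 1" using deg w by simp
    then have Ef: "E = {f}" using fE finE card_le_Suc0_iff_eq[of E] by auto
    define H where "H = G\<lparr>uverts := uverts G - {w}, uedges := uedges G - {f}\<rparr>"
    have Hs: "uverts H = uverts G - {w}" "uedges H = uedges G - {f}" "uends H = uends G" by (simp_all add: H_def)
    have nw: "w \<notin> uends G e" if "e \<in> uedges G - {f}" for e using that Ef by (auto simp: E_def)
    have "uends G e \<subseteq> uverts G - {w}" if "e \<in> uedges G - {f}" for e
      using that nw ugraph_on_ends_subset[OF G(1), of e] by auto
    then have sub: "usubgraph H G" by (auto simp: usubgraph_def Hs)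
    then have Hg: "ugraph_on H" using ugraph_on_usubgraph G by blast
    obtain x where x: "uends G f = {w, x}" "x \<noteq> w" "x \<in> uverts G"
    proof -
      obtain a b where ab: "a \<in> uverts G" "b \<in> uverts G" "uends G f = {a, b}"
        using ugraph_onE[OF G(1) f(1)] .
      then have "a = w \<and> b \<noteq> w \<or> b = w \<and> a \<noteq> w" using f(2) by (auto simp: crosses_def)
      then show ?thesis using that ab by (metis insert_commute)
    qed
    have "uconnected H"
    proof (subst uconnected_iff_cuts[OF Hg], intro conjI allI impI)
      show "uverts H \<noteq> {}" using x by (auto simp: Hs)
      fix U assume U: "U \<subseteq> uverts H" "U \<noteq> {}" "U \<noteq> uverts H"
      \<comment> \<open>\<open>w\<close> is put on the side of its only neighbour \<open>x\<close>,
        so that the pruned edge does not cross.\<close>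
      define U' where "U' = U \<union> (if x \<in> U then {w} else {})"
      have "U' \<subseteq> uverts G" "U' \<noteq> {}" "U' \<noteq> uverts G" using U w x by (auto simp: U'_def Hs split: if_splits)
      then obtain e where e: "e \<in> uedges G" "crosses (uends G e) U'" using uconnectedD_cut[OF G(1,2)] by blast
      have "e \<noteq> f" using e(2) x U by (auto simp: crosses_def U'_def Hs split: if_splits)
      then have "w \<notin> uends G e" using nw e by blast
      then have "crosses (uends G e) U" using e(2) by (auto simp: crosses_def U'_def split: if_splits)
      then show "\<exists>e \<in> uedges H. crosses (uends H e) U" using e \<open>e \<noteq> f\<close> by (auto simp: Hs)
    qed
    moreover have "card (uverts H) = card (uedges H)" "card (uverts H) < card (uverts G)"
      using G(3) w(1) f(1) fin card_Diff1_less[of "uverts G" w] by (simp_all add: Hs)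
    ultimately obtain C where "C \<in> circuits H" using less.hyps[of H] Hg by blast
    then have "C \<in> circuits G" using circuits_mono[OF sub] by blast
    then show ?thesis by blast
  qed
qed

lemma circuit_edges_nonempty:
  assumes "H \<in> circuits G"
  shows "uedges H \<noteq> {}"
proof
  assume e: "uedges H = {}"
  have "uverts H \<noteq> {}" and deg: "\<forall>v \<in> uverts H. udegree H v = 2"
    using assms unfolding circuits_def uconnected_def by blast+
  then obtain v where "v \<in> uverts H" by blast
  moreover have "udegree H v = 0" using e by (simp add: udegree_def)
  ultimately show False using deg by simp
qed

lemma circuits_udelete: "circuits (udelete G e) = {H \<in> circuits G. e \<notin> uedges H}"
proof -
  have "usubgraph H (udelete G e) \<longleftrightarrow> usubgraph H G \<and> e \<notin> uedges H" for H
    unfolding usubgraph_def udelete_simps by blast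
  then show ?thesis unfolding circuits_def by blast
qed

text \<open>Acyclicity becomes a count. In one direction, a circuit edge is no bridge although each
  edge of a graph with this count is one; in the other, a spanning tree with one extra edge has
  equally many vertices and edges and thus a circuit.\<close>

lemma utree_iff_card:
  assumes G: "ugraph_on G"
  shows "utree G \<longleftrightarrow> uconnected G \<and> card (uverts G) = card (uedges G) + 1"
proof (cases "uconnected G")
  case conn: True
  have "circuits G = {}" if c: "card (uverts G) = card (uedges G) + 1"
  proof (rule ccontr)
    assume "circuits G \<noteq> {}"
    then obtain H e where "H \<in> circuits G" "e \<in> uedges H" using circuit_edges_nonempty by blast
    moreover then have "e \<in> uedges G" by (auto simp: circuits_def usubgraph_def)
    ultimately show False using circuit_edge_not_bridge[OF G conn] tree_edge_bridge[OF G conn c] by blast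
  qed
  moreover have "card (uverts G) = card (uedges G) + 1" if c: "circuits G = {}"
  proof -
    obtain F where F: "F \<subseteq> uedges G" "card (uverts G) = card F + 1" "uconnected (G\<lparr>uedges := F\<rparr>)"
      using ex_spanning_tree[OF G conn] .
    have "F = uedges G"
    proof (rule ccontr)
      assume "F \<noteq> uedges G"
      then obtain e where e: "e \<in> uedges G" "e \<notin> F" using F by blast
      define H where "H = G\<lparr>uedges := insert e F\<rparr>"
      have GF: "ugraph_on (G\<lparr>uedges := F\<rparr>)" and GH: "ugraph_on H"
        using G F(1) e unfolding ugraph_on_def H_def by (auto intro: finite_subset)
      have "uconnected H"
        by (intro uconnected_mono[OF F(3)]) (auto simp: H_def)
      moreover have "card (uverts H) = card (uedges H)"
        using F e G by (simp add: H_def ugraph_on_def finite_subset)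
      ultimately obtain C where "C \<in> circuits H" using ex_circuit GH by blast
      moreover have "usubgraph H G"
        using F(1) e(1) ugraph_on_ends_subset[OF G] unfolding usubgraph_def H_def by auto
      ultimately have "C \<in> circuits G" using circuits_mono by blast
      then show False using c by blast
    qed
    then show ?thesis using F by simp
  qed
  ultimately show ?thesis using conn by (auto simp: utree_def)
qed (simp add: utree_def)


section \<open>Connected graphs with exactly one circuit\<close>

lemma circuits_subset_not_bridges:
  assumes G: "ugraph_on G" "uconnected G" and "H \<in> circuits G"
  shows "uedges H \<subseteq> {e \<in> uedges G. uconnected (udelete G e)}"
proof -
  have "uedges H \<subseteq> uedges G" using assms(3) usubgraphD(2)[of H G] by (simp add: circuits_def)
  then show ?thesis using circuit_edge_not_bridge[OF assms] by blast
qed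

text \<open>Deleting a non-bridge leaves a tree, so every circuit contains every non-bridge, and it
  contains no other edge. Hence all circuits have the same edges; having no isolated vertices, they
  coincide.\<close>

lemma unicyclic_circuits:
  assumes G: "ugraph_on G" "uconnected G" and card: "card (uverts G) = card (uedges G)"
  obtains C where "circuits G = {C}" "uedges C = {e \<in> uedges G. uconnected (udelete G e)}"
proof -
  have edges: "uedges H = {e \<in> uedges G. uconnected (udelete G e)}" if H: "H \<in> circuits G" for H
  proof
    show "{e \<in> uedges G. uconnected (udelete G e)} \<subseteq> uedges H"
    proof clarify
      fix e assume e: "e \<in> uedges G" "uconnected (udelete G e)"
      have "card (uedges G) > 0" using e ugraph_on_finite(2)[OF G(1)] by (auto simp: card_gt_0_iff)
      then have "card (uverts (udelete G e)) = card (uedges (udelete G e)) + 1"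
        using card e(1) by simp
      then have "utree (udelete G e)" using e(2) G(1) by (simp add: utree_iff_card)
      then have "circuits (udelete G e) = {}" by (simp add: utree_def)
      then show "e \<in> uedges H" using H by (simp add: circuits_udelete)
    qed
  qed (rule circuits_subset_not_bridges[OF G H])
  obtain C where C: "C \<in> circuits G" using ex_circuit[OF G card] by blast
  have verts: "uverts H = \<Union> (uends G ` uedges H)" if H: "H \<in> circuits G" for H
  proof
    have sub: "usubgraph H G" and deg: "\<forall>v \<in> uverts H. udegree H v = 2" using H by (simp_all add: circuits_def)
    show "uverts H \<subseteq> \<Union> (uends G ` uedges H)"
    proof
      fix v assume v: "v \<in> uverts H"
      have "{e \<in> uedges H. v \<in> uends H e} \<noteq> {}"
      proof
        assume "{e \<in> uedges H. v \<in> uends H e} = {}"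
        then have "udegree H v = 0" unfolding udegree_def by (metis sum.empty)
        then show False using deg v by simp
      qed
      then show "v \<in> \<Union> (uends G ` uedges H)" using usubgraphD(3)[OF sub] by auto
    qed
    show "\<Union> (uends G ` uedges H) \<subseteq> uverts H"
      using usubgraphD(4)[OF sub] unfolding usubgraphD(3)[OF sub] by blast
  qed
  have "H = C" if H: "H \<in> circuits G" for H
  proof -
    have "uends H = uends G" "uends C = uends G"
      using H C usubgraphD(3)[of H G] usubgraphD(3)[of C G] by (simp_all add: circuits_def)
    then show ?thesis using edges[OF H] edges[OF C] verts[OF H] verts[OF C] by (intro ugraph.equality) simp_all
  qed
  then have "circuits G = {C}" using C by blast
  then show ?thesis using that edges[OF C] by blast
qed

text \<open>Deleting an edge of the only circuit destroys every circuit without disconnecting, so a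
  tree is left.\<close>

lemma single_circuit_card:
  assumes G: "ugraph_on G" "uconnected G" and C: "circuits G = {C}"
  shows "card (uverts G) = card (uedges G)"
proof -
  obtain e where e: "e \<in> uedges C" using circuit_edges_nonempty[of C G] C by auto
  then have eG: "e \<in> uedges G" "uconnected (udelete G e)"
    using circuits_subset_not_bridges[OF G, of C] C by auto
  have "circuits (udelete G e) = {}" using C e by (auto simp: circuits_udelete)
  then have "utree (udelete G e)" using eG by (simp add: utree_def)
  then have "card (uverts G) = card (uedges G - {e}) + 1" using G by (simp add: utree_iff_card)
  moreover have "card (uedges G) > 0" using eG ugraph_on_finite(2)[OF G(1)] by (auto simp: card_gt_0_iff)
  ultimately show ?thesis using eG by simp
qed

text \<open>One deletion already reaches the edge count of a tree, where each remaining edge is a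
  bridge.\<close>

lemma unicyclic_udelete_bridge:
  assumes G: "ugraph_on G" and card: "card (uverts G) = card (uedges G)"
    and e: "e \<in> uedges G" "uconnected (udelete G e)" and f: "f \<in> uedges G" "f \<noteq> e"
  shows "\<not> uconnected (udelete (udelete G e) f)"
proof -
  have "card (uedges G) > 0" using e ugraph_on_finite(2)[OF G] by (auto simp: card_gt_0_iff)
  then have "card (uverts (udelete G e)) = card (uedges (udelete G e)) + 1"
    using card e(1) by simp
  then show ?thesis using tree_edge_bridge[of "udelete G e" f] G e f by simp
qed

text \<open>A single edge supplies degree 2 at a vertex only by being counted twice there.\<close>

lemma circuit_one_edge_loop:
  assumes "ugraph_on G" "H \<in> circuits G" "uedges H = {e}"
  obtains v where "uends G e = {v}"
proof -
  have sub: "usubgraph H G" and deg: "\<forall>v \<in> uverts H. udegree H v = 2" and ne: "uverts H \<noteq> {}"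
    using assms(2) by (simp_all add: circuits_def uconnected_def)
  obtain v where v: "v \<in> uverts H" using ne by blast
  have "uends H e = {v}"
  proof (rule ccontr)
    assume "uends H e \<noteq> {v}"
    then have "\<forall>f \<in> {f \<in> uedges H. v \<in> uends H f}. uends H f \<noteq> {v}" using assms(3) by auto
    then have "udegree H v = card {f \<in> uedges H. v \<in> uends H f}" unfolding udegree_def by simp
    also have "\<dots> \<le> card {e}" using assms(3) by (intro card_mono) auto
    finally show False using deg v by simp
  qed
  then show ?thesis using that usubgraphD(3)[OF sub] by simp
qed

text \<open>An end of one edge missed by the other would have to get degree 2 from a loop; that loop
  would be cut off from the other edge, against connectedness of the circuit.\<close>

lemma circuit_two_edges_parallel:
  assumes G: "ugraph_on G" and H: "H \<in> circuits G" and e: "uedges H = {e, f}" "e \<noteq> f"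
  shows "uends G e = uends G f"
proof -
  have sub: "usubgraph H G" and deg: "\<forall>v \<in> uverts H. udegree H v = 2" and conn: "uconnected H"
    using H by (simp_all add: circuits_def)
  have Hg: "ugraph_on H" using ugraph_on_usubgraph[OF G sub] .
  have U: "uends H = uends G" using usubgraphD(3)[OF sub] .
  have *: "uends G e' \<subseteq> uends G f'" if ef: "uedges H = {e', f'}" "e' \<noteq> f'" for e' f'
  proof
    fix v assume v: "v \<in> uends G e'"
    have ve: "v \<in> uends H e'" "v \<in> uverts H" using v ef usubgraphD(4)[OF sub, of e'] U by auto
    show "v \<in> uends G f'"
    proof (rule ccontr)
      assume nf: "v \<notin> uends G f'"
      then have "{g \<in> uedges H. v \<in> uends H g} = {e'}" using ve ef U by auto
      then have "udegree H v = (if uends H e' = {v} then 2 else 1)" by (simp add: udegree_def)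
      then have loop: "uends H e' = {v}" using deg ve by (auto split: if_splits)
      obtain w where w: "w \<in> uends H f'" "w \<in> uverts H" using ugraph_onE[OF Hg, of f'] ef by blast
      then have "w \<noteq> v" using nf U by auto
      then obtain g where "g \<in> uedges H" "crosses (uends H g) {v}"
        using uconnectedD_cut[OF Hg conn, of "{v}"] ve w by blast
      then show False using ef loop nf U by (auto simp: crosses_def)
    qed
  qed
  show ?thesis using *[of e f] *[of f e] e by (simp add: insert_commute)
qed


section \<open>Quotients of permutations by pairings\<close>

lemma orbit_subset_closed:
  assumes "f ` S \<subseteq> S" "x \<in> S"
  shows "orbit f x \<subseteq> S"
proof
  fix y assume "y \<in> orbit f x"
  then show "y \<in> S" by induction (use assms in auto)
qed

lemma orbit_eq_orbit:
  assumes "permutation f" "y \<in> orbit f x"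
  shows "orbit f y = orbit f x"
  using orbit_cyclic_eq3[OF cyclic_on_orbit'[OF assms(1)] assms(2)] .

lemma partition_on_perm_cycles:
  assumes "permutation f" "f ` S \<subseteq> S"
  shows "partition_on S (perm_cycles S f)"
proof (rule partition_onI)
  show "\<Union> (perm_cycles S f) = S"
    using orbit_subset_closed[OF assms(2)] permutation_self_in_orbit[OF assms(1)]
    by (auto simp: perm_cycles_def)
  show "disjnt p q" if pq: "p \<in> perm_cycles S f" "q \<in> perm_cycles S f" "p \<noteq> q" for p q
  proof (rule ccontr)
    assume "\<not> disjnt p q"
    then obtain z where z: "z \<in> p" "z \<in> q" by (auto simp: disjnt_iff)
    obtain x y where "p = orbit f x" "q = orbit f y" using pq(1,2) by (auto simp: perm_cycles_def)
    then have "p = orbit f z" "q = orbit f z" using orbit_eq_orbit[OF assms(1), of z] z by blast+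
    then show False using pq(3) by simp
  qed
  show "{} \<notin> perm_cycles S f" using permutation_self_in_orbit[OF assms(1)] by (auto simp: perm_cycles_def)
qed

lemma block_of_eq:
  assumes "partition_on S P" "B \<in> P" "x \<in> B"
  shows "block_of P x = B"
proof -
  have "C = B" if "C \<in> P \<and> x \<in> C" for C
    using partition_onD2[OF assms(1)] assms that by (auto simp: disjoint_def)
  moreover have "B \<in> P \<and> x \<in> B" using assms(2,3) by simp
  ultimately show ?thesis unfolding block_of_def by (rule the_equality[rotated])
qed

lemma block_of_in:
  assumes "partition_on S P" "x \<in> S"
  shows "block_of P x \<in> P" "x \<in> block_of P x"
proof -
  obtain B where "B \<in> P" "x \<in> B" using partition_onD1[OF assms(1)] assms(2) by auto
  then show "block_of P x \<in> P" "x \<in> block_of P x" using block_of_eq[OF assms(1)] by auto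
qed

lemma partition_on_blocks:
  assumes "partition_on S P"
  shows "P = block_of P ` S"
proof
  show "block_of P ` S \<subseteq> P" using block_of_in(1)[OF assms] by auto
  show "P \<subseteq> block_of P ` S"
  proof
    fix B assume B: "B \<in> P"
    then obtain x where "x \<in> B" using partition_onD3[OF assms] by (metis equals0I)
    then show "B \<in> block_of P ` S"
      using block_of_eq[OF assms B] partition_onD1[OF assms] B by (auto intro!: rev_image_eqI[of x])
  qed
qed

lemma block_of_perm_cycles:
  assumes "permutation f" "f ` S \<subseteq> S" "x \<in> S"
  shows "block_of (perm_cycles S f) x = orbit f x"
  using assms block_of_eq[OF partition_on_perm_cycles[OF assms(1,2)], of "orbit f x" x]
    permutation_self_in_orbit[OF assms(1)] by (auto simp: perm_cycles_def)

section \<open>Pairings as involutions without fixed points\<close>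

definition pairing :: "'a set \<Rightarrow> ('a \<Rightarrow> 'a) \<Rightarrow> bool" where
  "pairing S \<tau> \<longleftrightarrow> \<tau> permutes S \<and> (\<forall>x \<in> S. \<tau> x \<noteq> x \<and> \<tau> (\<tau> x) = x)"

lemma pairingD:
  assumes "pairing S \<tau>"
  shows "\<tau> permutes S" "x \<in> S \<Longrightarrow> \<tau> x \<in> S" "x \<in> S \<Longrightarrow> \<tau> x \<noteq> x" "\<tau> (\<tau> x) = x"
proof -
  show p: "\<tau> permutes S" using assms by (simp add: pairing_def)
  show "x \<in> S \<Longrightarrow> \<tau> x \<in> S" using p by (simp add: permutes_in_image)
  show "x \<in> S \<Longrightarrow> \<tau> x \<noteq> x" using assms by (simp add: pairing_def)
  show "\<tau> (\<tau> x) = x"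
    using assms permutes_not_in[OF p, of x] by (cases "x \<in> S") (simp_all add: pairing_def)
qed

lemma orbit_pairing:
  assumes "pairing S \<tau>"
  shows "orbit \<tau> x = {x, \<tau> x}"
proof
  show "orbit \<tau> x \<subseteq> {x, \<tau> x}"
    using pairingD(4)[OF assms] by (intro orbit_subset_closed) auto
  have "\<tau> x \<in> orbit \<tau> x" by (rule orbit.base)
  moreover from orbit.step[OF this] have "x \<in> orbit \<tau> x" using pairingD(4)[OF assms] by simp
  ultimately show "{x, \<tau> x} \<subseteq> orbit \<tau> x" by simp
qed

lemma perm_cycles_pairing:
  assumes "pairing S \<tau>"
  shows "perm_cycles S \<tau> = (\<lambda>x. {x, \<tau> x}) ` S"
  unfolding perm_cycles_def using orbit_pairing[OF assms] by simp

lemma pairing_iff_card_cycles: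
  assumes "finite S"
  shows "pairing S \<tau> \<longleftrightarrow> \<tau> permutes S \<and> (\<forall>C \<in> perm_cycles S \<tau>. card C = 2)"
proof
  assume p: "pairing S \<tau>"
  then show "\<tau> permutes S \<and> (\<forall>C \<in> perm_cycles S \<tau>. card C = 2)"
    using pairingD(1,3)[OF p] unfolding perm_cycles_pairing[OF p] by (auto simp: card_2_iff' intro: not_sym)
next
  assume *: "\<tau> permutes S \<and> (\<forall>C \<in> perm_cycles S \<tau>. card C = 2)"
  then have perm: "permutation \<tau>" using assms permutation_permutes by blast
  have "\<tau> x \<noteq> x \<and> \<tau> (\<tau> x) = x" if x: "x \<in> S" for x
  proof
    have c: "card (orbit \<tau> x) = 2" using * x by (simp add: perm_cycles_def)
    show ne: "\<tau> x \<noteq> x"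
    proof
      assume "\<tau> x = x"
      then have "orbit \<tau> x = {x}" by (simp add: orbit_eq_singleton_iff)
      then show False using c by simp
    qed
    have "x \<in> orbit \<tau> x" "\<tau> x \<in> orbit \<tau> x" using permutation_self_in_orbit[OF perm] by (auto intro: orbit.base)
    moreover obtain u v where "orbit \<tau> x = {u, v}" using c by (meson card_2_iff)
    ultimately have o: "orbit \<tau> x = {x, \<tau> x}" using ne by auto
    have "\<tau> (\<tau> x) \<in> orbit \<tau> x" by (intro orbit.step orbit.base)
    moreover have "\<tau> (\<tau> x) \<noteq> \<tau> x" using ne * by (metis permutes_inverses(2))
    ultimately show "\<tau> (\<tau> x) = x" using o by simp
  qed
  then show "pairing S \<tau>" using * by (simp add: pairing_def)
qed

lemma card_perm_cycles_pairing:
  assumes "finite S" "pairing S \<tau>"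
  shows "2 * card (perm_cycles S \<tau>) = card S"
proof -
  have perm: "permutation \<tau>" using assms pairingD(1) permutation_permutes by blast
  have "\<tau> ` S \<subseteq> S" using pairingD(2)[OF assms(2)] by auto
  then have part: "partition_on S (perm_cycles S \<tau>)" using partition_on_perm_cycles perm by blast
  have "2 * card (perm_cycles S \<tau>) = card (\<Union> (perm_cycles S \<tau>))"
  proof (rule card_partition)
    show "finite (perm_cycles S \<tau>)" using assms by (simp add: perm_cycles_def)
    show "finite (\<Union> (perm_cycles S \<tau>))" using partition_onD1[OF part] assms by simp
    show "card c = 2" if "c \<in> perm_cycles S \<tau>" for c using pairing_iff_card_cycles[OF assms(1)] assms(2) that by blast
    show "c1 \<inter> c2 = {}" if "c1 \<in> perm_cycles S \<tau>" "c2 \<in> perm_cycles S \<tau>" "c1 \<noteq> c2" for c1 c2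
      using partition_onD2[OF part] that by (simp add: disjoint_def)
  qed
  then show ?thesis using partition_onD1[OF part] by simp
qed

section \<open>The quotient graph with pairs as edges\<close>

text \<open>One interface for the quotients of one cycle, of two cycles and of all three.\<close>

definition quotient_on :: "'a set \<Rightarrow> ('a \<Rightarrow> 'a) \<Rightarrow> 'a set set \<Rightarrow> ('a set, 'a) pre_digraph" where
  "quotient_on S \<gamma> P = quotient_digraph \<lparr>verts = S, arcs = S, tail = \<gamma>, head = (\<lambda>i. i)\<rparr> P"

lemma quotient_on_simps [simp]:
  "verts (quotient_on S \<gamma> P) = P" "arcs (quotient_on S \<gamma> P) = S"
  "tail (quotient_on S \<gamma> P) e = block_of P (\<gamma> e)" "head (quotient_on S \<gamma> P) e = block_of P e"
  by (simp_all add: quotient_on_def quotient_digraph_def)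

text \<open>Vertices and ends are those of the elementarization, but there is one edge for each
  cycle of \<tau>: parallel pairs stay different edges, so for every partition the number of edges
  is half of \<open>card S\<close>.\<close>

definition pairing_graph :: "'a set \<Rightarrow> ('a \<Rightarrow> 'a) \<Rightarrow> ('a \<Rightarrow> 'a) \<Rightarrow> 'a set set \<Rightarrow> ('a set, 'a set) ugraph" where
  "pairing_graph S \<gamma> \<tau> P = (elementarization (quotient_on S \<gamma> P))\<lparr>uedges := perm_cycles S \<tau>\<rparr>"

text \<open>Elements of S are oriented edges, x going from \<open>\<gamma> x\<close> to x. The last
  assumption says that x and \<open>\<tau> x\<close> have opposite orientations: the tail of x is
  the head of \<open>\<tau> x\<close> and, applied to \<open>\<tau> x\<close>, conversely.\<close>

locale darts =
  fixes S :: "'a set" and \<gamma> \<tau> :: "'a \<Rightarrow> 'a" and P :: "'a set set"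
  assumes finite_S: "finite S" and nonempty_S: "S \<noteq> {}" and perm_\<gamma>: "permutation \<gamma>" and \<gamma>_S: "\<gamma> ` S \<subseteq> S"
    and pairing_\<tau>: "pairing S \<tau>" and part: "partition_on S P"
    and block_\<gamma>: "x \<in> S \<Longrightarrow> block_of P (\<gamma> x) = block_of P (\<tau> x)"
begin

abbreviation "M \<equiv> pairing_graph S \<gamma> \<tau> P"
abbreviation "blk \<equiv> block_of P"

lemmas \<tau>_perm = pairingD(1)[OF pairing_\<tau>]
  and \<tau>_S = pairingD(2)[OF pairing_\<tau>]
  and \<tau>_neq = pairingD(3)[OF pairing_\<tau>]
  and \<tau>_\<tau> [simp] = pairingD(4)[OF pairing_\<tau>]
  and blk_in = block_of_in(1)[OF part]
  and blk_self = block_of_in(2)[OF part]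

lemma uverts_M: "uverts M = P" by (simp add: pairing_graph_def elementarization_def)

lemma uedges_M: "uedges M = (\<lambda>x. {x, \<tau> x}) ` S"
  using perm_cycles_pairing[OF pairing_\<tau>] by (simp add: pairing_graph_def)

lemma uedges_M_iff: "x \<in> S \<Longrightarrow> {x, \<tau> x} \<in> uedges M"
  by (simp add: uedges_M)

lemma uends_M: "x \<in> S \<Longrightarrow> uends M {x, \<tau> x} = {blk x, blk (\<tau> x)}"
  using block_\<gamma>[of x] block_\<gamma>[of "\<tau> x"] \<tau>_S[of x]
  by (auto simp: pairing_graph_def elementarization_def)

lemma edge_eq_iff: "x \<in> S \<Longrightarrow> y \<in> S \<Longrightarrow> {x, \<tau> x} = {y, \<tau> y} \<longleftrightarrow> y = x \<or> y = \<tau> x"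
  using \<tau>_\<tau> by (auto simp: doubleton_eq_iff)

lemma finite_P: "finite P" using finite_elements[OF finite_S part] .

lemma ugraph_M: "ugraph_on M"
  unfolding ugraph_on_def uverts_M
proof (intro conjI ballI)
  show "finite (uedges M)" using finite_S by (simp add: uedges_M)
  fix e assume "e \<in> uedges M"
  then obtain x where x: "x \<in> S" "e = {x, \<tau> x}" by (auto simp: uedges_M)
  then show "\<exists>u \<in> P. \<exists>v \<in> P. uends M e = {u, v}"
    using uends_M[OF x(1)] blk_in[of x] blk_in[of "\<tau> x"] \<tau>_S[of x]
    by (intro bexI[of _ "blk x"] bexI[of _ "blk (\<tau> x)"]) simp_all
qed (rule finite_P)

lemma card_uedges_M: "2 * card (uedges M) = card S"
  using card_perm_cycles_pairing[OF finite_S pairing_\<tau>] by (simp add: pairing_graph_def)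

lemma crosses_M: "x \<in> S \<Longrightarrow> crosses (uends M {x, \<tau> x}) W \<longleftrightarrow> (blk x \<in> W) \<noteq> (blk (\<tau> x) \<in> W)"
  using uends_M[of x] by (auto simp: crosses_def)

lemma not_crosses_iff:
  "(\<forall>e \<in> uedges M. \<not> crosses (uends M e) W) \<longleftrightarrow> (\<forall>x \<in> S. blk x \<in> W \<longleftrightarrow> blk (\<tau> x) \<in> W)"
  using crosses_M by (auto simp: uedges_M)

text \<open>The elements of S whose block lies on one side of an uncrossed cut form a set closed
  under \<gamma> and \<tau>.\<close>

lemma uconnected_M:
  assumes "\<And>X. X \<subseteq> S \<Longrightarrow> X \<noteq> {} \<Longrightarrow> (\<And>x. x \<in> X \<Longrightarrow> \<gamma> x \<in> X) \<Longrightarrow> (\<And>x. x \<in> X \<Longrightarrow> \<tau> x \<in> X) \<Longrightarrow> X = S"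
  shows "uconnected M"
proof (rule ccontr)
  assume nc: "\<not> uconnected M"
  have ne: "uverts M \<noteq> {}" using nonempty_S blk_in by (auto simp: uverts_M)
  obtain W where W: "W \<subseteq> P" "W \<noteq> {}" "W \<noteq> P" "\<And>e. e \<in> uedges M \<Longrightarrow> \<not> crosses (uends M e) W"
    using not_uconnectedE[OF ugraph_M nc ne] unfolding uverts_M by metis
  have cl: "blk x \<in> W \<longleftrightarrow> blk (\<tau> x) \<in> W" if "x \<in> S" for x
    using W(4) not_crosses_iff that by blast
  define X where "X = {x \<in> S. blk x \<in> W}"
  have "X = S"
  proof (rule assms)
    obtain B where "B \<in> W" using W by blast
    moreover then have "B \<in> blk ` S" using partition_on_blocks[OF part] W(1) by (metis subsetD)
    ultimately obtain x where "x \<in> S" "blk x = B" "B \<in> W" by auto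
    then show "X \<noteq> {}" by (auto simp: X_def)
    show "\<gamma> x \<in> X" if "x \<in> X" for x using that cl block_\<gamma> \<gamma>_S by (auto simp: X_def)
    show "\<tau> x \<in> X" if "x \<in> X" for x using that cl \<tau>_S by (auto simp: X_def)
  qed (auto simp: X_def)
  then have "blk ` S \<subseteq> W" by (auto simp: X_def)
  then have "P \<subseteq> W" using partition_on_blocks[OF part] by metis
  then show False using W by blast
qed

text \<open>Cuts are balanced along every union of faces, since \<open>\<gamma> x\<close> and \<open>\<tau> x\<close> lie in the same block.\<close>

lemma cut_balanced:
  assumes "C \<subseteq> S" "\<gamma> ` C \<subseteq> C"
  shows "card {x \<in> C. blk x \<in> W \<and> blk (\<tau> x) \<notin> W} = card {x \<in> C. blk x \<notin> W \<and> blk (\<tau> x) \<in> W}"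
proof -
  have finC: "finite C" using assms finite_S finite_subset by blast
  have inj: "inj \<gamma>" using perm_\<gamma> permutation_bijective bij_is_inj by blast
  then have img: "\<gamma> ` C = C"
    using assms(2) finC by (meson endo_inj_surj inj_on_subset subset_UNIV)
  have "{x \<in> C. blk x \<in> W} = \<gamma> ` {x \<in> C. blk (\<gamma> x) \<in> W}"
  proof (intro set_eqI iffI)
    fix y assume y: "y \<in> {x \<in> C. blk x \<in> W}"
    then obtain x where "x \<in> C" "y = \<gamma> x" using img by auto
    then show "y \<in> \<gamma> ` {x \<in> C. blk (\<gamma> x) \<in> W}" using y by auto
  qed (use assms(2) in auto)
  then have "card {x \<in> C. blk x \<in> W} = card {x \<in> C. blk (\<gamma> x) \<in> W}"
    using card_image[OF inj_on_subset[OF inj subset_UNIV], of "{x \<in> C. blk (\<gamma> x) \<in> W}"] by simp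
  also have "{x \<in> C. blk (\<gamma> x) \<in> W} = {x \<in> C. blk (\<tau> x) \<in> W}"
    using block_\<gamma> assms(1) by auto
  finally have eq: "card {x \<in> C. blk x \<in> W} = card {x \<in> C. blk (\<tau> x) \<in> W}" .
  have "card {x \<in> C. blk x \<in> W} = card {x \<in> C. blk x \<in> W \<and> blk (\<tau> x) \<notin> W} + card {x \<in> C. blk x \<in> W \<and> blk (\<tau> x) \<in> W}"
    using finC by (subst card_Un_disjoint[symmetric]) (auto intro: arg_cong[where f = card])
  moreover have "card {x \<in> C. blk (\<tau> x) \<in> W} = card {x \<in> C. blk x \<notin> W \<and> blk (\<tau> x) \<in> W} + card {x \<in> C. blk x \<in> W \<and> blk (\<tau> x) \<in> W}"
    using finC by (subst card_Un_disjoint[symmetric]) (auto intro: arg_cong[where f = card])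
  ultimately show ?thesis using eq by simp
qed

text \<open>A cut crossed by the pair of \<open>a\<close> alone would be crossed exactly once along
  C, by \<open>a\<close>, as \<open>\<tau> a\<close> lies outside; balance allows only an even
  number.\<close>

lemma separated_not_bridge:
  assumes conn: "uconnected M" and C: "C \<subseteq> S" "\<gamma> ` C \<subseteq> C" and a: "a \<in> C" "\<tau> a \<notin> C"
  shows "uconnected (udelete M {a, \<tau> a})"
proof (rule ccontr)
  assume "\<not> ?thesis"
  then obtain W where W: "\<And>f. f \<in> uedges M \<Longrightarrow> crosses (uends M f) W \<longleftrightarrow> f = {a, \<tau> a}"
    using bridge_cutE[OF ugraph_M conn] by metis
  have aS: "a \<in> S" using a C by auto
  have cr: "(blk x \<in> W) \<noteq> (blk (\<tau> x) \<in> W) \<longleftrightarrow> x = a \<or> x = \<tau> a" if "x \<in> S" for x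
    using W[OF uedges_M_iff[OF that]] crosses_M[OF that] edge_eq_iff[OF aS that] by auto
  have "{x \<in> C. blk x \<in> W \<and> blk (\<tau> x) \<notin> W} \<union> {x \<in> C. blk x \<notin> W \<and> blk (\<tau> x) \<in> W} = {a}"
    using cr C(1) a by auto
  moreover have "finite C" using C(1) finite_S finite_subset by blast
  moreover have "{x \<in> C. blk x \<in> W \<and> blk (\<tau> x) \<notin> W} \<inter> {x \<in> C. blk x \<notin> W \<and> blk (\<tau> x) \<in> W} = {}" by auto
  ultimately have "card {x \<in> C. blk x \<in> W \<and> blk (\<tau> x) \<notin> W} + card {x \<in> C. blk x \<notin> W \<and> blk (\<tau> x) \<in> W} = 1"
    by (subst card_Un_disjoint[symmetric]) auto
  then show False using cut_balanced[OF C, of W] by presburger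
qed

text \<open>Delete the pair of \<open>b\<close>, which is not a bridge. In the remaining tree the
  pair of \<open>a\<close> is a bridge, and the corresponding cut of the whole graph is crossed by
  these two pairs only. Along C one crossing comes from \<open>b\<close>, so balance forces exactly
  one from the pair of \<open>a\<close>.\<close>

lemma unicyclic_not_bridge_through:
  assumes conn: "uconnected M" and card: "card P = card (uedges M)"
    and C: "C \<subseteq> S" "\<gamma> ` C \<subseteq> C" and b: "b \<in> C" "\<tau> b \<notin> C"
    and a: "a \<in> S" "uconnected (udelete M {a, \<tau> a})"
  shows "a \<in> C \<longleftrightarrow> \<tau> a \<notin> C"
proof (cases "a = b \<or> a = \<tau> b")
  case False
  have bS: "b \<in> S" using b C by auto
  have nb: "uconnected (udelete M {b, \<tau> b})" using separated_not_bridge[OF conn C b] .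
  have ne: "{a, \<tau> a} \<noteq> {b, \<tau> b}" using False edge_eq_iff[OF bS a(1)] by auto
  have "\<not> uconnected (udelete (udelete M {b, \<tau> b}) {a, \<tau> a})"
    using unicyclic_udelete_bridge[OF ugraph_M _ uedges_M_iff[OF bS] nb uedges_M_iff[OF a(1)] ne] card
    by (simp add: uverts_M)
  then obtain W where W: "W \<subseteq> P" "W \<noteq> {}" "W \<noteq> P"
    "\<And>f. f \<in> uedges M - {{b, \<tau> b}} \<Longrightarrow> crosses (uends M f) W \<longleftrightarrow> f = {a, \<tau> a}"
    using bridge_cutE[OF ugraph_on_udelete[OF ugraph_M] nb] unfolding udelete_simps uverts_M by metis
  \<comment> \<open>Otherwise the pair of \<open>a\<close> alone would cross W and be a bridge of
    the whole graph.\<close>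
  have "crosses (uends M {b, \<tau> b}) W"
  proof (rule ccontr)
    assume "\<not> ?thesis"
    then have "\<not> crosses (uends M f) W" if "f \<in> uedges M" "f \<noteq> {a, \<tau> a}" for f
      using W(4)[of f] that by auto
    then show False using bridgeI[OF ugraph_M, of W "{a, \<tau> a}"] W(1-3) a(2) uverts_M by auto
  qed
  then have "crosses (uends M f) W \<longleftrightarrow> f = {a, \<tau> a} \<or> f = {b, \<tau> b}" if "f \<in> uedges M" for f
    using W(4)[of f] that by (cases "f = {b, \<tau> b}") simp_all
  then have cr: "(blk x \<in> W) \<noteq> (blk (\<tau> x) \<in> W) \<longleftrightarrow> x \<in> {a, \<tau> a, b, \<tau> b}" if x: "x \<in> S" for x
    using crosses_M[OF x, of W] uedges_M_iff[OF x] edge_eq_iff[OF bS x] edge_eq_iff[OF a(1) x]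
      by (simp add: eq_commute[of "{x, \<tau> x}"])
  have finC: "finite C" using C(1) finite_S finite_subset by blast
  have bal: "card {x \<in> C. blk x \<in> W \<and> blk (\<tau> x) \<notin> W} = card {x \<in> C. blk x \<notin> W \<and> blk (\<tau> x) \<in> W}"
    by (rule cut_balanced[OF C])
  \<comment> \<open>\<open>\<tau> b\<close> lies outside C, so of the pair of \<open>b\<close> only
    \<open>b\<close> itself is counted.\<close>
  have un: "{x \<in> C. blk x \<in> W \<and> blk (\<tau> x) \<notin> W} \<union> {x \<in> C. blk x \<notin> W \<and> blk (\<tau> x) \<in> W} = insert b (C \<inter> {a, \<tau> a})"
    using cr C(1) b by auto
  have "card {x \<in> C. blk x \<in> W \<and> blk (\<tau> x) \<notin> W} + card {x \<in> C. blk x \<notin> W \<and> blk (\<tau> x) \<in> W}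
      = card (insert b (C \<inter> {a, \<tau> a}))"
    unfolding un[symmetric] using finC by (subst card_Un_disjoint) auto
  moreover have "b \<notin> C \<inter> {a, \<tau> a}" using False \<tau>_\<tau> by auto
  ultimately have odd: "odd (card (C \<inter> {a, \<tau> a}))" using bal finC by simp presburger
  show ?thesis
  proof (cases "a \<in> C")
    case True
    then show ?thesis using odd \<tau>_neq[OF a(1)] by (cases "\<tau> a \<in> C") auto
  next
    case False
    then show ?thesis using odd by (cases "\<tau> a \<in> C") auto
  qed
qed (use b in auto)

definition simple :: bool where
  "simple \<longleftrightarrow> (\<forall>x \<in> S. \<forall>y \<in> S. {blk x, blk (\<tau> x)} = {blk y, blk (\<tau> y)} \<longrightarrow> y = x \<or> y = \<tau> x)"

lemma simpleD: "simple \<Longrightarrow> x \<in> S \<Longrightarrow> y \<in> S \<Longrightarrow> {blk x, blk (\<tau> x)} = {blk y, blk (\<tau> y)} \<Longrightarrow> y = x \<or> y = \<tau> x"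
  unfolding simple_def by blast

lemma equivalent_edges_iff:
  "x \<in> S \<Longrightarrow> y \<in> S \<Longrightarrow> equivalent_edges (quotient_on S \<gamma> P) x y \<longleftrightarrow> {blk x, blk (\<tau> x)} = {blk y, blk (\<tau> y)}"
  by (simp add: equivalent_edges_def block_\<gamma> insert_commute)

text \<open>Simplicity makes an edge class no larger than a pair; \<open>block_\<gamma>\<close>
  makes it no smaller and gives the opposite orientations.\<close>

lemma elementarization_simple:
  assumes simple
  shows "elementarization (quotient_on S \<gamma> P) = M" "all_edges_double_opposite (quotient_on S \<gamma> P)"
proof -
  let ?R = "{(e, f). e \<in> S \<and> f \<in> S \<and> equivalent_edges (quotient_on S \<gamma> P) e f}"
  have cls: "?R `` {x} = {x, \<tau> x}" if x: "x \<in> S" for x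
  proof (intro set_eqI iffI)
    fix y assume "y \<in> ?R `` {x}"
    then have "y \<in> S" "equivalent_edges (quotient_on S \<gamma> P) x y" by simp_all
    then show "y \<in> {x, \<tau> x}" using simpleD[OF assms x, of y] equivalent_edges_iff[OF x, of y] by simp
  next
    fix y assume "y \<in> {x, \<tau> x}"
    then have "y \<in> S" "{blk x, blk (\<tau> x)} = {blk y, blk (\<tau> y)}" using x \<tau>_S by auto
    then show "y \<in> ?R `` {x}" using equivalent_edges_iff[OF x] x by simp
  qed
  have "S // ?R = (\<lambda>x. {x, \<tau> x}) ` S" unfolding quotient_def using cls by auto
  then show eq: "elementarization (quotient_on S \<gamma> P) = M"
    by (simp add: elementarization_def pairing_graph_def perm_cycles_pairing[OF pairing_\<tau>])
  show "all_edges_double_opposite (quotient_on S \<gamma> P)"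
    unfolding all_edges_double_opposite_def eq uedges_M
  proof (intro ballI conjI)
    fix c assume "c \<in> (\<lambda>x. {x, \<tau> x}) ` S"
    then obtain x where x: "x \<in> S" "c = {x, \<tau> x}" by auto
    then show "card c = 2" using \<tau>_neq[OF x(1)] by (simp add: card_2_iff')
    show "e \<noteq> f \<longrightarrow> opposite_edges (quotient_on S \<gamma> P) e f" if "e \<in> c" "f \<in> c" for e f
      using that x \<tau>_S[OF x(1)] block_\<gamma>[of x] block_\<gamma>[of "\<tau> x"] by (auto simp: opposite_edges_def)
  qed
qed

text \<open>\<open>\<gamma> (\<tau> y)\<close> has the block of \<open>\<tau> (\<tau> y)\<close>,
  which is y.\<close>

lemma cycle_subset_blk:
  assumes "x \<in> S" "y \<in> orbit (\<gamma> \<circ> \<tau>) x"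
  shows "y \<in> S \<and> blk y = blk x"
  using assms(2)
proof induction
  case base
  then show ?case using assms(1) \<tau>_S \<gamma>_S block_\<gamma>[of "\<tau> x"] by auto
next
  case (step y)
  then show ?case using \<tau>_S \<gamma>_S block_\<gamma>[of "\<tau> y"] by auto
qed

lemma permutation_face: "permutation (\<gamma> \<circ> \<tau>)"
  using perm_\<gamma> \<tau>_perm finite_S permutation_compose permutation_permutes by blast

lemma face_S: "(\<gamma> \<circ> \<tau>) ` S \<subseteq> S"
  using \<gamma>_S \<tau>_S by auto

text \<open>Each block is a union of cycles of \<open>\<gamma> \<circ> \<tau>\<close>, so sending a
  cycle to its block is onto; equal finite cardinalities make it injective as well.\<close>

lemma card_le_cycles:
  shows "card P \<le> card (perm_cycles S (\<gamma> \<circ> \<tau>))"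
    and "card P = card (perm_cycles S (\<gamma> \<circ> \<tau>)) \<Longrightarrow> P = perm_cycles S (\<gamma> \<circ> \<tau>)"
proof -
  let ?Q = "perm_cycles S (\<gamma> \<circ> \<tau>)"
  \<comment> \<open>The choice is harmless, since the block is constant along a cycle.\<close>
  define h where "h C = blk (SOME x. x \<in> C)" for C
  have h: "h (orbit (\<gamma> \<circ> \<tau>) x) = blk x" if "x \<in> S" for x
  proof -
    have "x \<in> orbit (\<gamma> \<circ> \<tau>) x" using permutation_self_in_orbit[OF permutation_face] .
    then have "(SOME y. y \<in> orbit (\<gamma> \<circ> \<tau>) x) \<in> orbit (\<gamma> \<circ> \<tau>) x" by (rule someI)
    then show ?thesis using cycle_subset_blk[OF that] unfolding h_def by blast
  qed
  have "h ` ?Q = blk ` S" unfolding perm_cycles_def image_image using h by (rule image_cong[OF refl])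
  also have "\<dots> = P" using partition_on_blocks[OF part] by (rule sym)
  finally have img: "h ` ?Q = P" .
  have fin: "finite ?Q" using finite_S by (simp add: perm_cycles_def)
  show "card P \<le> card ?Q" using card_image_le[OF fin, of h] img by simp
  assume eq: "card P = card ?Q"
  have inj: "inj_on h ?Q" using eq img fin by (intro eq_card_imp_inj_on) simp_all
  have "blk x = orbit (\<gamma> \<circ> \<tau>) x" if x: "x \<in> S" for x
  proof
    show "orbit (\<gamma> \<circ> \<tau>) x \<subseteq> blk x"
    proof
      fix y assume "y \<in> orbit (\<gamma> \<circ> \<tau>) x"
      then have "y \<in> S" "blk y = blk x" using cycle_subset_blk[OF x] by auto
      then show "y \<in> blk x" using blk_self[of y] by simp
    qed
    show "blk x \<subseteq> orbit (\<gamma> \<circ> \<tau>) x"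
    proof
      fix y assume y: "y \<in> blk x"
      have yS: "y \<in> S" using y blk_in[OF x] partition_onD1[OF part] by blast
      have "blk y = blk x" using block_of_eq[OF part blk_in[OF x] y] .
      then have "h (orbit (\<gamma> \<circ> \<tau>) y) = h (orbit (\<gamma> \<circ> \<tau>) x)" using h x yS by simp
      then have "orbit (\<gamma> \<circ> \<tau>) y = orbit (\<gamma> \<circ> \<tau>) x"
        using inj x yS by (auto simp: perm_cycles_def dest: inj_onD)
      then show "y \<in> orbit (\<gamma> \<circ> \<tau>) x" using permutation_self_in_orbit[OF permutation_face, of y] by simp
    qed
  qed
  then have "blk ` S = ?Q" unfolding perm_cycles_def by (rule image_cong[OF refl])
  with partition_on_blocks[OF part] show "P = ?Q" by (rule trans)
qed

end

text \<open>This is the finest partition compatible with \<tau>: \<open>\<gamma> x\<close> is the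
  image of \<open>\<tau> x\<close> under \<open>\<gamma> \<circ> \<tau>\<close>, so they lie in the
  same cycle.\<close>

lemma darts_cycles:
  assumes "finite S" "S \<noteq> {}" "permutation \<gamma>" "\<gamma> ` S \<subseteq> S" "pairing S \<tau>"
  shows "darts S \<gamma> \<tau> (perm_cycles S (\<gamma> \<circ> \<tau>))"
proof -
  have perm: "permutation (\<gamma> \<circ> \<tau>)"
    using assms(1,3) pairingD(1)[OF assms(5)] permutation_compose permutation_permutes by blast
  have cl: "(\<gamma> \<circ> \<tau>) ` S \<subseteq> S" using assms(4) pairingD(2)[OF assms(5)] by auto
  show ?thesis
  proof
    show "block_of (perm_cycles S (\<gamma> \<circ> \<tau>)) (\<gamma> x) = block_of (perm_cycles S (\<gamma> \<circ> \<tau>)) (\<tau> x)" if x: "x \<in> S" for x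
    proof -
      have "\<gamma> x = (\<gamma> \<circ> \<tau>) (\<tau> x)" using pairingD(4)[OF assms(5)] by simp
      then have "\<gamma> x \<in> orbit (\<gamma> \<circ> \<tau>) (\<tau> x)" by (metis orbit.base)
      then have "orbit (\<gamma> \<circ> \<tau>) (\<gamma> x) = orbit (\<gamma> \<circ> \<tau>) (\<tau> x)" by (rule orbit_eq_orbit[OF perm])
      then show ?thesis
        using block_of_perm_cycles[OF perm cl] x assms(4) pairingD(2)[OF assms(5) x] by auto
    qed
  qed (use assms partition_on_perm_cycles[OF perm cl] in simp_all)
qed

text \<open>Classes of size two give each edge its partner, and the opposite orientation of partners
  is the block condition of \<open>darts\<close>.\<close>

lemma all_edges_double_oppositeE:
  assumes fin: "finite S" and ne: "S \<noteq> {}" and \<gamma>: "permutation \<gamma>" "\<gamma> ` S \<subseteq> S" and part: "partition_on S P"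
    and opp: "all_edges_double_opposite (quotient_on S \<gamma> P)"
  obtains \<tau> where "darts S \<gamma> \<tau> P" "darts.simple S \<tau> P"
proof -
  let ?G = "quotient_on S \<gamma> P"
  define R where "R = {(e, f). e \<in> S \<and> f \<in> S \<and> equivalent_edges ?G e f}"
  have cls: "R `` {x} = {y \<in> S. {block_of P (\<gamma> x), block_of P x} = {block_of P (\<gamma> y), block_of P y}}" if "x \<in> S" for x
    using that by (auto simp: R_def equivalent_edges_def)
  have edge: "R `` {x} \<in> uedges (elementarization ?G)" if "x \<in> S" for x
  proof -
    have "uedges (elementarization ?G) = S // R" by (simp add: elementarization_def R_def)
    then show ?thesis using quotientI[OF that] by simp
  qed
  have "\<exists>y. R `` {x} = {x, y} \<and> y \<noteq> x" if x: "x \<in> S" for x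
  proof -
    have "card (R `` {x}) = 2" using opp edge[OF x] by (simp add: all_edges_double_opposite_def)
    moreover have "x \<in> R `` {x}" using cls[OF x] x by simp
    moreover obtain u v where uv: "R `` {x} = {u, v}" "u \<noteq> v" using calculation(1) by (meson card_2_iff)
    ultimately have "x = u \<or> x = v" by simp
    then show ?thesis using uv by (metis insert_commute)
  qed
  then obtain t where t: "\<And>x. x \<in> S \<Longrightarrow> R `` {x} = {x, t x} \<and> t x \<noteq> x" by metis
  \<comment> \<open>The identity outside S makes \<tau> a permutation in the sense of
    \<open>permutes\<close>.\<close>
  define \<tau> where "\<tau> x = (if x \<in> S then t x else x)" for x
  have \<tau>: "R `` {x} = {x, \<tau> x}" "\<tau> x \<noteq> x" if "x \<in> S" for x using t[OF that] that by (auto simp: \<tau>_def)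
  have \<tau>S: "\<tau> x \<in> S" if "x \<in> S" for x
  proof -
    have "\<tau> x \<in> R `` {x}" using \<tau>[OF that] by simp
    then show ?thesis by (auto simp: R_def)
  qed
  have \<tau>\<tau>: "\<tau> (\<tau> x) = x" if x: "x \<in> S" for x
  proof -
    have "\<tau> x \<in> R `` {x}" using \<tau>[OF x] by simp
    then have "R `` {\<tau> x} = R `` {x}" unfolding cls[OF x] cls[OF \<tau>S[OF x]] by simp
    then have "{\<tau> x, \<tau> (\<tau> x)} = {x, \<tau> x}" using \<tau>(1)[OF x] \<tau>(1)[OF \<tau>S[OF x]] by simp
    then show ?thesis using \<tau>(2)[OF x] by (auto simp: doubleton_eq_iff)
  qed
  have all: "\<tau> (\<tau> x) = x" for x using \<tau>\<tau>[of x] by (cases "x \<in> S") (simp_all add: \<tau>_def)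
  have "\<tau> permutes S" unfolding permutes_def
  proof (intro conjI allI impI)
    fix y show "\<exists>!x. \<tau> x = y" using all by metis
  qed (simp add: \<tau>_def)
  then have pair: "pairing S \<tau>" using \<tau>(2) \<tau>\<tau> by (simp add: pairing_def)
  have blk: "block_of P (\<gamma> x) = block_of P (\<tau> x)" if x: "x \<in> S" for x
  proof -
    have "\<forall>e \<in> R `` {x}. \<forall>f \<in> R `` {x}. e \<noteq> f \<longrightarrow> opposite_edges ?G e f"
      using opp edge[OF x] by (simp add: all_edges_double_opposite_def)
    then have "opposite_edges ?G x (\<tau> x)" using \<tau>[OF x] by simp
    then show ?thesis by (simp add: opposite_edges_def)
  qed
  interpret darts S \<gamma> \<tau> P
    by unfold_locales (use fin ne \<gamma> pair part blk in simp_all)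
  have "y = x \<or> y = \<tau> x" if xy: "x \<in> S" "y \<in> S" "{blk x, blk (\<tau> x)} = {blk y, blk (\<tau> y)}" for x y
  proof -
    have "y \<in> R `` {x}" using xy equivalent_edges_iff[OF xy(1,2)] by (simp add: R_def)
    then show ?thesis using \<tau>(1)[OF xy(1)] by simp
  qed
  then have simple unfolding simple_def by blast
  then show ?thesis using that darts_axioms by blast
qed


section \<open>Double trees and non-crossing pairings\<close>

context darts
begin

lemma parallel_not_bridge:
  assumes "uconnected M" "x \<in> S" "y \<in> S" "{blk x, blk (\<tau> x)} = {blk y, blk (\<tau> y)}" "y \<noteq> x" "y \<noteq> \<tau> x"
  shows "uconnected (udelete M {x, \<tau> x})"
proof (rule uconnected_udelete_parallel[OF ugraph_M assms(1)])
  show "{y, \<tau> y} \<in> uedges M" using uedges_M_iff[OF assms(3)] .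
  show "{y, \<tau> y} \<noteq> {x, \<tau> x}" using edge_eq_iff[OF assms(2,3)] assms(5,6) by auto
  show "uends M {x, \<tau> x} = uends M {y, \<tau> y}" using uends_M assms(2-4) by simp
qed

lemma loop_not_bridge:
  assumes "uconnected M" "x \<in> S" "blk x = blk (\<tau> x)"
  shows "uconnected (udelete M {x, \<tau> x})"
  using uconnected_udelete_loop[OF ugraph_M assms(1), of "{x, \<tau> x}" "blk x"] uends_M assms by simp

lemma tree_edge_bridge':
  assumes "uconnected M" "2 * card P = card S + 2" "x \<in> S"
  shows "\<not> uconnected (udelete M {x, \<tau> x})"
proof -
  have "card (uverts M) = card (uedges M) + 1" using assms(2) card_uedges_M by (simp add: uverts_M)
  then show ?thesis using tree_edge_bridge[OF ugraph_M assms(1) _ uedges_M_iff[OF assms(3)]] by blast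
qed

text \<open>In a tree every pair is a bridge, but a pair with another one parallel to it is
  not.\<close>

lemma tree_simple:
  assumes "uconnected M" "2 * card P = card S + 2"
  shows simple
  unfolding simple_def
proof (intro ballI impI, rule ccontr)
  fix x y assume "x \<in> S" "y \<in> S" "{blk x, blk (\<tau> x)} = {blk y, blk (\<tau> y)}" "\<not> (y = x \<or> y = \<tau> x)"
  then show False using parallel_not_bridge[OF assms(1), of x y] tree_edge_bridge'[OF assms, of x] by simp
qed

lemma tree_no_loop:
  assumes "uconnected M" "2 * card P = card S + 2" "x \<in> S"
  shows "blk x \<noteq> blk (\<tau> x)"
  using loop_not_bridge[OF assms(1,3)] tree_edge_bridge'[OF assms] by blast

text \<open>The pairs are the edges of the elementarization, which depends on P only. This recovers
  the pairings from a glued graph.\<close>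

lemma simple_unique:
  assumes "darts S \<gamma> \<tau>' P" "simple" "darts.simple S \<tau>' P"
  shows "\<tau>' = \<tau>"
proof
  interpret d': darts S \<gamma> \<tau>' P by (rule assms)
  have "uedges M = uedges d'.M"
    using elementarization_simple(1)[OF assms(2)] d'.elementarization_simple(1)[OF assms(3)] by simp
  then have eq: "(\<lambda>x. {x, \<tau> x}) ` S = (\<lambda>x. {x, \<tau>' x}) ` S" by (simp add: uedges_M d'.uedges_M)
  fix x show "\<tau>' x = \<tau> x"
  proof (cases "x \<in> S")
    case True
    have "{x, \<tau> x} \<in> (\<lambda>x. {x, \<tau>' x}) ` S" unfolding eq[symmetric] using True by (rule imageI)
    then obtain y where y: "y \<in> S" "{x, \<tau> x} = {y, \<tau>' y}" by (rule imageE)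
    then have "x = y \<and> \<tau> x = \<tau>' y \<or> x = \<tau>' y \<and> \<tau> x = y" by (simp add: doubleton_eq_iff)
    then show ?thesis using d'.\<tau>_\<tau> by metis
  next
    case False
    then show ?thesis using permutes_not_in[OF \<tau>_perm] permutes_not_in[OF d'.\<tau>_perm] by simp
  qed
qed

end

text \<open>The assumption \<open>transitive\<close> says that \<gamma> is a single cycle on S, in
  the form used for connectedness.\<close>

locale cyclic_darts =
  fixes S :: "'a set" and \<gamma> :: "'a \<Rightarrow> 'a"
  assumes finite_S: "finite S" and nonempty_S: "S \<noteq> {}" and perm_\<gamma>: "permutation \<gamma>" and \<gamma>_S: "\<gamma> ` S \<subseteq> S"
    and transitive: "X \<subseteq> S \<Longrightarrow> X \<noteq> {} \<Longrightarrow> (\<And>x. x \<in> X \<Longrightarrow> \<gamma> x \<in> X) \<Longrightarrow> X = S"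
begin

lemma uconnected_pairing_graph:
  assumes "darts S \<gamma> \<tau> P"
  shows "uconnected (pairing_graph S \<gamma> \<tau> P)"
  using darts.uconnected_M[OF assms] transitive by blast

lemma darts_face_partition:
  assumes "pairing S \<tau>"
  shows "darts S \<gamma> \<tau> (perm_cycles S (\<gamma> \<circ> \<tau>))"
  by (rule darts_cycles[OF finite_S nonempty_S perm_\<gamma> \<gamma>_S assms])

text \<open>A double tree has one block more than edges. The graph on the cycles of
  \<open>\<gamma> \<circ> \<tau>\<close> is connected with the same number of edges, hence has no
  more vertices; as blocks are unions of cycles, the numbers agree and so do the partitions.\<close>

lemma double_tree_iff:
  assumes "partition_on S P"
  shows "double_tree (quotient_on S \<gamma> P) \<longleftrightarrow>
    (\<exists>\<tau>. pairing S \<tau> \<and> P = perm_cycles S (\<gamma> \<circ> \<tau>) \<and> 2 * card P = card S + 2)"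
proof
  assume dt: "double_tree (quotient_on S \<gamma> P)"
  then obtain \<tau> where d: "darts S \<gamma> \<tau> P" and simple: "darts.simple S \<tau> P"
    using all_edges_double_oppositeE[OF finite_S nonempty_S perm_\<gamma> \<gamma>_S assms] unfolding double_tree_def by metis
  interpret darts S \<gamma> \<tau> P by (rule d)
  interpret c: darts S \<gamma> \<tau> "perm_cycles S (\<gamma> \<circ> \<tau>)" by (rule darts_face_partition[OF pairing_\<tau>])
  have "utree M" using dt elementarization_simple(1)[OF simple] by (simp add: double_tree_def)
  then have card: "card P = card (uedges M) + 1" using utree_iff_card[OF ugraph_M] by (simp add: uverts_M)
  have "card (perm_cycles S (\<gamma> \<circ> \<tau>)) \<le> card (uedges c.M) + 1"
    using uconnected_card_le[OF c.ugraph_M uconnected_pairing_graph[OF c.darts_axioms]] by (simp add: c.uverts_M)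
  then have "card P = card (perm_cycles S (\<gamma> \<circ> \<tau>))"
    using card_le_cycles(1) card card_uedges_M c.card_uedges_M by simp
  then have "P = perm_cycles S (\<gamma> \<circ> \<tau>)" by (rule card_le_cycles(2))
  then show "\<exists>\<tau>. pairing S \<tau> \<and> P = perm_cycles S (\<gamma> \<circ> \<tau>) \<and> 2 * card P = card S + 2"
    using card card_uedges_M pairing_\<tau> by (intro exI[of _ \<tau>]) simp
next
  assume "\<exists>\<tau>. pairing S \<tau> \<and> P = perm_cycles S (\<gamma> \<circ> \<tau>) \<and> 2 * card P = card S + 2"
  then obtain \<tau> where \<tau>: "pairing S \<tau>" "P = perm_cycles S (\<gamma> \<circ> \<tau>)" "2 * card P = card S + 2" by blast
  interpret darts S \<gamma> \<tau> P unfolding \<tau>(2) by (rule darts_face_partition[OF \<tau>(1)])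
  have conn: "uconnected M" by (rule uconnected_pairing_graph[OF darts_axioms])
  have "utree M" using utree_iff_card[OF ugraph_M] conn \<tau>(3) card_uedges_M by (simp add: uverts_M)
  then show "double_tree (quotient_on S \<gamma> P)"
    using elementarization_simple[OF tree_simple[OF conn \<tau>(3)]] by (simp add: double_tree_def)
qed

end

section \<open>Non-crossing pairings of an interval\<close>

locale segment_darts = darts "{l..<h}" \<gamma> \<tau> P for l h :: nat and \<gamma> \<tau> P +
  assumes \<gamma>_eq: "x \<in> {l..<h} \<Longrightarrow> \<gamma> x = (if Suc x < h then Suc x else l)"
begin

text \<open>Walk through the interval: since \<open>\<gamma> x\<close> has the block of
  \<open>\<tau> x\<close>, the side of the bridge cut changes between x and its successor only at
  \<open>a\<close> and \<open>\<tau> a\<close>. A pair crossing that of \<open>a\<close> would then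
  have its ends on different sides.\<close>

lemma bridges_imp_noncrossing:
  assumes conn: "uconnected M" and bridges: "\<And>x. x \<in> {l..<h} \<Longrightarrow> \<not> uconnected (udelete M {x, \<tau> x})"
    and ab: "a \<in> {l..<h}" "b \<in> {l..<h}"
  shows "\<not> (a < b \<and> b < \<tau> a \<and> \<tau> a < \<tau> b)"
proof
  assume cross: "a < b \<and> b < \<tau> a \<and> \<tau> a < \<tau> b"
  obtain W where W: "\<And>f. f \<in> uedges M \<Longrightarrow> crosses (uends M f) W \<longleftrightarrow> f = {a, \<tau> a}"
    using bridge_cutE[OF ugraph_M conn bridges[OF ab(1)]] by metis
  have cr: "(blk x \<in> W) \<noteq> (blk (\<tau> x) \<in> W) \<longleftrightarrow> x = a \<or> x = \<tau> a" if "x \<in> {l..<h}" for x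
    using W[OF uedges_M_iff[OF that]] crosses_M[OF that] edge_eq_iff[OF ab(1) that] by auto
  have \<tau>a: "\<tau> a < h" and \<tau>b: "\<tau> b \<in> {l..<h}" using \<tau>_S[OF ab(1)] \<tau>_S[OF ab(2)] by auto
  have same: "blk (Suc x) \<in> W \<longleftrightarrow> blk x \<in> W" if "x \<in> {l..<h}" "Suc x < h" "x \<noteq> a" "x \<noteq> \<tau> a" for x
    using block_\<gamma>[OF that(1)] \<gamma>_eq[OF that(1)] cr[OF that(1)] that by auto
  have start: "blk (Suc a) \<in> W \<longleftrightarrow> blk a \<notin> W"
    using block_\<gamma>[OF ab(1)] \<gamma>_eq[OF ab(1)] cr[OF ab(1)] cross \<tau>a by auto
  \<comment> \<open>The change happens after \<open>a\<close> and after \<open>\<tau> a\<close>, so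
    \<open>\<tau> a\<close> still belongs to the inner side while \<open>a\<close> does not.\<close>
  have inside: "blk (a + 1 + k) \<in> W \<longleftrightarrow> blk a \<notin> W" if "a + 1 + k \<le> \<tau> a" for k
    using that
  proof (induction k)
    case (Suc k)
    then show ?case using same[of "a + 1 + k"] \<tau>a ab(1) by auto
  qed (use start in simp)
  have finish: "blk (Suc (\<tau> a)) \<in> W \<longleftrightarrow> blk a \<in> W"
    using block_\<gamma>[of "\<tau> a"] \<gamma>_eq[of "\<tau> a"] \<tau>_S[OF ab(1)] cross \<tau>b by auto
  have outside: "blk (\<tau> a + 1 + k) \<in> W \<longleftrightarrow> blk a \<in> W" if "\<tau> a + 1 + k < h" for k
    using that
  proof (induction k)
    case (Suc k)
    then show ?case using same[of "\<tau> a + 1 + k"] ab(1) cross by auto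
  qed (use finish in simp)
  have "blk b \<in> W \<longleftrightarrow> blk a \<notin> W" using inside[of "b - a - 1"] cross by simp
  moreover have "blk (\<tau> b) \<in> W \<longleftrightarrow> blk a \<in> W" using outside[of "\<tau> b - \<tau> a - 1"] cross \<tau>b by simp
  moreover have "blk b \<in> W \<longleftrightarrow> blk (\<tau> b) \<in> W" using cr[OF ab(2)] cross by auto
  ultimately show False by blast
qed

text \<open>The interval from \<open>a + 1\<close> to \<open>\<tau> a\<close> is a union of cycles
  of \<open>\<gamma> \<circ> \<tau>\<close>, and by non-crossing only the pair of \<open>a\<close>
  leaves it.\<close>

lemma noncrossing_imp_bridge:
  assumes P: "P = perm_cycles {l..<h} (\<gamma> \<circ> \<tau>)"
    and nc: "\<And>a b. a \<in> {l..<h} \<Longrightarrow> b \<in> {l..<h} \<Longrightarrow> \<not> (a < b \<and> b < \<tau> a \<and> \<tau> a < \<tau> b)"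
    and a: "a \<in> {l..<h}" "a < \<tau> a"
  shows "\<not> uconnected (udelete M {a, \<tau> a})"
proof -
  \<comment> \<open>The point \<open>a\<close> is left out: \<open>\<gamma> \<circ> \<tau>\<close>
    maps \<open>\<tau> a\<close> to \<open>a + 1\<close>, and any other point x of the interval to
    the successor of \<open>\<tau> x\<close>, which is at most \<open>\<tau> a\<close>.\<close>
  define I where "I = {a + 1..\<tau> a}"
  have \<tau>a: "\<tau> a < h" using \<tau>_S[OF a(1)] by simp
  have IS: "I \<subseteq> {l..<h}" using a \<tau>a by (auto simp: I_def)
  have inner: "\<tau> x \<in> I" if x: "x \<in> I" "x \<noteq> \<tau> a" for x
  proof (rule ccontr)
    assume out: "\<tau> x \<notin> I"
    have xS: "x \<in> {l..<h}" and "a < x" "x < \<tau> a" using x IS by (auto simp: I_def)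
    moreover have "\<tau> x \<noteq> a" using x(2) \<tau>_\<tau>[of x] by auto
    ultimately have "\<tau> x < a \<or> \<tau> a < \<tau> x" using out by (auto simp: I_def)
    then show False
    proof
      assume "\<tau> x < a"
      then show False using nc[of "\<tau> x" a] \<open>a < x\<close> \<open>x < \<tau> a\<close> \<tau>_S[OF xS] a(1) by simp
    next
      assume "\<tau> a < \<tau> x"
      then show False using nc[of a x] \<open>a < x\<close> \<open>x < \<tau> a\<close> xS a(1) by simp
    qed
  qed
  have face: "(\<gamma> \<circ> \<tau>) ` I \<subseteq> I"
  proof
    fix y assume "y \<in> (\<gamma> \<circ> \<tau>) ` I"
    then obtain x where x: "x \<in> I" "y = \<gamma> (\<tau> x)" by auto
    show "y \<in> I"
    proof (cases "x = \<tau> a")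
      case True
      then show ?thesis using x \<gamma>_eq[OF a(1)] a \<tau>a by (auto simp: I_def)
    next
      case False
      then have "\<tau> x \<in> I" using inner x by blast
      moreover have "\<tau> x \<noteq> \<tau> a"
      proof
        assume "\<tau> x = \<tau> a"
        then have "x = a" by (metis \<tau>_\<tau>)
        then show False using x(1) by (simp add: I_def)
      qed
      ultimately have "a < \<tau> x" "\<tau> x < \<tau> a" "\<tau> x \<in> {l..<h}" using IS by (auto simp: I_def)
      then show ?thesis using x(2) \<gamma>_eq[of "\<tau> x"] \<tau>a by (simp add: I_def)
    qed
  qed
  have blk: "blk x = orbit (\<gamma> \<circ> \<tau>) x" if "x \<in> {l..<h}" for x
    unfolding P by (rule block_of_perm_cycles[OF permutation_face face_S that])
  define W where "W = blk ` I"
  have W: "blk x \<in> W \<longleftrightarrow> x \<in> I" if x: "x \<in> {l..<h}" for x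
  proof
    assume "blk x \<in> W"
    then obtain y where y: "y \<in> I" "blk x = blk y" unfolding W_def by blast
    then have "x \<in> orbit (\<gamma> \<circ> \<tau>) y" using blk_self[OF x] blk[OF subsetD[OF IS y(1)]] by simp
    then show "x \<in> I" using orbit_subset_closed[OF face y(1)] by blast
  qed (simp add: W_def)
  show ?thesis
  proof (rule bridgeI[OF ugraph_M])
    show "W \<subseteq> uverts M" unfolding W_def uverts_M using subsetD[OF IS] blk_in by (intro image_subsetI) metis
    show "W \<noteq> {}" using a by (simp add: W_def I_def)
    have "blk a \<notin> W" using W[OF a(1)] by (simp add: I_def)
    then show "W \<noteq> uverts M" using blk_in[OF a(1)] unfolding uverts_M by metis
    fix f assume f: "f \<in> uedges M" "f \<noteq> {a, \<tau> a}"
    then obtain x where x: "x \<in> {l..<h}" "f = {x, \<tau> x}" unfolding uedges_M by blast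
    then have ne: "x \<noteq> a" "x \<noteq> \<tau> a" using f edge_eq_iff[OF a(1) x(1)] by auto
    have "x \<in> I \<longleftrightarrow> \<tau> x \<in> I"
    proof
      assume "\<tau> x \<in> I"
      moreover have "\<tau> x \<noteq> \<tau> a" using ne(1) \<tau>_\<tau> by metis
      ultimately show "x \<in> I" using inner[of "\<tau> x"] \<tau>_\<tau>[of x] by simp
    qed (use inner ne in blast)
    then show "\<not> crosses (uends M f) W"
      using crosses_M[OF x(1)] W[OF x(1)] W[OF \<tau>_S[OF x(1)]] x(2) by simp
  qed
qed

text \<open>Both sides say that every pair is a bridge.\<close>

lemma noncrossing_iff_card:
  assumes P: "P = perm_cycles {l..<h} (\<gamma> \<circ> \<tau>)" and conn: "uconnected M"
  shows "\<not> (\<exists>a \<in> {l..<h}. \<exists>b \<in> {l..<h}. a < b \<and> b < \<tau> a \<and> \<tau> a < \<tau> b) \<longleftrightarrow> 2 * card P = card {l..<h} + 2"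
proof
  assume nc: "\<not> (\<exists>a \<in> {l..<h}. \<exists>b \<in> {l..<h}. a < b \<and> b < \<tau> a \<and> \<tau> a < \<tau> b)"
  have *: "\<not> uconnected (udelete M {a, \<tau> a})" if "a \<in> {l..<h}" "a < \<tau> a" for a
    using noncrossing_imp_bridge[OF P _ that] nc by blast
  have "\<not> uconnected (udelete M e)" if e: "e \<in> uedges M" for e
  proof -
    obtain x where x: "x \<in> {l..<h}" "e = {x, \<tau> x}" using e unfolding uedges_M by blast
    show ?thesis
    proof (cases "x < \<tau> x")
      case False
      then have "\<tau> x < \<tau> (\<tau> x)" using \<tau>_neq[OF x(1)] by simp
      then show ?thesis using *[OF \<tau>_S[OF x(1)]] x(2) by (simp add: insert_commute)
    qed (use * x in simp)
  qed
  then have "card (uverts M) = card (uedges M) + 1" by (rule all_bridges_card[OF ugraph_M conn])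
  then show "2 * card P = card {l..<h} + 2" using card_uedges_M by (simp add: uverts_M)
next
  assume "2 * card P = card {l..<h} + 2"
  then show "\<not> (\<exists>a \<in> {l..<h}. \<exists>b \<in> {l..<h}. a < b \<and> b < \<tau> a \<and> \<tau> a < \<tau> b)"
    using bridges_imp_noncrossing[OF conn tree_edge_bridge'[OF conn]] by blast
qed

end


section \<open>Unicircuit graphs and annular pairings\<close>

text \<open>A and B are the two cycles of \<gamma>; a pair meeting both is a through string.\<close>

locale annular =
  fixes S A B :: "'a set" and \<gamma> :: "'a \<Rightarrow> 'a"
  assumes finite_S: "finite S" and S_eq: "S = A \<union> B" and disj: "A \<inter> B = {}"
    and A_ne: "A \<noteq> {}" and B_ne: "B \<noteq> {}" and perm_\<gamma>: "permutation \<gamma>"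
    and \<gamma>_A: "\<gamma> ` A \<subseteq> A" and \<gamma>_B: "\<gamma> ` B \<subseteq> B"
    and transitive_A: "X \<subseteq> A \<Longrightarrow> X \<noteq> {} \<Longrightarrow> (\<And>x. x \<in> X \<Longrightarrow> \<gamma> x \<in> X) \<Longrightarrow> X = A"
    and transitive_B: "X \<subseteq> B \<Longrightarrow> X \<noteq> {} \<Longrightarrow> (\<And>x. x \<in> X \<Longrightarrow> \<gamma> x \<in> X) \<Longrightarrow> X = B"
begin

lemma nonempty_S: "S \<noteq> {}" using S_eq A_ne by simp

lemma in_S_iff: "x \<in> S \<longleftrightarrow> x \<in> A \<or> x \<in> B" using S_eq by simp

lemma \<gamma>_S: "\<gamma> ` S \<subseteq> S" using \<gamma>_A \<gamma>_B unfolding S_eq by auto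

lemma darts_face_partition:
  assumes "pairing S \<tau>"
  shows "darts S \<gamma> \<tau> (perm_cycles S (\<gamma> \<circ> \<tau>))"
  by (rule darts_cycles[OF finite_S nonempty_S perm_\<gamma> \<gamma>_S assms])

definition strings :: "('a \<Rightarrow> 'a) \<Rightarrow> 'a set set" where
  "strings \<tau> = {C \<in> perm_cycles S \<tau>. C \<inter> A \<noteq> {} \<and> C \<inter> B \<noteq> {}}"

definition unicircuit :: "'a set set \<Rightarrow> bool" where
  "unicircuit P \<longleftrightarrow> uconnected (elementarization (quotient_on S \<gamma> P)) \<and>
     all_edges_double_opposite (quotient_on S \<gamma> P) \<and>
     (\<exists>C. circuits (elementarization (quotient_on S \<gamma> P)) = {C} \<and>
        (\<forall>c \<in> uedges C. \<exists>e \<in> A. \<exists>f \<in> B. c = {e, f}))"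

text \<open>A set closed under \<gamma> that meets A or B contains it, and one through string
  carries it to the other cycle.\<close>

lemma uconnected_pairing_graph:
  assumes "darts S \<gamma> \<tau> P" and b: "b \<in> A" "\<tau> b \<in> B"
  shows "uconnected (pairing_graph S \<gamma> \<tau> P)"
proof (rule darts.uconnected_M[OF assms(1)])
  interpret darts S \<gamma> \<tau> P by (rule assms)
  fix X assume X: "X \<subseteq> S" "X \<noteq> {}" and \<gamma>X: "\<And>x. x \<in> X \<Longrightarrow> \<gamma> x \<in> X" and \<tau>X: "\<And>x. x \<in> X \<Longrightarrow> \<tau> x \<in> X"
  have AX: "X \<inter> A = A" if "X \<inter> A \<noteq> {}"
    using that \<gamma>X \<gamma>_A by (intro transitive_A) auto
  have BX: "X \<inter> B = B" if "X \<inter> B \<noteq> {}"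
    using that \<gamma>X \<gamma>_B by (intro transitive_B) auto
  have "X \<inter> A \<noteq> {} \<or> X \<inter> B \<noteq> {}" using X S_eq by auto
  then have "b \<in> X \<or> \<tau> b \<in> X" using AX BX b by auto
  then have "b \<in> X \<and> \<tau> b \<in> X" using \<tau>X[of b] \<tau>X[of "\<tau> b"] \<tau>_\<tau>[of b] by auto
  then have "X \<inter> A = A" "X \<inter> B = B" using AX BX b by auto
  then show "X = S" using X(1) S_eq by auto
qed

end

locale annular_darts = annular S A B \<gamma> + darts S \<gamma> \<tau> P for S A B :: "'a set" and \<gamma> \<tau> :: "'a \<Rightarrow> 'a" and P
begin

lemma strings_eq: "strings \<tau> = {c. \<exists>x \<in> A. c = {x, \<tau> x} \<and> \<tau> x \<in> B}"
proof (intro set_eqI iffI)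
  fix c assume "c \<in> strings \<tau>"
  then have "c \<in> (\<lambda>x. {x, \<tau> x}) ` S" and c: "c \<inter> A \<noteq> {}" "c \<inter> B \<noteq> {}"
    by (simp_all add: strings_def perm_cycles_pairing[OF pairing_\<tau>])
  then obtain x where x: "x \<in> S" "c = {x, \<tau> x}" by blast
  show "c \<in> {c. \<exists>x \<in> A. c = {x, \<tau> x} \<and> \<tau> x \<in> B}"
  proof (cases "x \<in> A")
    case True
    then show ?thesis using x c disj by auto
  next
    case False
    then have "\<tau> x \<in> A" "x \<in> B" using x c S_eq by auto
    then show ?thesis using x(2) \<tau>_\<tau>[of x] by (intro CollectI bexI[of _ "\<tau> x"]) (auto simp: insert_commute)
  qed
next
  fix c assume "c \<in> {c. \<exists>x \<in> A. c = {x, \<tau> x} \<and> \<tau> x \<in> B}"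
  then obtain x where "x \<in> A" "c = {x, \<tau> x}" "\<tau> x \<in> B" by blast
  then show "c \<in> strings \<tau>"
    using in_S_iff by (auto simp: strings_def perm_cycles_pairing[OF pairing_\<tau>])
qed

lemma strings_iff: "x \<in> S \<Longrightarrow> {x, \<tau> x} \<in> strings \<tau> \<longleftrightarrow> (x \<in> A \<longleftrightarrow> \<tau> x \<notin> A)"
  using \<tau>_S[of x] in_S_iff disj by (auto simp: strings_def perm_cycles_pairing[OF pairing_\<tau>])

lemma strings_subset: "strings \<tau> \<subseteq> uedges M"
  by (auto simp: strings_def pairing_graph_def)

lemma through_not_bridge:
  assumes "uconnected M" "c \<in> strings \<tau>"
  shows "uconnected (udelete M c)"
proof -
  obtain x where x: "x \<in> A" "c = {x, \<tau> x}" "\<tau> x \<in> B" using assms(2) unfolding strings_eq by blast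
  have "A \<subseteq> S" "\<tau> x \<notin> A" using S_eq x disj by auto
  then show ?thesis using separated_not_bridge[OF assms(1) _ \<gamma>_A x(1)] x(2) by simp
qed

text \<open>One inclusion is balance along A of a cut crossed by one pair, the other of a cut
  crossed by two pairs.\<close>

lemma not_bridges_eq_strings:
  assumes conn: "uconnected M" and card: "2 * card P = card S" and ne: "strings \<tau> \<noteq> {}"
  shows "{e \<in> uedges M. uconnected (udelete M e)} = strings \<tau>"
proof
  show "strings \<tau> \<subseteq> {e \<in> uedges M. uconnected (udelete M e)}"
    using strings_subset through_not_bridge[OF conn] by blast
  obtain b where b: "b \<in> A" "\<tau> b \<in> B" using ne unfolding strings_eq by blast
  have AS: "A \<subseteq> S" and bA: "\<tau> b \<notin> A" using S_eq b disj by auto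
  have cP: "card P = card (uedges M)" using card card_uedges_M by simp
  show "{e \<in> uedges M. uconnected (udelete M e)} \<subseteq> strings \<tau>"
  proof
    fix e assume "e \<in> {e \<in> uedges M. uconnected (udelete M e)}"
    then have e: "e \<in> (\<lambda>x. {x, \<tau> x}) ` S" "uconnected (udelete M e)" by (simp_all add: uedges_M)
    then obtain a where a: "a \<in> S" "e = {a, \<tau> a}" by blast
    then show "e \<in> strings \<tau>"
      using unicyclic_not_bridge_through[OF conn cP AS \<gamma>_A b(1) bA a(1)] e(2) strings_iff[OF a(1)] by simp
  qed
qed

lemma other_not_bridge:
  assumes conn: "uconnected M" and card: "2 * card P = card S"
    and e: "e \<in> uedges M" "uconnected (udelete M e)" and f: "f \<in> uedges M" "f \<noteq> e"
  shows "\<not> uconnected (udelete (udelete M e) f)"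
  using unicyclic_udelete_bridge[OF ugraph_M _ e f] card card_uedges_M by (simp add: uverts_M)

text \<open>Removing a third edge of the circuit would leave a tree with two parallel edges.\<close>

lemma parallel_imp_two_strings:
  assumes conn: "uconnected M" and card: "2 * card P = card S" and ne: "strings \<tau> \<noteq> {}"
    and xy: "x \<in> S" "y \<in> S" "{blk x, blk (\<tau> x)} = {blk y, blk (\<tau> y)}" "\<not> (y = x \<or> y = \<tau> x)"
  shows "card (strings \<tau>) = 2"
proof -
  let ?c = "{x, \<tau> x}" and ?d = "{y, \<tau> y}"
  have cd: "?d \<noteq> ?c" using edge_eq_iff[OF xy(1,2)] xy(4) by auto
  have E: "?c \<in> uedges M" "?d \<in> uedges M" using uedges_M_iff xy(1,2) by auto
  have ends: "uends M ?c = uends M ?d" using uends_M xy(1-3) by simp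
  have nbc: "uconnected (udelete M ?c)" using uconnected_udelete_parallel[OF ugraph_M conn E(2) cd ends] .
  have nbd: "uconnected (udelete M ?d)" using uconnected_udelete_parallel[OF ugraph_M conn E(1) cd[symmetric] ends[symmetric]] .
  have sub: "e = ?c \<or> e = ?d" if e: "e \<in> strings \<tau>" for e
  proof (rule ccontr)
    assume ne: "\<not> ?thesis"
    have eM: "e \<in> uedges M" using strings_subset e by blast
    have conn': "uconnected (udelete M e)" using through_not_bridge[OF conn e] .
    have "uconnected (udelete (udelete M e) ?c)"
      using uconnected_udelete_parallel[OF ugraph_on_udelete[OF ugraph_M] conn', of ?d ?c] E ne cd ends
      by (simp add: eq_commute[of _ e])
    then show False using other_not_bridge[OF conn card eM conn' E(1)] ne by blast
  qed
  have "?c \<in> strings \<tau>" "?d \<in> strings \<tau>" using not_bridges_eq_strings[OF conn card ne] nbc nbd E by auto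
  then have "strings \<tau> = {?c, ?d}" using sub by blast
  then show ?thesis using cd by (simp add: card_2_iff')
qed

lemma simple_if_not_two_strings:
  assumes "uconnected M" "2 * card P = card S" "strings \<tau> \<noteq> {}" "card (strings \<tau>) \<noteq> 2"
  shows simple
  unfolding simple_def using parallel_imp_two_strings[OF assms(1-3)] assms(4) by metis

text \<open>A loop is no bridge, hence a through string; deleting another through string would leave
  a tree containing a loop.\<close>

lemma loop_imp_single_string:
  assumes conn: "uconnected M" and card: "2 * card P = card S" and ne: "strings \<tau> \<noteq> {}"
    and x: "x \<in> S" "blk x = blk (\<tau> x)"
  shows "strings \<tau> = {{x, \<tau> x}}"
proof -
  have E: "{x, \<tau> x} \<in> uedges M" using uedges_M_iff x(1) .
  have "{x, \<tau> x} \<in> strings \<tau>"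
    using not_bridges_eq_strings[OF conn card ne] E loop_not_bridge[OF conn x] by blast
  moreover have "e = {x, \<tau> x}" if e: "e \<in> strings \<tau>" for e
  proof (rule ccontr)
    assume ne: "e \<noteq> {x, \<tau> x}"
    have eM: "e \<in> uedges M" using strings_subset e by blast
    have conn': "uconnected (udelete M e)" using through_not_bridge[OF conn e] .
    have "uconnected (udelete (udelete M e) {x, \<tau> x})"
      using uconnected_udelete_loop[OF ugraph_on_udelete[OF ugraph_M] conn'] uends_M[OF x(1)] x(2) by simp
    then show False using other_not_bridge[OF conn card eM conn' E] ne by blast
  qed
  ultimately show ?thesis by blast
qed

lemma circuit_strings:
  assumes conn: "uconnected M" and card: "2 * card P = card S" and ne: "strings \<tau> \<noteq> {}"
  obtains C where "circuits M = {C}" "uedges C = strings \<tau>"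
proof -
  have "card (uverts M) = card (uedges M)" using card card_uedges_M by (simp add: uverts_M)
  then show ?thesis
    using unicyclic_circuits[OF ugraph_M conn] not_bridges_eq_strings[OF conn card ne] that by metis
qed

text \<open>The circuit then has one edge only, which must be a loop.\<close>

lemma single_string_imp_loop:
  assumes conn: "uconnected M" and card: "2 * card P = card S" and x: "x \<in> S" "strings \<tau> = {{x, \<tau> x}}"
  shows "blk x = blk (\<tau> x)"
proof -
  obtain C where "circuits M = {C}" "uedges C = strings \<tau>"
    using circuit_strings[OF conn card] x by auto
  then obtain v where "uends M {x, \<tau> x} = {v}"
    using circuit_one_edge_loop[OF ugraph_M, of C "{x, \<tau> x}"] x by auto
  then show ?thesis using uends_M[OF x(1)] by (metis doubleton_eq_iff insert_absorb2)
qed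

text \<open>A circuit of two edges consists of parallel edges, which simplicity forbids.\<close>

lemma simple_imp_not_two_strings:
  assumes conn: "uconnected M" and card: "2 * card P = card S" and simple
  shows "card (strings \<tau>) \<noteq> 2"
proof
  assume two: "card (strings \<tau>) = 2"
  then have ne: "strings \<tau> \<noteq> {}" by auto
  obtain c d where cd: "strings \<tau> = {c, d}" "c \<noteq> d" using two by (meson card_2_iff)
  obtain C where C: "circuits M = {C}" "uedges C = strings \<tau>"
    using circuit_strings[OF conn card ne] .
  have ends: "uends M c = uends M d"
    using circuit_two_edges_parallel[OF ugraph_M, of C c d] C cd by auto
  have "c \<in> (\<lambda>x. {x, \<tau> x}) ` S" "d \<in> (\<lambda>x. {x, \<tau> x}) ` S"
    using strings_subset cd(1) unfolding uedges_M by blast+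
  then obtain x y where x: "x \<in> S" "c = {x, \<tau> x}" and y: "y \<in> S" "d = {y, \<tau> y}" by blast
  have "{blk x, blk (\<tau> x)} = {blk y, blk (\<tau> y)}" using ends x y uends_M by simp
  then have "y = x \<or> y = \<tau> x" by (rule simpleD[OF assms(3) x(1) y(1)])
  then show False using cd(2) x(2) y(2) edge_eq_iff[OF x(1) y(1)] by simp
qed

end

context annular
begin

text \<open>The number of blocks is one below that of a tree, so P could be coarser than the
  partition into cycles only if the latter gave a tree; but there a through string would be a
  bridge.\<close>

lemma unicircuit_iff:
  assumes "partition_on S P"
  shows "unicircuit P \<longleftrightarrow> (\<exists>\<tau>. pairing S \<tau> \<and> P = perm_cycles S (\<gamma> \<circ> \<tau>) \<and> 2 * card P = card S \<and>
     strings \<tau> \<noteq> {} \<and> card (strings \<tau>) \<noteq> 2)"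
proof
  assume u: "unicircuit P"
  then obtain \<tau> where d: "darts S \<gamma> \<tau> P" and simple: "darts.simple S \<tau> P"
    using all_edges_double_oppositeE[OF finite_S nonempty_S perm_\<gamma> \<gamma>_S assms] unfolding unicircuit_def by metis
  interpret darts S \<gamma> \<tau> P by (rule d)
  interpret a: annular_darts S A B \<gamma> \<tau> P by unfold_locales
  interpret c: darts S \<gamma> \<tau> "perm_cycles S (\<gamma> \<circ> \<tau>)" by (rule darts_face_partition[OF pairing_\<tau>])
  interpret ca: annular_darts S A B \<gamma> \<tau> "perm_cycles S (\<gamma> \<circ> \<tau>)" by unfold_locales
  have eq: "elementarization (quotient_on S \<gamma> P) = M" by (rule elementarization_simple(1)[OF simple])
  have conn: "uconnected M" using u by (simp add: unicircuit_def eq)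
  obtain C where C: "circuits M = {C}" "\<forall>c \<in> uedges C. \<exists>e \<in> A. \<exists>f \<in> B. c = {e, f}"
    using u unfolding unicircuit_def eq by blast
  have "card (uverts M) = card (uedges M)" by (rule single_circuit_card[OF ugraph_M conn C(1)])
  then have card: "2 * card P = card S" using card_uedges_M by (simp add: uverts_M)
  have "C \<in> circuits M" using C(1) by simp
  then obtain c where c: "c \<in> uedges C" using circuit_edges_nonempty by blast
  then have "c \<in> uedges M" using circuits_subset_not_bridges[OF ugraph_M conn \<open>C \<in> circuits M\<close>] by blast
  then have "c \<in> perm_cycles S \<tau>" by (simp add: pairing_graph_def)
  moreover obtain e f where "e \<in> A" "f \<in> B" "c = {e, f}" using C(2) c by blast
  ultimately have "c \<in> strings \<tau>" by (auto simp: strings_def)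
  then have ne: "strings \<tau> \<noteq> {}" by blast
  then obtain b where b: "b \<in> A" "\<tau> b \<in> B" unfolding a.strings_eq by blast
  have conn': "uconnected c.M" by (rule uconnected_pairing_graph[OF c.darts_axioms b])
  \<comment> \<open>The cycles number at least \<open>card P\<close>, which is half of
    \<open>card S\<close>, and at most one more; this excludes the larger value.\<close>
  have "\<not> (2 * card (perm_cycles S (\<gamma> \<circ> \<tau>)) = card S + 2)"
  proof
    assume "2 * card (perm_cycles S (\<gamma> \<circ> \<tau>)) = card S + 2"
    then have "\<not> uconnected (udelete c.M {b, \<tau> b})"
      using c.tree_edge_bridge'[OF conn'] b(1) S_eq by blast
    moreover have "{b, \<tau> b} \<in> strings \<tau>" using b unfolding a.strings_eq by blast
    ultimately show False using ca.through_not_bridge[OF conn'] by blast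
  qed
  moreover have "card (perm_cycles S (\<gamma> \<circ> \<tau>)) \<le> card (uedges c.M) + 1"
    using uconnected_card_le[OF c.ugraph_M conn'] by (simp add: c.uverts_M)
  ultimately have "card P = card (perm_cycles S (\<gamma> \<circ> \<tau>))"
    using card_le_cycles(1) card c.card_uedges_M by linarith
  then have "P = perm_cycles S (\<gamma> \<circ> \<tau>)" by (rule card_le_cycles(2))
  then show "\<exists>\<tau>. pairing S \<tau> \<and> P = perm_cycles S (\<gamma> \<circ> \<tau>) \<and> 2 * card P = card S \<and>
     strings \<tau> \<noteq> {} \<and> card (strings \<tau>) \<noteq> 2"
    using card pairing_\<tau> ne a.simple_imp_not_two_strings[OF conn card simple] by (intro exI[of _ \<tau>]) simp
next
  assume "\<exists>\<tau>. pairing S \<tau> \<and> P = perm_cycles S (\<gamma> \<circ> \<tau>) \<and> 2 * card P = card S \<and>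
     strings \<tau> \<noteq> {} \<and> card (strings \<tau>) \<noteq> 2"
  then obtain \<tau> where \<tau>: "pairing S \<tau>" "P = perm_cycles S (\<gamma> \<circ> \<tau>)" "2 * card P = card S"
     "strings \<tau> \<noteq> {}" "card (strings \<tau>) \<noteq> 2" by blast
  interpret darts S \<gamma> \<tau> P unfolding \<tau>(2) by (rule darts_face_partition[OF \<tau>(1)])
  interpret a: annular_darts S A B \<gamma> \<tau> P by unfold_locales
  obtain b where b: "b \<in> A" "\<tau> b \<in> B" using \<tau>(4) unfolding a.strings_eq by blast
  have conn: "uconnected M" by (rule uconnected_pairing_graph[OF darts_axioms b])
  have simple by (rule a.simple_if_not_two_strings[OF conn \<tau>(3-5)])
  note el = elementarization_simple[OF this]
  obtain C where C: "circuits M = {C}" "uedges C = strings \<tau>" using a.circuit_strings[OF conn \<tau>(3,4)] .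
  have "\<forall>c \<in> strings \<tau>. \<exists>e \<in> A. \<exists>f \<in> B. c = {e, f}" unfolding a.strings_eq by blast
  then show "unicircuit P"
    unfolding unicircuit_def el(1) using conn C el(2) by blast
qed

end


section \<open>The three segments\<close>

text \<open>\<open>cycle_of_list\<close> applied entrywise rotates the list by one, so position
  \<open>x - l\<close> takes the entry of the next position modulo the length.\<close>

lemma cycle_of_list_upt:
  assumes "x \<in> {l..<h}"
  shows "cycle_of_list [l..<h] x = (if Suc x < h then Suc x else l)"
proof -
  have "map (cycle_of_list [l..<h]) [l..<h] = rotate1 [l..<h]"
    using cyclic_rotation[of "[l..<h]" 1] by simp
  then have "map (cycle_of_list [l..<h]) [l..<h] ! (x - l) = rotate1 [l..<h] ! (x - l)" by simp
  moreover have "x - l < length [l..<h]" "[l..<h] ! (x - l) = x" using assms by auto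
  moreover have "l + Suc (x - l) mod (h - l) < h"
    using assms mod_less_divisor[of "h - l" "Suc (x - l)"] by (simp add: less_diff_conv add.commute)
  ultimately have eq: "cycle_of_list [l..<h] x = l + Suc (x - l) mod (h - l)"
    by (simp add: nth_rotate1 del: rotate1_length01 map_upt_Suc)
  show ?thesis
  proof (cases "Suc x < h")
    case False
    then have "Suc (x - l) = h - l" using assms by auto
    then show ?thesis using eq False by simp
  qed (use eq assms in auto)
qed

text \<open>From any point one climbs to \<open>h - 1\<close>, wraps around to \<open>l\<close>, and
  from there climbs through everything.\<close>

lemma upt_cycle_transitive:
  fixes l h :: nat
  assumes \<gamma>: "\<And>x. x \<in> {l..<h} \<Longrightarrow> \<gamma> x = (if Suc x < h then Suc x else l)"
    and X: "X \<subseteq> {l..<h}" "X \<noteq> {}" and cl: "\<And>x. x \<in> X \<Longrightarrow> \<gamma> x \<in> X"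
  shows "X = {l..<h}"
proof -
  have up: "x + k \<in> X" if "x \<in> X" "x + k < h" for x k
    using that(2)
  proof (induction k)
    case (Suc k)
    then have "x + k \<in> X" by simp
    then show ?case using cl[of "x + k"] \<gamma>[of "x + k"] X(1) Suc.prems by auto
  qed (use that in simp)
  obtain x where x: "x \<in> X" using X(2) by blast
  then have xlh: "l \<le> x" "x < h" using X(1) by auto
  have "h - 1 \<in> X" using up[OF x, of "h - 1 - x"] xlh by simp
  then have "l \<in> X" using cl[of "h - 1"] \<gamma>[of "h - 1"] xlh by auto
  then have "y \<in> X" if "y \<in> {l..<h}" for y using up[of l "y - l"] that by simp
  then show ?thesis using X(1) by blast
qed

lemma orbit_conjugate:
  assumes gh: "\<And>x. g (h x) = h (f x)"
  shows "orbit g (h x) = h ` orbit f x"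
proof
  show "orbit g (h x) \<subseteq> h ` orbit f x"
  proof
    fix y assume "y \<in> orbit g (h x)"
    then show "y \<in> h ` orbit f x"
    proof induction
      case base
      show ?case unfolding gh by (intro imageI orbit.base)
    next
      case (step y)
      then obtain z where z: "z \<in> orbit f x" "y = h z" by blast
      show ?case unfolding z(2) gh by (intro imageI orbit.step z(1))
    qed
  qed
  have "h y \<in> orbit g (h x)" if "y \<in> orbit f x" for y
    using that
  proof induction
    case base
    show ?case unfolding gh[symmetric] by (rule orbit.base)
  next
    case (step y)
    then show ?case unfolding gh[symmetric] by (intro orbit.step)
  qed
  then show "h ` orbit f x \<subseteq> orbit g (h x)" by blast
qed

text \<open>\<tau> conjugates \<open>\<gamma> \<circ> \<tau>\<close> into
  \<open>\<tau> \<circ> \<gamma>\<close>. The annular condition counts cycles of the latter, whereas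
  the vertices of the quotient are cycles of the former.\<close>

lemma card_perm_cycles_conjugate:
  assumes "pairing S \<tau>"
  shows "card (perm_cycles S (\<tau> \<circ> \<gamma>)) = card (perm_cycles S (\<gamma> \<circ> \<tau>))"
proof -
  have inj: "inj \<tau>" using pairingD(1)[OF assms] by (rule permutes_inj)
  have "\<tau> ` S = S" using pairingD(1)[OF assms] by (rule permutes_image)
  then have "perm_cycles S (\<tau> \<circ> \<gamma>) = orbit (\<tau> \<circ> \<gamma>) ` \<tau> ` S" by (simp add: perm_cycles_def)
  also have "\<dots> = (\<lambda>x. \<tau> ` orbit (\<gamma> \<circ> \<tau>) x) ` S"
    unfolding image_image by (intro image_cong refl orbit_conjugate) simp
  also have "\<dots> = (`) \<tau> ` perm_cycles S (\<gamma> \<circ> \<tau>)" by (simp add: perm_cycles_def image_image)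
  also have "card \<dots> = card (perm_cycles S (\<gamma> \<circ> \<tau>))"
    using inj by (intro card_image inj_onI) (simp add: inj_image_eq_iff)
  finally show ?thesis .
qed

section \<open>Annular pairings characterized by counting cycles\<close>

context annular
begin

lemma orbit_A: "x \<in> A \<Longrightarrow> orbit \<gamma> x = A"
  using orbit_subset_closed[OF \<gamma>_A] orbit_nonempty[of \<gamma> x] by (intro transitive_A) (auto intro: orbit.step)

lemma orbit_B: "x \<in> B \<Longrightarrow> orbit \<gamma> x = B"
  using orbit_subset_closed[OF \<gamma>_B] orbit_nonempty[of \<gamma> x] by (intro transitive_B) (auto intro: orbit.step)

lemma perm_cycles_\<gamma>: "perm_cycles S \<gamma> = {A, B}"
proof -
  have "perm_cycles S \<gamma> = orbit \<gamma> ` A \<union> orbit \<gamma> ` B" unfolding perm_cycles_def S_eq image_Un ..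
  also have "orbit \<gamma> ` A = (\<lambda>_. A) ` A" by (rule image_cong) (simp_all add: orbit_A)
  also have "orbit \<gamma> ` B = (\<lambda>_. B) ` B" by (rule image_cong) (simp_all add: orbit_B)
  finally show ?thesis using A_ne B_ne by auto
qed

lemma A_neq_B: "A \<noteq> B" using disj A_ne by auto

text \<open>Without through strings no generating block links A to B; a single one suffices to link
  all of S.\<close>

lemma partition_join_iff:
  assumes "pairing S \<tau>"
  shows "partition_join S (perm_cycles S \<tau>) {A, B} = {S} \<longleftrightarrow> strings \<tau> \<noteq> {}"
proof -
  interpret annular_darts S A B \<gamma> \<tau> "perm_cycles S (\<gamma> \<circ> \<tau>)"
    using darts_face_partition[OF assms] annular_axioms by (intro annular_darts.intro)
  define R where "R = (\<Union>C \<in> perm_cycles S \<tau> \<union> {A, B}. C \<times> C)"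
  have R: "R = (\<Union>x \<in> S. {x, \<tau> x} \<times> {x, \<tau> x}) \<union> A \<times> A \<union> B \<times> B"
    unfolding R_def perm_cycles_pairing[OF assms] by blast
  show ?thesis
  proof
    assume j: "partition_join S (perm_cycles S \<tau>) {A, B} = {S}"
    show "strings \<tau> \<noteq> {}"
    proof
      assume e: "strings \<tau> = {}"
      have same: "x \<in> A \<longleftrightarrow> \<tau> x \<in> A" if "x \<in> S" for x using strings_iff[OF that] e by blast
      \<comment> \<open>The relation on the right is transitive, so it also contains the transitive
        closure of R.\<close>
      have "R \<subseteq> {(x, y). x \<in> A \<longrightarrow> y \<in> A}" unfolding R using same disj \<tau>_\<tau> by fastforce
      then have "R\<^sup>+ \<subseteq> {(x, y). x \<in> A \<longrightarrow> y \<in> A}\<^sup>+" by (rule trancl_mono_subset)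
      also have "\<dots> = {(x, y). x \<in> A \<longrightarrow> y \<in> A}" by (intro trancl_id transI) auto
      finally have RA: "R\<^sup>+ \<subseteq> {(x, y). x \<in> A \<longrightarrow> y \<in> A}" .
      obtain a where a: "a \<in> A" using A_ne by blast
      have "R\<^sup>+ `` {a} \<in> S // R\<^sup>+" using a S_eq by (intro quotientI) simp
      then have "R\<^sup>+ `` {a} = S" using j by (simp add: partition_join_def R_def)
      moreover have "R\<^sup>+ `` {a} \<subseteq> A" using RA a by auto
      ultimately show False using S_eq disj B_ne by auto
    qed
  next
    assume "strings \<tau> \<noteq> {}"
    then obtain b where b: "b \<in> A" "\<tau> b \<in> B" unfolding strings_eq by blast
    have "b \<in> S" using b S_eq by simp
    then have bb: "(b, \<tau> b) \<in> R\<^sup>+" "(\<tau> b, b) \<in> R\<^sup>+" unfolding R by blast+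
    have AA: "(x, y) \<in> R\<^sup>+" if "x \<in> A" "y \<in> A" for x y unfolding R using that by blast
    have BB: "(x, y) \<in> R\<^sup>+" if "x \<in> B" "y \<in> B" for x y unfolding R using that by blast
    have AB: "(x, y) \<in> R\<^sup>+" if "x \<in> A" "y \<in> B" for x y
      using trancl_trans[OF trancl_trans[OF AA[OF that(1) b(1)] bb(1)] BB[OF b(2) that(2)]] .
    have BA: "(x, y) \<in> R\<^sup>+" if "x \<in> B" "y \<in> A" for x y
      using trancl_trans[OF trancl_trans[OF BB[OF that(1) b(2)] bb(2)] AA[OF b(1) that(2)]] .
    have "R \<subseteq> S \<times> S" unfolding R using \<tau>_S in_S_iff by auto
    then have "R\<^sup>+ \<subseteq> S \<times> S" by (rule trancl_subset_Sigma)
    moreover have "S \<times> S \<subseteq> R\<^sup>+" using AA BB AB BA in_S_iff by auto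
    ultimately have "R\<^sup>+ = S \<times> S" by (rule subset_antisym)
    then have "partition_join S (perm_cycles S \<tau>) {A, B} = S // (S \<times> S)"
      unfolding partition_join_def R_def by simp
    also have "\<dots> = {S}" using nonempty_S by (auto simp: quotient_def)
    finally show "partition_join S (perm_cycles S \<tau>) {A, B} = {S}" .
  qed
qed

text \<open>With n elements, \<tau> has n / 2 cycles and \<gamma> has 2. If c is the number of
  cycles of \<open>\<gamma> \<circ> \<tau>\<close>, the length equation n / 2 + (n - c) = (n - 2) +
  2 says c = n / 2; the condition on the join is the existence of a through string.\<close>

lemma annular_pairing_iff:
  assumes \<gamma>': "\<And>x. x \<in> S \<Longrightarrow> \<gamma>' x = \<gamma> x"
  shows "\<tau> permutes S \<and> (\<forall>C \<in> perm_cycles S \<tau>. card C = 2) \<and>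
       perm_length S \<tau> + perm_length S (inv \<tau> \<circ> \<gamma>') = perm_length S \<gamma>' + 2 \<and>
       partition_join S (perm_cycles S \<tau>) (perm_cycles S \<gamma>') = {S} \<longleftrightarrow>
    pairing S \<tau> \<and> 2 * card (perm_cycles S (\<gamma> \<circ> \<tau>)) = card S \<and> strings \<tau> \<noteq> {}"
proof (cases "pairing S \<tau>")
  case True
  have "orbit \<gamma>' x = orbit \<gamma> x" if "x \<in> S" for x
    using that \<gamma>_S \<gamma>' by (intro orbit_cong0[where A = S]) auto
  then have cyc': "perm_cycles S \<gamma>' = {A, B}" unfolding perm_cycles_\<gamma>[symmetric] by (simp add: perm_cycles_def)
  have "inv \<tau> = \<tau>" using pairingD(4)[OF True] by (intro inv_unique_comp) (simp_all add: fun_eq_iff)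
  moreover have "orbit (\<tau> \<circ> \<gamma>') x = orbit (\<tau> \<circ> \<gamma>) x" if "x \<in> S" for x
    using that \<gamma>_S \<gamma>' pairingD(2)[OF True] by (intro orbit_cong0[where A = S]) auto
  ultimately have "perm_cycles S (inv \<tau> \<circ> \<gamma>') = perm_cycles S (\<tau> \<circ> \<gamma>)" by (simp add: perm_cycles_def)
  then have c: "card (perm_cycles S (inv \<tau> \<circ> \<gamma>')) = card (perm_cycles S (\<gamma> \<circ> \<tau>))"
    using card_perm_cycles_conjugate[OF True] by simp
  have "card (perm_cycles S (\<gamma> \<circ> \<tau>)) \<le> card S" using finite_S by (simp add: perm_cycles_def card_image_le)
  moreover have "2 * card (perm_cycles S \<tau>) = card S" by (rule card_perm_cycles_pairing[OF finite_S True])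
  moreover have "card {A, B} = 2" using A_neq_B by simp
  \<comment> \<open>This keeps the truncated subtraction in the length of \<gamma> exact.\<close>
  moreover have "2 \<le> card S"
  proof -
    have "card (A \<union> B) = card A + card B" using finite_S disj unfolding S_eq by (intro card_Un_disjoint) auto
    moreover have "card A > 0" "card B > 0" using finite_S A_ne B_ne unfolding S_eq by (auto simp: card_gt_0_iff)
    ultimately show ?thesis unfolding S_eq by simp
  qed
  ultimately have "perm_length S \<tau> + perm_length S (inv \<tau> \<circ> \<gamma>') = perm_length S \<gamma>' + 2 \<longleftrightarrow>
      2 * card (perm_cycles S (\<gamma> \<circ> \<tau>)) = card S"
    unfolding perm_length_def c cyc' by linarith
  then show ?thesis
    using True pairing_iff_card_cycles[OF finite_S, of \<tau>] partition_join_iff[OF True] unfolding cyc' by blast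
qed (use pairing_iff_card_cycles[OF finite_S] in blast)

end

section \<open>The three segments and the pairings on them\<close>

locale three_cycles =
  fixes m :: "nat \<Rightarrow> nat"
  assumes m_pos: "j \<in> {1, 2, 3} \<Longrightarrow> m j \<ge> 1"
begin

abbreviation "seg \<equiv> segment m"
abbreviation "\<gamma> \<equiv> gamma m"

definition lo :: "nat \<Rightarrow> nat" where "lo j = (\<Sum>k = 1..<j. m k) + 1"
definition hi :: "nat \<Rightarrow> nat" where "hi j = (\<Sum>k = 1..j. m k) + 1"

lemma seg_eq: "seg j = {lo j..<hi j}" by (simp only: segment_def cycle_list_def lo_def hi_def set_upt)

lemma bounds: "lo 1 = 1" "hi 1 = m 1 + 1" "lo 2 = m 1 + 1" "hi 2 = m 1 + m 2 + 1"
  "lo 3 = m 1 + m 2 + 1" "hi 3 = m 1 + m 2 + m 3 + 1"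
  by (simp_all add: lo_def hi_def numeral_2_eq_2 numeral_3_eq_3)

lemma index_cases: "j \<in> {1, 2, 3} \<Longrightarrow> (j = 1 \<Longrightarrow> Q) \<Longrightarrow> (j = 2 \<Longrightarrow> Q) \<Longrightarrow> (j = 3 \<Longrightarrow> Q) \<Longrightarrow> Q" for j :: nat
  unfolding insert_iff by (elim disjE) simp_all

lemma lo_less_hi: "j \<in> {1, 2, 3} \<Longrightarrow> lo j < hi j"
  using m_pos[of j] by (elim index_cases) (simp_all only: bounds, simp_all)

lemma seg_nonempty: "j \<in> {1, 2, 3} \<Longrightarrow> seg j \<noteq> {}"
  using lo_less_hi[of j] unfolding seg_eq by simp

lemma finite_seg: "finite (seg j)" by (simp add: seg_eq)

lemma seg_disjoint: "i \<in> {1, 2, 3} \<Longrightarrow> j \<in> {1, 2, 3} \<Longrightarrow> i \<noteq> j \<Longrightarrow> seg i \<inter> seg j = {}"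
  unfolding seg_eq by (elim index_cases) (simp_all only: bounds, auto)

lemma seg_union: "seg 1 \<union> seg 2 \<union> seg 3 = {1..m 1 + m 2 + m 3}"
  unfolding seg_eq bounds by auto

lemma basic_cycle_eq: "x \<in> seg j \<Longrightarrow> basic_cycle m j x = (if Suc x < hi j then Suc x else lo j)"
  unfolding basic_cycle_def cycle_list_def lo_def[symmetric] hi_def[symmetric] seg_eq by (rule cycle_of_list_upt)

lemma basic_cycle_outside: "x \<notin> seg j \<Longrightarrow> basic_cycle m j x = x"
  unfolding basic_cycle_def segment_def by (rule id_outside_supp)

lemma basic_cycle_seg: "x \<in> seg j \<Longrightarrow> basic_cycle m j x \<in> seg j"
  using permutes_in_image[OF cycle_permutes, of "cycle_list m j" x] by (simp add: basic_cycle_def segment_def)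

text \<open>Points of the segment and their images are fixed by the other two basic cycles, so the
  order of composition does not matter.\<close>

lemma gamma_basic:
  assumes "j \<in> {1, 2, 3}" "x \<in> seg j"
  shows "\<gamma> x = basic_cycle m j x"
proof -
  have out: "y \<notin> seg i" if "y \<in> seg j" "i \<in> {1, 2, 3}" "i \<noteq> j" for i y
    using seg_disjoint[OF assms(1) that(2)] that by auto
  show ?thesis
    using assms(1) out[OF assms(2)] out[OF basic_cycle_seg[OF assms(2)]]
    by (elim index_cases) (simp_all add: gamma_def basic_cycle_outside)
qed

lemma gamma_eq: "j \<in> {1, 2, 3} \<Longrightarrow> x \<in> seg j \<Longrightarrow> \<gamma> x = (if Suc x < hi j then Suc x else lo j)"
  using gamma_basic basic_cycle_eq by simp

lemma gamma_seg: "j \<in> {1, 2, 3} \<Longrightarrow> \<gamma> ` seg j \<subseteq> seg j"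
  using gamma_basic basic_cycle_seg by auto

lemma permutation_gamma: "permutation \<gamma>"
  unfolding gamma_def basic_cycle_def by (intro permutation_compose permutation_of_cycle)

lemma gamma_transitive:
  assumes "j \<in> {1, 2, 3}" "X \<subseteq> seg j" "X \<noteq> {}" "\<And>x. x \<in> X \<Longrightarrow> \<gamma> x \<in> X"
  shows "X = seg j"
  using gamma_eq[OF assms(1)] assms(2-4) unfolding seg_eq by (rule upt_cycle_transitive)

lemma cyclic_darts_seg:
  assumes "j \<in> {1, 2, 3}"
  shows "cyclic_darts (seg j) \<gamma>"
proof
  show "X = seg j" if "X \<subseteq> seg j" "X \<noteq> {}" "\<And>x. x \<in> X \<Longrightarrow> \<gamma> x \<in> X" for X
    using gamma_transitive[OF assms that] .
qed (rule finite_seg seg_nonempty[OF assms] permutation_gamma gamma_seg[OF assms])+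

lemma annular_segs:
  assumes "j \<in> {1, 2, 3}" "k \<in> {1, 2, 3}" "j \<noteq> k"
  shows "annular (seg j \<union> seg k) (seg j) (seg k) \<gamma>"
proof
  show "X = seg j" if "X \<subseteq> seg j" "X \<noteq> {}" "\<And>x. x \<in> X \<Longrightarrow> \<gamma> x \<in> X" for X
    using gamma_transitive[OF assms(1) that] .
  show "X = seg k" if "X \<subseteq> seg k" "X \<noteq> {}" "\<And>x. x \<in> X \<Longrightarrow> \<gamma> x \<in> X" for X
    using gamma_transitive[OF assms(2) that] .
qed (rule finite_UnI finite_seg refl seg_nonempty[OF assms(1)] seg_nonempty[OF assms(2)] permutation_gamma
    gamma_seg[OF assms(1)] gamma_seg[OF assms(2)] seg_disjoint[OF assms])+

lemma NC2_iff_pairing: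
  "\<tau> \<in> NC2 m i \<longleftrightarrow> pairing (seg i) \<tau> \<and>
    \<not> (\<exists>a \<in> seg i. \<exists>b \<in> seg i. a < b \<and> b < \<tau> a \<and> \<tau> a < \<tau> b)"
  unfolding pairing_iff_card_cycles[OF finite_seg] NC2_def mem_Collect_eq conj_assoc ..

text \<open>With n elements this asks for n / 2 + 1 cycles of
  \<open>\<gamma> \<circ> \<tau>\<close>, the number of vertices of a tree with n / 2 edges.\<close>

lemma NC2_iff:
  assumes i: "i \<in> {1, 2, 3}"
  shows "\<tau> \<in> NC2 m i \<longleftrightarrow> pairing (seg i) \<tau> \<and> 2 * card (perm_cycles (seg i) (\<gamma> \<circ> \<tau>)) = card (seg i) + 2"
proof (cases "pairing (seg i) \<tau>")
  case True
  interpret cyclic_darts "seg i" \<gamma> by (rule cyclic_darts_seg[OF i])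
  have d: "darts (seg i) \<gamma> \<tau> (perm_cycles (seg i) (\<gamma> \<circ> \<tau>))" by (rule darts_face_partition[OF True])
  then interpret segment_darts "lo i" "hi i" \<gamma> \<tau> "perm_cycles {lo i..<hi i} (\<gamma> \<circ> \<tau>)"
    unfolding seg_eq by (intro segment_darts.intro segment_darts_axioms.intro) (use gamma_eq[OF i] in \<open>simp_all add: seg_eq\<close>)
  have "\<not> (\<exists>a \<in> seg i. \<exists>b \<in> seg i. a < b \<and> b < \<tau> a \<and> \<tau> a < \<tau> b) \<longleftrightarrow>
      2 * card (perm_cycles (seg i) (\<gamma> \<circ> \<tau>)) = card (seg i) + 2"
    using noncrossing_iff_card[OF refl uconnected_pairing_graph[OF d, unfolded seg_eq]] unfolding seg_eq .
  then show ?thesis unfolding NC2_iff_pairing by simp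
qed (simp add: NC2_iff_pairing)

lemma NC2_annular_iff:
  assumes jk: "j \<in> {1, 2, 3}" "k \<in> {1, 2, 3}" "j \<noteq> k"
  shows "\<tau> \<in> NC2_annular m j k \<longleftrightarrow> pairing (seg j \<union> seg k) \<tau> \<and>
    2 * card (perm_cycles (seg j \<union> seg k) (\<gamma> \<circ> \<tau>)) = card (seg j \<union> seg k) \<and> through_strings m j k \<tau> \<noteq> {}"
proof -
  interpret annular "seg j \<union> seg k" "seg j" "seg k" \<gamma> by (rule annular_segs[OF jk])
  have ts: "strings \<tau> = through_strings m j k \<tau>" by (simp add: strings_def through_strings_def)
  \<comment> \<open>On the third segment the product of the two cycles may differ from \<gamma>, so
    agreement is claimed on these two only.\<close>
  have \<gamma>': "(basic_cycle m j \<circ> basic_cycle m k) x = \<gamma> x" if x: "x \<in> seg j \<union> seg k" for x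
  proof (cases "x \<in> seg k")
    case True
    then have "basic_cycle m k x \<notin> seg j" using seg_disjoint[OF jk] basic_cycle_seg[of x k] by blast
    then show ?thesis using gamma_basic[OF jk(2) True] basic_cycle_outside by simp
  next
    case False
    then show ?thesis using x gamma_basic[OF jk(1), of x] basic_cycle_outside[of x k] by simp
  qed
  show ?thesis
    unfolding NC2_annular_def Let_def ts[symmetric] mem_Collect_eq by (rule annular_pairing_iff) (rule \<gamma>')
qed

lemma double_tree_NC2:
  assumes i: "i \<in> {1, 2, 3}" and P: "partition_on (seg i) (restrict_partition P (seg i))"
  shows "double_tree (quotient_cycle_graph m P {i}) \<longleftrightarrow>
    (\<exists>\<tau> \<in> NC2 m i. restrict_partition P (seg i) = perm_cycles (seg i) (\<gamma> \<circ> \<tau>))"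
proof -
  interpret cyclic_darts "seg i" \<gamma> by (rule cyclic_darts_seg[OF i])
  have "quotient_cycle_graph m P {i} = quotient_on (seg i) \<gamma> (restrict_partition P (seg i))"
    by (simp add: quotient_cycle_graph_def cycle_graph_def quotient_on_def)
  then have "double_tree (quotient_cycle_graph m P {i}) \<longleftrightarrow> (\<exists>\<tau>. pairing (seg i) \<tau> \<and>
      restrict_partition P (seg i) = perm_cycles (seg i) (\<gamma> \<circ> \<tau>) \<and>
      2 * card (restrict_partition P (seg i)) = card (seg i) + 2)"
    using double_tree_iff[OF P] by simp
  also have "\<dots> \<longleftrightarrow> (\<exists>\<tau> \<in> NC2 m i. restrict_partition P (seg i) = perm_cycles (seg i) (\<gamma> \<circ> \<tau>))"
    unfolding Bex_def NC2_iff[OF i] by (intro iff_exI) auto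
  finally show ?thesis .
qed

text \<open>\<open>NC2_annular\<close> admits any positive number of through strings; two are
  excluded here because they would be parallel edges.\<close>

lemma double_unicircuit_NC2_annular:
  assumes jk: "j \<in> {1, 2, 3}" "k \<in> {1, 2, 3}" "j \<noteq> k"
    and P: "partition_on (seg j \<union> seg k) (restrict_partition P (seg j \<union> seg k))"
  shows "double_unicircuit m P j k \<longleftrightarrow>
    (\<exists>\<tau> \<in> NC2_annular m j k. card (through_strings m j k \<tau>) \<noteq> 2 \<and>
       restrict_partition P (seg j \<union> seg k) = perm_cycles (seg j \<union> seg k) (\<gamma> \<circ> \<tau>))"
proof -
  interpret annular "seg j \<union> seg k" "seg j" "seg k" \<gamma> by (rule annular_segs[OF jk])
  have ts: "strings \<tau> = through_strings m j k \<tau>" for \<tau> by (simp add: strings_def through_strings_def)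
  have "quotient_cycle_graph m P {j, k} = quotient_on (seg j \<union> seg k) \<gamma> (restrict_partition P (seg j \<union> seg k))"
    by (simp add: quotient_cycle_graph_def cycle_graph_def quotient_on_def)
  then have "double_unicircuit m P j k \<longleftrightarrow> unicircuit (restrict_partition P (seg j \<union> seg k))"
    by (simp add: double_unicircuit_def unicircuit_def Let_def)
  also have "\<dots> \<longleftrightarrow> (\<exists>\<tau> \<in> NC2_annular m j k. card (through_strings m j k \<tau>) \<noteq> 2 \<and>
       restrict_partition P (seg j \<union> seg k) = perm_cycles (seg j \<union> seg k) (\<gamma> \<circ> \<tau>))"
    unfolding unicircuit_iff[OF P] Bex_def NC2_annular_iff[OF jk] ts by (intro iff_exI) auto
  finally show ?thesis .
qed

end


section \<open>Gluing partitions\<close>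

text \<open>Used with fibres of size 2 for gluing and of size 4 for merging.\<close>

lemma card_eq_card_fibre_mult:
  assumes "finite D" "\<And>d. d \<in> D \<Longrightarrow> card {d' \<in> D. f d' = f d} = k"
  shows "card D = k * card (f ` D)"
proof -
  have "card D = (\<Sum>y \<in> f ` D. card {d \<in> D. f d = y})"
    using sum.image_gen[OF assms(1), of "\<lambda>_. 1::nat" f] by simp
  also have "\<dots> = (\<Sum>y \<in> f ` D. k)"
    using assms(2) by (intro sum.cong) auto
  finally show ?thesis by simp
qed

section \<open>Restricting and gluing partitions\<close>

lemma partition_on_restrict_partition:
  assumes "partition_on N P" "S \<subseteq> N"
  shows "partition_on S (restrict_partition P S)"
proof -
  have "restrict_partition P S = (\<inter>) S ` P - {{}}"
    unfolding restrict_partition_def by (simp add: Int_commute)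
  moreover have "S \<inter> N = S" using assms(2) by blast
  ultimately show ?thesis using partition_on_restrict[OF assms(1), of S] by simp
qed

lemma block_of_restrict_partition:
  assumes P: "partition_on N P" and "S \<subseteq> N" "x \<in> S"
  shows "block_of (restrict_partition P S) x = block_of P x \<inter> S"
proof (rule block_of_eq[OF partition_on_restrict_partition[OF assms(1,2)]])
  have "x \<in> N" using assms by blast
  then have "block_of P x \<in> P" "x \<in> block_of P x" using block_of_in[OF P] by blast+
  then show "x \<in> block_of P x \<inter> S" "block_of P x \<inter> S \<in> restrict_partition P S"
    using assms(3) by (auto simp: restrict_partition_def)
qed

lemma block_of_restrict_eq_iff:
  assumes P: "partition_on N P" and "S \<subseteq> N" "x \<in> S" "y \<in> S"
  shows "block_of (restrict_partition P S) x = block_of (restrict_partition P S) y \<longleftrightarrow> block_of P x = block_of P y"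
proof
  have N: "x \<in> N" "y \<in> N" using assms by auto
  assume "block_of (restrict_partition P S) x = block_of (restrict_partition P S) y"
  then have "x \<in> block_of P y"
    using block_of_restrict_partition[OF assms(1,2)] block_of_in(2)[OF P N(1)] assms(3,4) by auto
  then show "block_of P x = block_of P y" using block_of_eq[OF P block_of_in(1)[OF P N(2)]] by simp
qed (simp add: block_of_restrict_partition[OF assms(1,2)] assms(3,4))

lemma restrict_partition_self:
  assumes "partition_on N P"
  shows "restrict_partition P N = P"
proof -
  have "B \<inter> N = B" if "B \<in> P" for B using partition_onD1[OF assms] that by blast
  then have "(\<lambda>B. B \<inter> N) ` P = P" by simp
  then show ?thesis using partition_onD3[OF assms] by (simp add: restrict_partition_def)
qed

text \<open>The order matters: \<open>u1\<close> goes with \<open>v1\<close> and \<open>u2\<close>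
  with \<open>v2\<close>, which records in which direction the two edges are matched.\<close>

definition glue :: "'a set set \<Rightarrow> 'a set set \<Rightarrow> 'a set \<Rightarrow> 'a set \<Rightarrow> 'a set \<Rightarrow> 'a set \<Rightarrow> 'a set set" where
  "glue Q1 Q2 u1 u2 v1 v2 = (Q1 - {u1, u2}) \<union> (Q2 - {v1, v2}) \<union> {u1 \<union> v1, u2 \<union> v2}"

lemma glue_swap: "glue Q1 Q2 u2 u1 v2 v1 = glue Q1 Q2 u1 u2 v1 v2"
  by (simp add: glue_def insert_commute)

locale gluing =
  fixes S1 S2 :: "'a set" and Q1 Q2 u1 u2 v1 v2
  assumes disj: "S1 \<inter> S2 = {}" and Q1: "partition_on S1 Q1" and Q2: "partition_on S2 Q2"
    and u: "u1 \<in> Q1" "u2 \<in> Q1" "u1 \<noteq> u2" and v: "v1 \<in> Q2" "v2 \<in> Q2" "v1 \<noteq> v2"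
begin

lemma sub1: "B \<in> Q1 \<Longrightarrow> B \<subseteq> S1" and sub2: "B \<in> Q2 \<Longrightarrow> B \<subseteq> S2"
  using partition_onD1[OF Q1] partition_onD1[OF Q2] by blast+

lemma ne1: "B \<in> Q1 \<Longrightarrow> B \<noteq> {}" and ne2: "B \<in> Q2 \<Longrightarrow> B \<noteq> {}"
  using partition_onD3[OF Q1] partition_onD3[OF Q2] by blast+

lemma d1: "B \<in> Q1 \<Longrightarrow> C \<in> Q1 \<Longrightarrow> B \<noteq> C \<Longrightarrow> B \<inter> C = {}"
  using disjointD[OF partition_onD2[OF Q1]] .

lemma d2: "B \<in> Q2 \<Longrightarrow> C \<in> Q2 \<Longrightarrow> B \<noteq> C \<Longrightarrow> B \<inter> C = {}"
  using disjointD[OF partition_onD2[OF Q2]] .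

lemma d12: "B \<in> Q1 \<Longrightarrow> C \<in> Q2 \<Longrightarrow> B \<inter> C = {}"
  using sub1[of B] sub2[of C] disj by blast

lemma traces1: "B \<in> Q1 \<Longrightarrow> B \<inter> S1 = B" "B \<in> Q1 \<Longrightarrow> B \<inter> S2 = {}"
  using sub1[of B] disj by blast+

lemma traces2: "B \<in> Q2 \<Longrightarrow> B \<inter> S2 = B" "B \<in> Q2 \<Longrightarrow> B \<inter> S1 = {}"
  using sub2[of B] disj by blast+

lemma traces_glued:
  "(u1 \<union> v1) \<inter> S1 = u1" "(u2 \<union> v2) \<inter> S1 = u2" "(u1 \<union> v1) \<inter> S2 = v1" "(u2 \<union> v2) \<inter> S2 = v2"
  using traces1[OF u(1)] traces1[OF u(2)] traces2[OF v(1)] traces2[OF v(2)] by (simp_all add: Int_Un_distrib2)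

lemma partition_on_glue: "partition_on (S1 \<union> S2) (glue Q1 Q2 u1 u2 v1 v2)"
proof (rule partition_onI)
  have U: "\<Union> Q1 = S1" "\<Union> Q2 = S2" using partition_onD1[OF Q1] partition_onD1[OF Q2] by simp_all
  have "\<Union> (glue Q1 Q2 u1 u2 v1 v2) = \<Union> ((Q1 - {u1, u2}) \<union> {u1, u2}) \<union> \<Union> ((Q2 - {v1, v2}) \<union> {v1, v2})"
    by (auto simp: glue_def)
  also have "(Q1 - {u1, u2}) \<union> {u1, u2} = Q1" using u by auto
  also have "(Q2 - {v1, v2}) \<union> {v1, v2} = Q2" using v by auto
  finally show "\<Union> (glue Q1 Q2 u1 u2 v1 v2) = S1 \<union> S2" using U by simp
  show "{} \<notin> glue Q1 Q2 u1 u2 v1 v2" using ne1 ne2 u v by (auto simp: glue_def)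
  have glued: "(u1 \<union> v1) \<inter> (u2 \<union> v2) = {}"
    using d1[OF u] d2[OF v] d12[OF u(1) v(2)] d12[OF u(2) v(1)] by blast
  have old: "B \<inter> (u1 \<union> v1) = {} \<and> B \<inter> (u2 \<union> v2) = {}" if "B \<in> (Q1 - {u1, u2}) \<union> (Q2 - {v1, v2})" for B
    using that
  proof
    assume B: "B \<in> Q1 - {u1, u2}"
    then show ?thesis using d1[of B u1] d1[of B u2] d12[of B v1] d12[of B v2] u v by (simp add: Int_Un_distrib)
  next
    assume B: "B \<in> Q2 - {v1, v2}"
    then show ?thesis using d2[of B v1] d2[of B v2] d12[of u1 B] d12[of u2 B] u v
      by (simp add: Int_Un_distrib Int_commute)
  qed
  have old2: "B \<inter> C = {}" if "B \<in> (Q1 - {u1, u2}) \<union> (Q2 - {v1, v2})" "C \<in> (Q1 - {u1, u2}) \<union> (Q2 - {v1, v2})" "B \<noteq> C" for B C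
  proof -
    have "B \<in> Q1 \<or> B \<in> Q2" "C \<in> Q1 \<or> C \<in> Q2" using that(1,2) by blast+
    then show ?thesis
      using d1[of B C] d2[of B C] d12[of B C] d12[of C B] that(3) by (elim disjE) (simp_all add: Int_commute)
  qed
  fix B C assume "B \<in> glue Q1 Q2 u1 u2 v1 v2" "C \<in> glue Q1 Q2 u1 u2 v1 v2" and ne: "B \<noteq> C"
  then have "B \<in> (Q1 - {u1, u2}) \<union> (Q2 - {v1, v2}) \<or> B = u1 \<union> v1 \<or> B = u2 \<union> v2"
    "C \<in> (Q1 - {u1, u2}) \<union> (Q2 - {v1, v2}) \<or> C = u1 \<union> v1 \<or> C = u2 \<union> v2"
    unfolding glue_def by blast+
  then show "disjnt B C" unfolding disjnt_def using old[of B] old[of C] old2[of B C] glued ne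
    by (elim disjE) (simp_all add: Int_commute)
qed

lemma restrict_glue1: "restrict_partition (glue Q1 Q2 u1 u2 v1 v2) S1 = Q1"
proof -
  have a: "(\<lambda>B. B \<inter> S1) ` (Q1 - {u1, u2}) = Q1 - {u1, u2}" using traces1 by force
  have b: "(\<lambda>B. B \<inter> S1) ` (Q2 - {v1, v2}) \<subseteq> {{}}" using traces2 by force
  have "(\<lambda>B. B \<inter> S1) ` glue Q1 Q2 u1 u2 v1 v2 - {{}} = ((Q1 - {u1, u2}) \<union> {u1, u2}) - {{}}"
    unfolding glue_def image_Un a using b traces_glued by auto
  also have "\<dots> = Q1" using u ne1 by auto
  finally show ?thesis unfolding restrict_partition_def .
qed

lemma restrict_glue2: "restrict_partition (glue Q1 Q2 u1 u2 v1 v2) S2 = Q2"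
proof -
  have a: "(\<lambda>B. B \<inter> S2) ` (Q2 - {v1, v2}) = Q2 - {v1, v2}" using traces2 by force
  have b: "(\<lambda>B. B \<inter> S2) ` (Q1 - {u1, u2}) \<subseteq> {{}}" using traces1 by force
  have "(\<lambda>B. B \<inter> S2) ` glue Q1 Q2 u1 u2 v1 v2 - {{}} = ((Q2 - {v1, v2}) \<union> {v1, v2}) - {{}}"
    unfolding glue_def image_Un a using b traces_glued by auto
  also have "\<dots> = Q2" using v ne2 by auto
  finally show ?thesis unfolding restrict_partition_def .
qed

text \<open>Makes the gluing recoverable: the two merged blocks can be recognised in the
  result.\<close>

lemma common_glue: "{B \<in> glue Q1 Q2 u1 u2 v1 v2. B \<inter> S1 \<noteq> {} \<and> B \<inter> S2 \<noteq> {}} = {u1 \<union> v1, u2 \<union> v2}"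
proof (intro set_eqI iffI)
  fix B assume "B \<in> {B \<in> glue Q1 Q2 u1 u2 v1 v2. B \<inter> S1 \<noteq> {} \<and> B \<inter> S2 \<noteq> {}}"
  then have B: "B \<in> Q1 \<or> B \<in> Q2 \<or> B \<in> {u1 \<union> v1, u2 \<union> v2}" "B \<inter> S1 \<noteq> {}" "B \<inter> S2 \<noteq> {}"
    unfolding glue_def by blast+
  then show "B \<in> {u1 \<union> v1, u2 \<union> v2}" using traces1(2)[of B] traces2(2)[of B] by (elim disjE) simp_all
next
  fix B assume B: "B \<in> {u1 \<union> v1, u2 \<union> v2}"
  then have "B \<inter> S1 \<noteq> {}" "B \<inter> S2 \<noteq> {}"
    using traces_glued ne1[OF u(1)] ne1[OF u(2)] ne2[OF v(1)] ne2[OF v(2)] by auto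
  then show "B \<in> {B \<in> glue Q1 Q2 u1 u2 v1 v2. B \<inter> S1 \<noteq> {} \<and> B \<inter> S2 \<noteq> {}}"
    using B unfolding glue_def by blast
qed

text \<open>The unordered pair of common blocks is determined, and their traces on S1 and S2 give
  back the ends; only the simultaneous exchange remains.\<close>

lemma glue_eq_iff:
  assumes "gluing S1 S2 Q1 Q2 u1' u2' v1' v2'"
  shows "glue Q1 Q2 u1 u2 v1 v2 = glue Q1 Q2 u1' u2' v1' v2' \<longleftrightarrow>
    u1' = u1 \<and> u2' = u2 \<and> v1' = v1 \<and> v2' = v2 \<or> u1' = u2 \<and> u2' = u1 \<and> v1' = v2 \<and> v2' = v1"
proof
  interpret g: gluing S1 S2 Q1 Q2 u1' u2' v1' v2' by (rule assms)
  assume "glue Q1 Q2 u1 u2 v1 v2 = glue Q1 Q2 u1' u2' v1' v2'"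
  then have "{u1 \<union> v1, u2 \<union> v2} = {u1' \<union> v1', u2' \<union> v2'}"
    using common_glue g.common_glue by metis
  then have "u1' \<union> v1' = u1 \<union> v1 \<and> u2' \<union> v2' = u2 \<union> v2 \<or> u1' \<union> v1' = u2 \<union> v2 \<and> u2' \<union> v2' = u1 \<union> v1"
    by (simp only: doubleton_eq_iff) blast
  then show "u1' = u1 \<and> u2' = u2 \<and> v1' = v1 \<and> v2' = v2 \<or> u1' = u2 \<and> u2' = u1 \<and> v1' = v2 \<and> v2' = v1"
  proof (elim disjE conjE)
    assume "u1' \<union> v1' = u1 \<union> v1" "u2' \<union> v2' = u2 \<union> v2"
    then show ?thesis using traces_glued g.traces_glued by simp
  next
    assume "u1' \<union> v1' = u2 \<union> v2" "u2' \<union> v2' = u1 \<union> v1"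
    then show ?thesis using traces_glued g.traces_glued by simp
  qed
next
  assume "u1' = u1 \<and> u2' = u2 \<and> v1' = v1 \<and> v2' = v2 \<or> u1' = u2 \<and> u2' = u1 \<and> v1' = v2 \<and> v2' = v1"
  then show "glue Q1 Q2 u1 u2 v1 v2 = glue Q1 Q2 u1' u2' v1' v2'"
    using glue_swap[of Q1 Q2 u1 u2 v1 v2] by (elim disjE conjE) simp_all
qed

end

text \<open>Any block other than the two common ones lies on one side, where restriction does not
  change it. This is the converse to the construction by gluing.\<close>

lemma glue_restrict:
  assumes P: "partition_on (S1 \<union> S2) P" and disj: "S1 \<inter> S2 = {}" and ne: "B1 \<noteq> B2"
    and common: "{B \<in> P. B \<inter> S1 \<noteq> {} \<and> B \<inter> S2 \<noteq> {}} = {B1, B2}"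
  shows "P = glue (restrict_partition P S1) (restrict_partition P S2) (B1 \<inter> S1) (B2 \<inter> S1) (B1 \<inter> S2) (B2 \<inter> S2)"
proof -
  have sub: "B \<subseteq> S1 \<union> S2" and nonempty: "B \<noteq> {}" if "B \<in> P" for B
    using partition_onD1[OF P] partition_onD3[OF P] that by blast+
  have B12: "B1 \<in> P" "B2 \<in> P" "B1 \<inter> S1 \<noteq> {}" "B2 \<inter> S1 \<noteq> {}" "B1 \<inter> S2 \<noteq> {}" "B2 \<inter> S2 \<noteq> {}"
    using common by blast+
  have only1: "restrict_partition P S - {B1 \<inter> S, B2 \<inter> S} = {B \<in> P. B \<subseteq> S}"
    if S: "S = S1 \<and> T = S2 \<or> S = S2 \<and> T = S1" for S T
  proof (intro set_eqI iffI)
    fix C assume "C \<in> restrict_partition P S - {B1 \<inter> S, B2 \<inter> S}"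
    then obtain B where B: "B \<in> P" "C = B \<inter> S" "C \<noteq> {}" "B \<noteq> B1" "B \<noteq> B2" by (auto simp: restrict_partition_def)
    then have "B \<inter> T = {}" using common S by blast
    then have "B \<inter> S = B" using sub[OF B(1)] S by blast
    then show "C \<in> {B \<in> P. B \<subseteq> S}" using B by auto
  next
    fix C assume C: "C \<in> {B \<in> P. B \<subseteq> S}"
    then have "C \<inter> S = C" by blast
    \<comment> \<open>If a common block had the block C inside S as its trace, the two would
      intersect and coincide, but then the common block would miss T.\<close>
    moreover have "B \<inter> S \<noteq> C" if B: "B = B1 \<or> B = B2" for B
    proof
      assume eq: "B \<inter> S = C"
      have "B \<in> P" using B B12 by blast
      moreover have "B \<inter> C \<noteq> {}" using eq nonempty C by blast
      ultimately have "B = C" using disjointD[OF partition_onD2[OF P]] C by blast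
      then have "B \<inter> T = {}" using C S disj by blast
      then show False using B B12 S by blast
    qed
    ultimately show "C \<in> restrict_partition P S - {B1 \<inter> S, B2 \<inter> S}"
      using C nonempty[of C] unfolding restrict_partition_def by (auto intro: rev_image_eqI[of C])
  qed
  have B: "B1 \<inter> S1 \<union> B1 \<inter> S2 = B1" "B2 \<inter> S1 \<union> B2 \<inter> S2 = B2" using sub B12 by blast+
  have P_eq: "P = {B \<in> P. B \<subseteq> S1} \<union> {B \<in> P. B \<subseteq> S2} \<union> {B1, B2}"
  proof
    show "P \<subseteq> {B \<in> P. B \<subseteq> S1} \<union> {B \<in> P. B \<subseteq> S2} \<union> {B1, B2}"
    proof
      fix B assume B: "B \<in> P"
      show "B \<in> {B \<in> P. B \<subseteq> S1} \<union> {B \<in> P. B \<subseteq> S2} \<union> {B1, B2}"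
      proof (cases "B \<in> {B1, B2}")
        case False
        then have "B \<inter> S1 = {} \<or> B \<inter> S2 = {}" using common B by blast
        then have "B \<subseteq> S1 \<or> B \<subseteq> S2" using sub[OF B] by blast
        then show ?thesis using B by blast
      qed blast
    qed
  qed (use B12 in auto)
  have old: "restrict_partition P S1 - {B1 \<inter> S1, B2 \<inter> S1} = {B \<in> P. B \<subseteq> S1}"
    "restrict_partition P S2 - {B1 \<inter> S2, B2 \<inter> S2} = {B \<in> P. B \<subseteq> S2}"
    using only1[of S1 S2] only1[of S2 S1] by simp_all
  show ?thesis unfolding glue_def B old by (rule P_eq)
qed


section \<open>Gluing a double tree to a unicircuit graph\<close>

text \<open>The index \<open>i\<close> is that of the double tree, \<open>j\<close> and
  \<open>k\<close> those of the unicircuit graph.\<close>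

locale index_triple = three_cycles +
  fixes i j k :: nat
  assumes ijk: "{i, j, k} = {1, 2, 3}"
begin

lemma index: "i \<in> {1, 2, 3}" "j \<in> {1, 2, 3}" "k \<in> {1, 2, 3}"
  using ijk by blast+

lemma index_neq: "i \<noteq> j" "i \<noteq> k" "j \<noteq> k"
proof -
  have c: "card {i, j, k} = 3" unfolding ijk by simp
  have "card {x, y} \<le> 2" for x y :: nat by (simp add: card_insert_if)
  then have "{i, j, k} \<noteq> {x, y}" for x y using c by (metis Suc_n_not_le_n eval_nat_numeral(3))
  then show "i \<noteq> j" "i \<noteq> k" "j \<noteq> k" by (metis insert_absorb2 insert_commute)+
qed

abbreviation "S1 \<equiv> seg i"
abbreviation "S2 \<equiv> seg j \<union> seg k"
abbreviation "N \<equiv> {1..m 1 + m 2 + m 3}"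

lemma disj12: "S1 \<inter> S2 = {}"
  using seg_disjoint[OF index(1,2) index_neq(1)] seg_disjoint[OF index(1,3) index_neq(2)] by blast

lemma S12: "S1 \<union> S2 = N"
proof -
  have "S1 \<union> S2 = \<Union> (seg ` {i, j, k})" by auto
  also have "\<dots> = N" unfolding ijk using seg_union by auto
  finally show ?thesis .
qed

definition Q1 :: "(nat \<Rightarrow> nat) \<Rightarrow> nat set set" where "Q1 \<pi> = perm_cycles S1 (\<gamma> \<circ> \<pi>)"
definition Q2 :: "(nat \<Rightarrow> nat) \<Rightarrow> nat set set" where "Q2 \<tau> = perm_cycles S2 (\<gamma> \<circ> \<tau>)"

text \<open>The pairings that come from double unicircuit graphs, by
  \<open>double_unicircuit_NC2_annular\<close>.\<close>

definition annular_ok :: "(nat \<Rightarrow> nat) \<Rightarrow> bool" where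
  "annular_ok \<tau> \<longleftrightarrow> \<tau> \<in> NC2_annular m j k \<and> card (through_strings m j k \<tau>) \<noteq> 2"

lemma NC2_darts:
  assumes "\<pi> \<in> NC2 m i"
  shows "darts S1 \<gamma> \<pi> (Q1 \<pi>)" "darts.simple S1 \<pi> (Q1 \<pi>)"
    "a \<in> S1 \<Longrightarrow> block_of (Q1 \<pi>) a \<noteq> block_of (Q1 \<pi>) (\<pi> a)"
proof -
  interpret cyclic_darts S1 \<gamma> by (rule cyclic_darts_seg[OF index(1)])
  have \<pi>: "pairing S1 \<pi>" "2 * card (Q1 \<pi>) = card S1 + 2"
    using assms NC2_iff[OF index(1)] unfolding Q1_def by blast+
  show d: "darts S1 \<gamma> \<pi> (Q1 \<pi>)" unfolding Q1_def by (rule darts_face_partition[OF \<pi>(1)])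
  note conn = uconnected_pairing_graph[OF d]
  show "darts.simple S1 \<pi> (Q1 \<pi>)" by (rule darts.tree_simple[OF d conn \<pi>(2)])
  show "a \<in> S1 \<Longrightarrow> block_of (Q1 \<pi>) a \<noteq> block_of (Q1 \<pi>) (\<pi> a)" by (rule darts.tree_no_loop[OF d conn \<pi>(2)])
qed

text \<open>The third claim explains the condition on \<open>b\<close> in \<open>glue_data\<close>:
  a pair is a loop exactly if it is the only through string.\<close>

lemma annular_ok_darts:
  assumes "annular_ok \<tau>"
  shows "darts S2 \<gamma> \<tau> (Q2 \<tau>)" "darts.simple S2 \<tau> (Q2 \<tau>)"
    "b \<in> S2 \<Longrightarrow> block_of (Q2 \<tau>) b = block_of (Q2 \<tau>) (\<tau> b) \<longleftrightarrow> through_strings m j k \<tau> = {{b, \<tau> b}}"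
    "\<exists>x \<in> seg j. \<tau> x \<in> seg k"
proof -
  interpret annular S2 "seg j" "seg k" \<gamma> by (rule annular_segs[OF index(2,3) index_neq(3)])
  have ts: "strings \<tau> = through_strings m j k \<tau>" by (simp add: strings_def through_strings_def)
  have \<tau>: "pairing S2 \<tau>" "2 * card (Q2 \<tau>) = card S2" "strings \<tau> \<noteq> {}" "card (strings \<tau>) \<noteq> 2"
    using assms NC2_annular_iff[OF index(2,3) index_neq(3)] unfolding Q2_def annular_ok_def ts by blast+
  show d: "darts S2 \<gamma> \<tau> (Q2 \<tau>)" unfolding Q2_def by (rule darts_face_partition[OF \<tau>(1)])
  interpret annular_darts S2 "seg j" "seg k" \<gamma> \<tau> "Q2 \<tau>"
    using d annular_axioms by (intro annular_darts.intro)
  obtain x where x: "x \<in> seg j" "\<tau> x \<in> seg k" using \<tau>(3) unfolding strings_eq by blast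
  then show "\<exists>x \<in> seg j. \<tau> x \<in> seg k" by blast
  note conn = uconnected_pairing_graph[OF d x]
  show "darts.simple S2 \<tau> (Q2 \<tau>)" by (rule simple_if_not_two_strings[OF conn \<tau>(2-4)])
  assume b: "b \<in> S2"
  show "block_of (Q2 \<tau>) b = block_of (Q2 \<tau>) (\<tau> b) \<longleftrightarrow> through_strings m j k \<tau> = {{b, \<tau> b}}"
    using loop_imp_single_string[OF conn \<tau>(2,3) b] single_string_imp_loop[OF conn \<tau>(2) b] unfolding ts by blast
qed

section \<open>Glued partitions and the data producing them\<close>

text \<open>Heads are glued to heads and tails to tails: the head of \<open>a\<close> is its own
  block, and its tail is the block of \<open>\<pi> a\<close>.\<close>

definition glued :: "(nat \<Rightarrow> nat) \<times> (nat \<Rightarrow> nat) \<times> nat \<times> nat \<Rightarrow> nat set set" where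
  "glued = (\<lambda>(\<tau>, \<pi>, a, b). glue (Q1 \<pi>) (Q2 \<tau>) (block_of (Q1 \<pi>) a) (block_of (Q1 \<pi>) (\<pi> a))
     (block_of (Q2 \<tau>) b) (block_of (Q2 \<tau>) (\<tau> b)))"

text \<open>An element \<open>a\<close> of S1 stands for an edge with an orientation,
  \<open>\<pi> a\<close> being the same edge reversed; likewise \<open>b\<close>. The last condition
  says that \<open>b\<close> is not a loop.\<close>

definition glue_data :: "((nat \<Rightarrow> nat) \<times> (nat \<Rightarrow> nat) \<times> nat \<times> nat) set" where
  "glue_data = {(\<tau>, \<pi>, a, b). annular_ok \<tau> \<and> \<pi> \<in> NC2 m i \<and> a \<in> S1 \<and> b \<in> S2 \<and>
     through_strings m j k \<tau> \<noteq> {{b, \<tau> b}}}"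

definition UC :: "nat set set set" where
  "UC = {P. partition_on N P \<and> double_tree (quotient_cycle_graph m P {i}) \<and>
     double_unicircuit m P j k \<and> joined_along_edge m P i j k}"

lemma glue_dataD:
  assumes "(\<tau>, \<pi>, a, b) \<in> glue_data"
  shows "annular_ok \<tau>" "\<pi> \<in> NC2 m i" "a \<in> S1" "b \<in> S2" "through_strings m j k \<tau> \<noteq> {{b, \<tau> b}}"
  using assms by (simp_all add: glue_data_def)

text \<open>The ends are distinct on both sides: a tree has no loops, and \<open>b\<close> is chosen
  not to be one.\<close>

lemma gluing_glue_data:
  assumes "(\<tau>, \<pi>, a, b) \<in> glue_data"
  shows "gluing S1 S2 (Q1 \<pi>) (Q2 \<tau>) (block_of (Q1 \<pi>) a) (block_of (Q1 \<pi>) (\<pi> a))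
     (block_of (Q2 \<tau>) b) (block_of (Q2 \<tau>) (\<tau> b))"
proof -
  note D = glue_dataD[OF assms]
  interpret d1: darts S1 \<gamma> \<pi> "Q1 \<pi>" by (rule NC2_darts[OF D(2)])
  interpret d2: darts S2 \<gamma> \<tau> "Q2 \<tau>" by (rule annular_ok_darts[OF D(1)])
  show ?thesis
  proof (rule gluing.intro)
    show "block_of (Q1 \<pi>) a \<noteq> block_of (Q1 \<pi>) (\<pi> a)" by (rule NC2_darts(3)[OF D(2,3)])
    show "block_of (Q2 \<tau>) b \<noteq> block_of (Q2 \<tau>) (\<tau> b)" using annular_ok_darts(3)[OF D(1,4)] D(5) by simp
  qed (rule disj12 d1.part d2.part d1.blk_in d2.blk_in d1.\<tau>_S d2.\<tau>_S D)+
qed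

lemma quotient_cycle_graph_all:
  assumes "partition_on N P"
  shows "quotient_cycle_graph m P {i, j, k} = quotient_on N \<gamma> P"
proof -
  have "(\<Union>j \<in> {i, j, k}. seg j) = N" using S12 by auto
  then show ?thesis
    unfolding quotient_cycle_graph_def cycle_graph_def quotient_on_def by (simp only: restrict_partition_self[OF assms])
qed

lemma joined_iff:
  assumes "partition_on N P"
  shows "joined_along_edge m P i j k \<longleftrightarrow> (\<exists>a \<in> S1. \<exists>b \<in> S2.
     {block_of P (\<gamma> a), block_of P a} = {block_of P (\<gamma> b), block_of P b} \<and>
     {B \<in> P. B \<inter> S1 \<noteq> {} \<and> B \<inter> S2 \<noteq> {}} = {block_of P (\<gamma> a), block_of P a})"
  unfolding joined_along_edge_def Let_def quotient_cycle_graph_all[OF assms] equivalent_edges_def quotient_on_simps ..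

lemma glued_in_UC:
  assumes "(\<tau>, \<pi>, a, b) \<in> glue_data"
  shows "glued (\<tau>, \<pi>, a, b) \<in> UC"
proof -
  note D = glue_dataD[OF assms]
  interpret d1: darts S1 \<gamma> \<pi> "Q1 \<pi>" by (rule NC2_darts[OF D(2)])
  interpret d2: darts S2 \<gamma> \<tau> "Q2 \<tau>" by (rule annular_ok_darts[OF D(1)])
  interpret gluing S1 S2 "Q1 \<pi>" "Q2 \<tau>" "d1.blk a" "d1.blk (\<pi> a)" "d2.blk b" "d2.blk (\<tau> b)"
    by (rule gluing_glue_data[OF assms])
  define P where "P = glued (\<tau>, \<pi>, a, b)"
  have P: "P = glue (Q1 \<pi>) (Q2 \<tau>) (d1.blk a) (d1.blk (\<pi> a)) (d2.blk b) (d2.blk (\<tau> b))"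
    by (simp add: P_def glued_def)
  have part: "partition_on N P" unfolding P S12[symmetric] by (rule partition_on_glue)
  have r1: "restrict_partition P S1 = Q1 \<pi>" unfolding P by (rule restrict_glue1)
  have r2: "restrict_partition P S2 = Q2 \<tau>" unfolding P by (rule restrict_glue2)
  have "double_tree (quotient_cycle_graph m P {i})"
    using double_tree_NC2[OF index(1), of P] d1.part D(2) unfolding r1 Q1_def by blast
  moreover have "double_unicircuit m P j k"
    using double_unicircuit_NC2_annular[OF index(2,3) index_neq(3), of P] d2.part D(1)
    unfolding r2 Q2_def annular_ok_def by blast
  \<comment> \<open>\<open>a\<close> and \<open>b\<close> become equivalent because their heads are
    merged, and so are their tails.\<close>
  moreover have "joined_along_edge m P i j k"
    unfolding joined_iff[OF part]
  proof (intro bexI[OF _ D(3)] bexI[OF _ D(4)] conjI)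
    have in1: "d1.blk a \<union> d2.blk b \<in> P" and in2: "d1.blk (\<pi> a) \<union> d2.blk (\<tau> b) \<in> P"
      unfolding P glue_def by blast+
    have "a \<in> d1.blk a" "b \<in> d2.blk b" using d1.blk_self D(3) d2.blk_self D(4) by blast+
    then have b1: "block_of P a = d1.blk a \<union> d2.blk b" "block_of P b = d1.blk a \<union> d2.blk b"
      by (intro block_of_eq[OF part in1]; simp)+
    have "\<gamma> a \<in> d1.blk (\<gamma> a)" "\<gamma> b \<in> d2.blk (\<gamma> b)"
      using d1.blk_self[of "\<gamma> a"] d2.blk_self[of "\<gamma> b"] d1.\<gamma>_S d2.\<gamma>_S D(3,4) by blast+
    then have "\<gamma> a \<in> d1.blk (\<pi> a)" "\<gamma> b \<in> d2.blk (\<tau> b)" using d1.block_\<gamma>[OF D(3)] d2.block_\<gamma>[OF D(4)] by simp_all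
    then have b2: "block_of P (\<gamma> a) = d1.blk (\<pi> a) \<union> d2.blk (\<tau> b)" "block_of P (\<gamma> b) = d1.blk (\<pi> a) \<union> d2.blk (\<tau> b)"
      by (intro block_of_eq[OF part in2]; simp)+
    show "{block_of P (\<gamma> a), block_of P a} = {block_of P (\<gamma> b), block_of P b}" unfolding b1 b2 ..
    show "{B \<in> P. B \<inter> S1 \<noteq> {} \<and> B \<inter> S2 \<noteq> {}} = {block_of P (\<gamma> a), block_of P a}"
      unfolding b1 b2 using common_glue unfolding P[symmetric] by (simp add: insert_commute)
  qed
  ultimately show ?thesis using part unfolding UC_def P_def by blast
qed

lemma UC_restrict:
  assumes "P \<in> UC"
  obtains \<tau> \<pi> where "annular_ok \<tau>" "\<pi> \<in> NC2 m i" "restrict_partition P S1 = Q1 \<pi>" "restrict_partition P S2 = Q2 \<tau>"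
proof -
  have P: "partition_on N P" "double_tree (quotient_cycle_graph m P {i})" "double_unicircuit m P j k"
    using assms by (simp_all add: UC_def)
  have sub: "S1 \<subseteq> N" "S2 \<subseteq> N" unfolding S12[symmetric] by blast+
  obtain \<pi> where "\<pi> \<in> NC2 m i" "restrict_partition P S1 = Q1 \<pi>"
    using double_tree_NC2[OF index(1) partition_on_restrict_partition[OF P(1) sub(1)]] P(2) unfolding Q1_def by blast
  moreover obtain \<tau> where "annular_ok \<tau>" "restrict_partition P S2 = Q2 \<tau>"
    using double_unicircuit_NC2_annular[OF index(2,3) index_neq(3) partition_on_restrict_partition[OF P(1) sub(2)]] P(3)
    unfolding Q2_def annular_ok_def by blast
  ultimately show ?thesis using that by blast
qed

text \<open>The joining edges supply \<open>a\<close> and \<open>b\<close>, with equal or with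
  opposite orientations; in the latter case \<open>\<tau> b\<close> takes the place of
  \<open>b\<close>.\<close>

lemma UC_glued:
  assumes "P \<in> UC"
  shows "P \<in> glued ` glue_data"
proof -
  obtain \<tau> \<pi> where ok: "annular_ok \<tau>" "\<pi> \<in> NC2 m i"
    and r: "restrict_partition P S1 = Q1 \<pi>" "restrict_partition P S2 = Q2 \<tau>"
    using UC_restrict[OF assms] .
  have part: "partition_on N P" and joined: "joined_along_edge m P i j k"
    using assms by (simp_all add: UC_def)
  have sub: "S1 \<subseteq> N" "S2 \<subseteq> N" unfolding S12[symmetric] by blast+
  interpret d1: darts S1 \<gamma> \<pi> "Q1 \<pi>" by (rule NC2_darts[OF ok(2)])
  interpret d2: darts S2 \<gamma> \<tau> "Q2 \<tau>" by (rule annular_ok_darts[OF ok(1)])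
  note blk1 = block_of_restrict_partition[OF part sub(1), unfolded r]
  note blk2 = block_of_restrict_partition[OF part sub(2), unfolded r]
  obtain a b where ab: "a \<in> S1" "b \<in> S2" "{block_of P (\<gamma> a), block_of P a} = {block_of P (\<gamma> b), block_of P b}"
    and common: "{B \<in> P. B \<inter> S1 \<noteq> {} \<and> B \<inter> S2 \<noteq> {}} = {block_of P (\<gamma> a), block_of P a}"
    using joined unfolding joined_iff[OF part] by (elim bexE conjE) (rule that)
  have \<gamma>ab: "\<gamma> a \<in> S1" "\<gamma> b \<in> S2" using d1.\<gamma>_S d2.\<gamma>_S ab(1,2) by blast+
  have t1: "block_of P a \<inter> S1 = d1.blk a" "block_of P (\<gamma> a) \<inter> S1 = d1.blk (\<pi> a)"
    using blk1[OF ab(1)] blk1[OF \<gamma>ab(1)] d1.block_\<gamma>[OF ab(1)] by simp_all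
  have t2: "block_of P b \<inter> S2 = d2.blk b" "block_of P (\<gamma> b) \<inter> S2 = d2.blk (\<tau> b)"
    using blk2[OF ab(2)] blk2[OF \<gamma>ab(2)] d2.block_\<gamma>[OF ab(2)] by simp_all
  \<comment> \<open>The traces on S1 are the ends of a tree edge, which is no loop. As
    \<open>b\<close> is equivalent to \<open>a\<close>, it cannot be a loop either.\<close>
  have ne: "block_of P a \<noteq> block_of P (\<gamma> a)" using NC2_darts(3)[OF ok(2) ab(1)] t1 by metis
  have "P = glue (restrict_partition P S1) (restrict_partition P S2) (block_of P a \<inter> S1) (block_of P (\<gamma> a) \<inter> S1)
      (block_of P a \<inter> S2) (block_of P (\<gamma> a) \<inter> S2)"
    by (rule glue_restrict[OF part[folded S12] disj12 ne]) (simp add: common insert_commute)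
  then have P_eq: "P = glue (Q1 \<pi>) (Q2 \<tau>) (d1.blk a) (d1.blk (\<pi> a)) (block_of P a \<inter> S2) (block_of P (\<gamma> a) \<inter> S2)"
    unfolding r t1 .
  have blocks: "block_of P b \<noteq> block_of P (\<gamma> b)" using ab(3) ne by (auto simp: doubleton_eq_iff)
  then have "d2.blk b \<noteq> d2.blk (\<tau> b)"
    using block_of_restrict_eq_iff[OF part sub(2) ab(2) \<gamma>ab(2), unfolded r] d2.block_\<gamma>[OF ab(2)] by simp
  then have nl: "through_strings m j k \<tau> \<noteq> {{b, \<tau> b}}" using annular_ok_darts(3)[OF ok(1) ab(2)] by simp
  have "\<exists>c \<in> S2. through_strings m j k \<tau> \<noteq> {{c, \<tau> c}} \<and> d2.blk c = block_of P a \<inter> S2 \<and> d2.blk (\<tau> c) = block_of P (\<gamma> a) \<inter> S2"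
  proof (cases "block_of P b = block_of P a")
    case True
    then have "block_of P (\<gamma> b) = block_of P (\<gamma> a)" using ab(3) by (auto simp: doubleton_eq_iff)
    then show ?thesis using ab(2) nl t2 True by (intro bexI[of _ b]) simp_all
  next
    case False
    then have "block_of P b = block_of P (\<gamma> a)" "block_of P (\<gamma> b) = block_of P a"
      using ab(3) by (auto simp: doubleton_eq_iff)
    then show ?thesis using d2.\<tau>_S[OF ab(2)] nl t2 d2.\<tau>_\<tau> by (intro bexI[of _ "\<tau> b"]) (simp_all add: insert_commute)
  qed
  then obtain c where c: "c \<in> S2" "through_strings m j k \<tau> \<noteq> {{c, \<tau> c}}"
    "d2.blk c = block_of P a \<inter> S2" "d2.blk (\<tau> c) = block_of P (\<gamma> a) \<inter> S2" by blast
  have "glued (\<tau>, \<pi>, a, c) = P" unfolding glued_def prod.case c(3,4) by (rule P_eq[symmetric])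
  moreover have "(\<tau>, \<pi>, a, c) \<in> glue_data" using ok ab(1) c(1,2) by (simp add: glue_data_def)
  ultimately show ?thesis by (metis imageI)
qed

lemma glued_image: "glued ` glue_data = UC"
proof
  show "glued ` glue_data \<subseteq> UC"
  proof
    fix P assume "P \<in> glued ` glue_data"
    then obtain d where d: "d \<in> glue_data" "P = glued d" by blast
    obtain \<tau> \<pi> a b where "d = (\<tau>, \<pi>, a, b)" by (metis prod_cases4)
    then show "P \<in> UC" using glued_in_UC d by simp
  qed
qed (use UC_glued in blast)

text \<open>Restriction to S1 and S2 gives back both quotients, hence both pairings by
  \<open>simple_unique\<close>; \<open>glue_eq_iff\<close> leaves only the reversal of both edges at
  once.\<close>

lemma glued_fibre:
  assumes d: "(\<tau>, \<pi>, a, b) \<in> glue_data"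
  shows "{d \<in> glue_data. glued d = glued (\<tau>, \<pi>, a, b)} = {(\<tau>, \<pi>, a, b), (\<tau>, \<pi>, \<pi> a, \<tau> b)}"
proof -
  note D = glue_dataD[OF d]
  interpret d1: darts S1 \<gamma> \<pi> "Q1 \<pi>" by (rule NC2_darts[OF D(2)])
  interpret d2: darts S2 \<gamma> \<tau> "Q2 \<tau>" by (rule annular_ok_darts[OF D(1)])
  interpret gluing S1 S2 "Q1 \<pi>" "Q2 \<tau>" "d1.blk a" "d1.blk (\<pi> a)" "d2.blk b" "d2.blk (\<tau> b)"
    by (rule gluing_glue_data[OF d])
  show ?thesis
  proof (intro set_eqI iffI)
    fix x assume x: "x \<in> {d \<in> glue_data. glued d = glued (\<tau>, \<pi>, a, b)}"
    obtain \<tau>' \<pi>' a' b' where x_eq: "x = (\<tau>', \<pi>', a', b')" by (metis prod_cases4)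
    have d': "(\<tau>', \<pi>', a', b') \<in> glue_data" and eq: "glued (\<tau>', \<pi>', a', b') = glued (\<tau>, \<pi>, a, b)"
      using x unfolding x_eq by simp_all
    note D' = glue_dataD[OF d']
    interpret g': gluing S1 S2 "Q1 \<pi>'" "Q2 \<tau>'" "block_of (Q1 \<pi>') a'" "block_of (Q1 \<pi>') (\<pi>' a')"
      "block_of (Q2 \<tau>') b'" "block_of (Q2 \<tau>') (\<tau>' b')"
      by (rule gluing_glue_data[OF d'])
    have Q: "Q1 \<pi>' = Q1 \<pi>" "Q2 \<tau>' = Q2 \<tau>"
      using restrict_glue1 restrict_glue2 g'.restrict_glue1 g'.restrict_glue2 eq unfolding glued_def prod.case by metis+
    have \<pi>': "\<pi>' = \<pi>"
      using d1.simple_unique NC2_darts(1,2)[OF D'(2)] NC2_darts(2)[OF D(2)] unfolding Q by blast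
    have \<tau>': "\<tau>' = \<tau>"
      using d2.simple_unique annular_ok_darts(1,2)[OF D'(1)] annular_ok_darts(2)[OF D(1)] unfolding Q by blast
    have "d1.blk a' = d1.blk a \<and> d1.blk (\<pi> a') = d1.blk (\<pi> a) \<and> d2.blk b' = d2.blk b \<and> d2.blk (\<tau> b') = d2.blk (\<tau> b) \<or>
        d1.blk a' = d1.blk (\<pi> a) \<and> d1.blk (\<pi> a') = d1.blk a \<and> d2.blk b' = d2.blk (\<tau> b) \<and> d2.blk (\<tau> b') = d2.blk b"
      using glue_eq_iff[OF g'.gluing_axioms[unfolded \<pi>' \<tau>']] eq unfolding glued_def prod.case \<pi>' \<tau>' by simp
    \<comment> \<open>Simplicity determines \<open>a'\<close> and \<open>b'\<close> up to reversal;
      the order of the distinct ends then decides about the reversal.\<close>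
    then have "a' = a \<and> b' = b \<or> a' = \<pi> a \<and> b' = \<tau> b"
    proof
      assume e: "d1.blk a' = d1.blk a \<and> d1.blk (\<pi> a') = d1.blk (\<pi> a) \<and> d2.blk b' = d2.blk b \<and> d2.blk (\<tau> b') = d2.blk (\<tau> b)"
      have "a' = a \<or> a' = \<pi> a" using d1.simpleD[OF NC2_darts(2)[OF D(2)] D(3) D'(3)] e by simp
      moreover have "b' = b \<or> b' = \<tau> b" using d2.simpleD[OF annular_ok_darts(2)[OF D(1)] D(4) D'(4)] e by simp
      moreover have "a' \<noteq> \<pi> a" "b' \<noteq> \<tau> b" using e u(3) v(3) by auto
      ultimately show ?thesis by blast
    next
      assume e: "d1.blk a' = d1.blk (\<pi> a) \<and> d1.blk (\<pi> a') = d1.blk a \<and> d2.blk b' = d2.blk (\<tau> b) \<and> d2.blk (\<tau> b') = d2.blk b"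
      have "a' = a \<or> a' = \<pi> a" using d1.simpleD[OF NC2_darts(2)[OF D(2)] D(3) D'(3)] e by (simp add: insert_commute)
      moreover have "b' = b \<or> b' = \<tau> b" using d2.simpleD[OF annular_ok_darts(2)[OF D(1)] D(4) D'(4)] e by (simp add: insert_commute)
      moreover have "a' \<noteq> a" "b' \<noteq> b" using e u(3) v(3) by auto
      ultimately show ?thesis by blast
    qed
    then show "x \<in> {(\<tau>, \<pi>, a, b), (\<tau>, \<pi>, \<pi> a, \<tau> b)}" unfolding x_eq \<pi>' \<tau>' by auto
  next
    fix x assume x: "x \<in> {(\<tau>, \<pi>, a, b), (\<tau>, \<pi>, \<pi> a, \<tau> b)}"
    have "(\<tau>, \<pi>, \<pi> a, \<tau> b) \<in> glue_data"
      using D d1.\<tau>_S d2.\<tau>_S d2.\<tau>_\<tau> by (simp add: glue_data_def insert_commute)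
    moreover have "glued (\<tau>, \<pi>, \<pi> a, \<tau> b) = glued (\<tau>, \<pi>, a, b)"
      unfolding glued_def prod.case d1.\<tau>_\<tau> d2.\<tau>_\<tau> by (rule glue_swap)
    ultimately show "x \<in> {d \<in> glue_data. glued d = glued (\<tau>, \<pi>, a, b)}" using x d by auto
  qed
qed

lemma finite_glue_data: "finite glue_data"
proof (rule finite_subset)
  show "glue_data \<subseteq> {\<tau>. \<tau> permutes S2} \<times> {\<pi>. \<pi> permutes S1} \<times> S1 \<times> S2"
  proof
    fix d assume d: "d \<in> glue_data"
    obtain \<tau> \<pi> a b where d_eq: "d = (\<tau>, \<pi>, a, b)" by (metis prod_cases4)
    note D = glue_dataD[OF d[unfolded d_eq]]
    have "\<pi> permutes S1" "\<tau> permutes S2"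
      using darts.\<tau>_perm[OF NC2_darts(1)[OF D(2)]] darts.\<tau>_perm[OF annular_ok_darts(1)[OF D(1)]] .
    then show "d \<in> {\<tau>. \<tau> permutes S2} \<times> {\<pi>. \<pi> permutes S1} \<times> S1 \<times> S2" using D(3,4) by (simp add: d_eq)
  qed
  show "finite ({\<tau>. \<tau> permutes S2} \<times> {\<pi>. \<pi> permutes S1} \<times> S1 \<times> S2)"
    using finite_seg by (intro finite_cartesian_product finite_permutations finite_UnI)
qed

lemma card_glue_data_UC: "card glue_data = 2 * card UC"
  unfolding glued_image[symmetric]
proof (rule card_eq_card_fibre_mult[OF finite_glue_data])
  fix d assume d: "d \<in> glue_data"
  obtain \<tau> \<pi> a b where d_eq: "d = (\<tau>, \<pi>, a, b)" by (metis prod_cases4)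
  note D = glue_dataD[OF d[unfolded d_eq]]
  have "\<pi> a \<noteq> a" using darts.\<tau>_neq[OF NC2_darts(1)[OF D(2)] D(3)] .
  then show "card {d' \<in> glue_data. glued d' = glued d} = 2"
    unfolding d_eq glued_fibre[OF d[unfolded d_eq]] by simp
qed

end


section \<open>Partitioned permutations\<close>

text \<open>Every other block of V is a block of P disjoint from the exceptional one, and these have
  to cover the rest. So V is determined by its exceptional block.\<close>

lemma partition_on_eqI:
  assumes V: "partition_on N V" and P: "partition_on N P"
    and X: "X \<in> V" "X = C1 \<union> C2" "C1 \<in> P" "C2 \<in> P" and rest: "\<forall>B \<in> V - {X}. B \<in> P"
  shows "V = (P - {C1, C2}) \<union> {X}"
proof
  have ne: "C \<noteq> {}" if "C \<in> P" for C using partition_onD3[OF P] that by blast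
  have dP: "B = C" if "B \<in> P" "C \<in> P" "x \<in> B" "x \<in> C" for B C x
    using disjointD[OF partition_onD2[OF P] that(1,2)] that(3,4) by blast
  show "V \<subseteq> (P - {C1, C2}) \<union> {X}"
  proof
    fix B assume B: "B \<in> V"
    show "B \<in> (P - {C1, C2}) \<union> {X}"
    proof (cases "B = X")
      case False
      then have "B \<inter> X = {}" using disjointD[OF partition_onD2[OF V] B X(1)] by blast
      then have "B \<noteq> C1" "B \<noteq> C2" using ne[OF X(3)] ne[OF X(4)] X(2) by blast+
      then show ?thesis using rest B False by blast
    qed blast
  qed
  show "(P - {C1, C2}) \<union> {X} \<subseteq> V"
  proof
    fix B assume "B \<in> (P - {C1, C2}) \<union> {X}"
    then consider "B = X" | "B \<in> P" "B \<noteq> C1" "B \<noteq> C2" by blast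
    then show "B \<in> V"
    proof cases
      case 2
      then obtain x where x: "x \<in> B" using ne by blast
      then have "x \<in> N" using 2(1) partition_onD1[OF P] by blast
      then obtain B' where B': "B' \<in> V" "x \<in> B'" using partition_onD1[OF V] by blast
      \<comment> \<open>A block of V through x other than X is a block of P through x, so it is
        B.\<close>
      have "B' \<noteq> X" using dP[OF 2(1) X(3) x] dP[OF 2(1) X(4) x] 2(2,3) B'(2) X(2) by blast
      then have "B' \<in> P" using rest B'(1) by blast
      then have "B = B'" using dP[OF 2(1) _ x B'(2)] by blast
      then show ?thesis using B'(1) by simp
    qed (simp add: X(1))
  qed
qed

lemma partition_on_merge:
  assumes P: "partition_on N P" and C: "C1 \<in> P" "C2 \<in> P"
  shows "partition_on N ((P - {C1, C2}) \<union> {C1 \<union> C2})"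
proof (rule partition_onI)
  have "\<Union> ((P - {C1, C2}) \<union> {C1 \<union> C2}) = \<Union> P" using C by auto
  then show "\<Union> ((P - {C1, C2}) \<union> {C1 \<union> C2}) = N" using partition_onD1[OF P] by simp
  show "{} \<notin> (P - {C1, C2}) \<union> {C1 \<union> C2}" using partition_onD3[OF P] C by auto
  have d: "B \<inter> D = {}" if "B \<in> P" "D \<in> P" "B \<noteq> D" for B D
    using disjointD[OF partition_onD2[OF P] that] .
  fix B D assume "B \<in> (P - {C1, C2}) \<union> {C1 \<union> C2}" "D \<in> (P - {C1, C2}) \<union> {C1 \<union> C2}" and ne: "B \<noteq> D"
  then consider "B \<in> P" "D \<in> P" | "B = C1 \<union> C2" "D \<in> P" "D \<noteq> C1" "D \<noteq> C2" | "D = C1 \<union> C2" "B \<in> P" "B \<noteq> C1" "B \<noteq> C2"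
    by blast
  then show "disjnt B D"
  proof cases
    case 1
    then show ?thesis using d ne by (simp add: disjnt_def)
  next
    case 2
    then show ?thesis using d[OF C(1) 2(2)] d[OF C(2) 2(2)] by (auto simp: disjnt_def)
  next
    case 3
    then show ?thesis using d[OF 3(2) C(1)] d[OF 3(2) C(2)] by (auto simp: disjnt_def)
  qed
qed

lemma through_strings_commute: "through_strings m j k \<tau> = through_strings m k j \<tau>"
  unfolding through_strings_def by (simp only: Un_commute conj_commute)

section \<open>Merging a cycle of each pairing\<close>

context index_triple
begin

lemma NC2_pairing: "\<pi> \<in> NC2 m i \<Longrightarrow> pairing S1 \<pi>"
  using NC2_iff[OF index(1)] by blast

lemma NC2_annular_pairing: "\<tau> \<in> NC2_annular m j k \<Longrightarrow> pairing S2 \<tau>"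
  using NC2_annular_iff[OF index(2,3) index_neq(3)] by blast

lemma comp_apply1:
  assumes "pairing S2 \<tau>" "pairing S1 \<pi>" "x \<in> S1"
  shows "(\<tau> \<circ> \<pi>) x = \<pi> x"
proof -
  have "\<pi> x \<notin> S2" using pairingD(2)[OF assms(2,3)] disj12 by blast
  then show ?thesis using permutes_not_in[OF pairingD(1)[OF assms(1)]] by simp
qed

lemma comp_apply2:
  assumes "pairing S2 \<tau>" "pairing S1 \<pi>" "x \<in> S2"
  shows "(\<tau> \<circ> \<pi>) x = \<tau> x"
proof -
  have "x \<notin> S1" using assms(3) disj12 by blast
  then show ?thesis using permutes_not_in[OF pairingD(1)[OF assms(2)]] by simp
qed

lemma pairing_comp:
  assumes "pairing S2 \<tau>" "pairing S1 \<pi>"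
  shows "pairing N (\<tau> \<circ> \<pi>)"
  unfolding pairing_def
proof (intro conjI ballI)
  show "(\<tau> \<circ> \<pi>) permutes N"
    using pairingD(1)[OF assms(1)] pairingD(1)[OF assms(2)] S12
    by (intro permutes_compose) (auto intro: permutes_subset)
  fix x assume "x \<in> N"
  then consider "x \<in> S1" | "x \<in> S2" using S12 by blast
  then have "(\<tau> \<circ> \<pi>) x \<noteq> x \<and> (\<tau> \<circ> \<pi>) ((\<tau> \<circ> \<pi>) x) = x"
  proof cases
    case 1
    then show ?thesis
      using comp_apply1[OF assms 1] comp_apply1[OF assms pairingD(2)[OF assms(2) 1]] pairingD(3,4)[OF assms(2)] by simp
  next
    case 2
    then show ?thesis
      using comp_apply2[OF assms 2] comp_apply2[OF assms pairingD(2)[OF assms(1) 2]] pairingD(3,4)[OF assms(1)] by simp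
  qed
  then show "(\<tau> \<circ> \<pi>) x \<noteq> x" "(\<tau> \<circ> \<pi>) ((\<tau> \<circ> \<pi>) x) = x" by simp_all
qed

lemma cycles_comp:
  assumes "pairing S2 \<tau>" "pairing S1 \<pi>"
  shows "partition_on N (perm_cycles N (\<tau> \<circ> \<pi>))" "perm_cycles S2 \<tau> \<subseteq> perm_cycles N (\<tau> \<circ> \<pi>)"
    "perm_cycles S1 \<pi> \<subseteq> perm_cycles N (\<tau> \<circ> \<pi>)"
proof -
  note p = pairing_comp[OF assms]
  have "permutation (\<tau> \<circ> \<pi>)" using pairingD(1)[OF p] permutation_permutes by blast
  moreover have "(\<tau> \<circ> \<pi>) ` N \<subseteq> N" using pairingD(2)[OF p] by blast
  ultimately show "partition_on N (perm_cycles N (\<tau> \<circ> \<pi>))" by (rule partition_on_perm_cycles)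
  have sub: "S1 \<subseteq> N" "S2 \<subseteq> N" unfolding S12[symmetric] by blast+
  have "perm_cycles S2 \<tau> = (\<lambda>x. {x, (\<tau> \<circ> \<pi>) x}) ` S2"
    unfolding perm_cycles_pairing[OF assms(1)] by (rule image_cong) (simp_all only: comp_apply2[OF assms])
  then show "perm_cycles S2 \<tau> \<subseteq> perm_cycles N (\<tau> \<circ> \<pi>)"
    unfolding perm_cycles_pairing[OF p] using image_mono[OF sub(2)] by simp
  have "perm_cycles S1 \<pi> = (\<lambda>x. {x, (\<tau> \<circ> \<pi>) x}) ` S1"
    unfolding perm_cycles_pairing[OF assms(2)] by (rule image_cong) (simp_all only: comp_apply1[OF assms])
  then show "perm_cycles S1 \<pi> \<subseteq> perm_cycles N (\<tau> \<circ> \<pi>)"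
    unfolding perm_cycles_pairing[OF p] using image_mono[OF sub(1)] by simp
qed

definition merged :: "(nat \<Rightarrow> nat) \<Rightarrow> nat set \<Rightarrow> nat set \<Rightarrow> nat set set" where
  "merged p C1 C2 = (perm_cycles N p - {C1, C2}) \<union> {C1 \<union> C2}"

lemma ps11_iff:
  "ps11 m j k i \<tau> \<pi> C1 C2 V p \<longleftrightarrow> \<tau> \<in> NC2_annular m j k \<and> \<pi> \<in> NC2 m i \<and> p = \<tau> \<circ> \<pi> \<and>
     C1 \<in> perm_cycles S2 \<tau> \<and> C2 \<in> perm_cycles S1 \<pi> \<and> V = merged p C1 C2"
proof (cases "\<tau> \<in> NC2_annular m j k \<and> \<pi> \<in> NC2 m i \<and> p = \<tau> \<circ> \<pi> \<and> C1 \<in> perm_cycles S2 \<tau> \<and> C2 \<in> perm_cycles S1 \<pi>")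
  case True
  then have pp: "pairing S2 \<tau>" "pairing S1 \<pi>" using NC2_pairing NC2_annular_pairing by blast+
  note c = cycles_comp[OF pp]
  have C: "C1 \<in> perm_cycles N p" "C2 \<in> perm_cycles N p" "partition_on N (perm_cycles N p)"
    using True c by blast+
  have "partition_on N V \<and> C1 \<union> C2 \<in> V \<and> (\<forall>B \<in> V - {C1 \<union> C2}. B \<in> perm_cycles N p) \<longleftrightarrow> V = merged p C1 C2"
  proof
    assume "partition_on N V \<and> C1 \<union> C2 \<in> V \<and> (\<forall>B \<in> V - {C1 \<union> C2}. B \<in> perm_cycles N p)"
    then show "V = merged p C1 C2"
      unfolding merged_def using partition_on_eqI[OF _ C(3) _ refl C(1,2)] by blast
  next
    assume V: "V = merged p C1 C2"
    show "partition_on N V \<and> C1 \<union> C2 \<in> V \<and> (\<forall>B \<in> V - {C1 \<union> C2}. B \<in> perm_cycles N p)"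
      unfolding V merged_def using partition_on_merge[OF C(3,1,2)] by blast
  qed
  moreover have "{j, k, i} = {1, 2, 3}" using ijk by (simp only: insert_commute)
  ultimately show ?thesis using True unfolding ps11_def by blast
next
  case False
  then show ?thesis unfolding ps11_def by blast
qed

text \<open>All blocks are pairs except the exceptional one, which is recognised by its four
  elements.\<close>

lemma ps11_cycles:
  assumes "ps11 m j k i \<tau> \<pi> C1 C2 V p"
  shows "C1 \<subseteq> S2" "C2 \<subseteq> S1" "card (C1 \<union> C2) = 4" "C1 \<union> C2 \<in> V" "B \<in> V \<Longrightarrow> card B = 4 \<Longrightarrow> B = C1 \<union> C2"
    "pairing S2 \<tau>" "pairing S1 \<pi>" "p = \<tau> \<circ> \<pi>" "pairing N p"
proof -
  note ps = assms[unfolded ps11_iff]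
  show pp: "pairing S2 \<tau>" "pairing S1 \<pi>" using ps NC2_pairing NC2_annular_pairing by blast+
  show p: "p = \<tau> \<circ> \<pi>" using ps by blast
  show pN: "pairing N p" unfolding p by (rule pairing_comp[OF pp])
  obtain x where x: "x \<in> S2" "C1 = {x, \<tau> x}" using ps unfolding perm_cycles_pairing[OF pp(1)] by blast
  obtain y where y: "y \<in> S1" "C2 = {y, \<pi> y}" using ps unfolding perm_cycles_pairing[OF pp(2)] by blast
  show C1: "C1 \<subseteq> S2" using x pairingD(2)[OF pp(1) x(1)] by blast
  show C2: "C2 \<subseteq> S1" using y pairingD(2)[OF pp(2) y(1)] by blast
  have "card C1 = 2" "card C2 = 2" using x y pairingD(3)[OF pp(1) x(1)] pairingD(3)[OF pp(2) y(1)] by (simp_all add: card_insert_if)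
  moreover have "C1 \<inter> C2 = {}" using C1 C2 disj12 by blast
  ultimately show "card (C1 \<union> C2) = 4" using x(2) y(2) by (subst card_Un_disjoint) simp_all
  show "C1 \<union> C2 \<in> V" using ps unfolding merged_def by blast
  assume B: "B \<in> V" "card B = 4"
  have "card B = 2" if "B \<in> perm_cycles N p"
    using pairing_iff_card_cycles[of N p] pN that by blast
  then show "B = C1 \<union> C2" using B ps unfolding merged_def by auto
qed

text \<open>Unlike \<open>glued\<close>, this depends on \<open>a\<close> and \<open>b\<close> only
  through their pairs.\<close>

definition merge :: "(nat \<Rightarrow> nat) \<times> (nat \<Rightarrow> nat) \<times> nat \<times> nat \<Rightarrow> nat set set \<times> (nat \<Rightarrow> nat)" where
  "merge = (\<lambda>(\<tau>, \<pi>, a, b). (merged (\<tau> \<circ> \<pi>) {b, \<tau> b} {a, \<pi> a}, \<tau> \<circ> \<pi>))"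

text \<open>The last condition excludes exactly the case of one through string that is itself part
  of the exceptional block.\<close>

definition PS :: "(nat set set \<times> (nat \<Rightarrow> nat)) set" where
  "PS = {(V, p). \<exists>\<tau> \<pi> C1 C2. ps11 m j k i \<tau> \<pi> C1 C2 V p \<and>
     card (through_strings m j k \<tau>) \<noteq> 2 \<and> through_strings m j k \<tau> \<noteq> {C1}}"

lemma ps11_merge:
  assumes "(\<tau>, \<pi>, a, b) \<in> glue_data"
  shows "ps11 m j k i \<tau> \<pi> {b, \<tau> b} {a, \<pi> a} (fst (merge (\<tau>, \<pi>, a, b))) (snd (merge (\<tau>, \<pi>, a, b)))"
proof -
  note D = glue_dataD[OF assms]
  have "\<tau> \<in> NC2_annular m j k" using D(1) by (simp add: annular_ok_def)
  then show ?thesis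
    using D(2-4) perm_cycles_pairing[OF NC2_pairing[OF D(2)]] perm_cycles_pairing[OF NC2_annular_pairing]
    unfolding ps11_iff merge_def by simp
qed

lemma merge_image: "merge ` glue_data = PS"
proof (intro set_eqI iffI)
  fix Vp assume "Vp \<in> merge ` glue_data"
  then obtain d where d: "d \<in> glue_data" "Vp = merge d" by blast
  obtain \<tau> \<pi> a b where d_eq: "d = (\<tau>, \<pi>, a, b)" by (metis prod_cases4)
  note D = glue_dataD[OF d(1)[unfolded d_eq]]
  show "Vp \<in> PS" unfolding d(2) d_eq PS_def mem_Collect_eq case_prod_unfold
    using ps11_merge[OF d(1)[unfolded d_eq]] D(1,5) unfolding annular_ok_def by blast
next
  fix Vp assume "Vp \<in> PS"
  then obtain V p \<tau> \<pi> C1 C2 where Vp: "Vp = (V, p)" "ps11 m j k i \<tau> \<pi> C1 C2 V p"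
    "card (through_strings m j k \<tau>) \<noteq> 2" "through_strings m j k \<tau> \<noteq> {C1}"
    unfolding PS_def by blast
  note ps = Vp(2)[unfolded ps11_iff]
  note pp = ps11_cycles(6,7)[OF Vp(2)]
  obtain b where b: "b \<in> S2" "C1 = {b, \<tau> b}" using ps unfolding perm_cycles_pairing[OF pp(1)] by blast
  obtain a where a: "a \<in> S1" "C2 = {a, \<pi> a}" using ps unfolding perm_cycles_pairing[OF pp(2)] by blast
  have "(\<tau>, \<pi>, a, b) \<in> glue_data"
    using ps Vp(3,4) a(1) b unfolding glue_data_def annular_ok_def by simp
  moreover have "merge (\<tau>, \<pi>, a, b) = Vp" using ps unfolding merge_def Vp(1) a(2) b(2) by simp
  ultimately show "Vp \<in> merge ` glue_data" by (metis imageI)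
qed

end

text \<open>The index \<open>i\<close> is the only one whose segment is mapped to itself by p,
  because a through string of \<tau> links the other two. The pairings are restrictions of p, and
  C1, C2 are the parts of the block with four elements. The other two indices may still be
  exchanged.\<close>

lemma (in three_cycles) ps11_unique:
  assumes t: "index_triple m i j k" "index_triple m i' j' k'"
    and ps: "ps11 m j k i \<tau> \<pi> C1 C2 V p" "ps11 m j' k' i' \<tau>' \<pi>' C1' C2' V p"
  shows "i' = i" "\<tau>' = \<tau>" "\<pi>' = \<pi>" "C1' = C1" "C2' = C2"
proof -
  interpret t: index_triple m i j k by (rule t)
  interpret t': index_triple m i' j' k' by (rule t)
  note c = t.ps11_cycles[OF ps(1)] and c' = t'.ps11_cycles[OF ps(2)]
  have p1: "p x = \<pi> x" if "x \<in> t.S1" for x using t.comp_apply1[OF c(6,7) that] c(8) by simp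
  have p2: "p x = \<tau> x" if "x \<in> t.S2" for x using t.comp_apply2[OF c(6,7) that] c(8) by simp
  have p1': "p x = \<pi>' x" if "x \<in> t'.S1" for x using t'.comp_apply1[OF c'(6,7) that] c'(8) by simp
  have p2': "p x = \<tau>' x" if "x \<in> t'.S2" for x using t'.comp_apply2[OF c'(6,7) that] c'(8) by simp
  show i: "i' = i"
  proof (rule ccontr)
    assume ne: "i' \<noteq> i"
    have "through_strings m j k \<tau> \<noteq> {}"
      using ps(1) NC2_annular_iff[OF t.index(2,3) t.index_neq(3)] unfolding ps11_def by blast
    then obtain x where x: "x \<in> seg j" "\<tau> x \<in> seg k"
    proof -
      assume ts: "through_strings m j k \<tau> \<noteq> {}" and th: "\<And>x. x \<in> seg j \<Longrightarrow> \<tau> x \<in> seg k \<Longrightarrow> thesis"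
      interpret a: annular t.S2 "seg j" "seg k" \<gamma> by (rule annular_segs[OF t.index(2,3) t.index_neq(3)])
      interpret a: annular_darts t.S2 "seg j" "seg k" \<gamma> \<tau> "perm_cycles t.S2 (\<gamma> \<circ> \<tau>)"
        using a.darts_face_partition[OF c(6)] a.annular_axioms by (intro annular_darts.intro)
      have "a.strings \<tau> \<noteq> {}" using ts unfolding a.strings_def through_strings_def .
      then show thesis using th unfolding a.strings_eq by blast
    qed
    have cl: "p y \<in> seg i'" if "y \<in> seg i'" for y using p1'[OF that] pairingD(2)[OF c'(7) that] by simp
    have px: "p x \<in> seg k" using p2[of x] x by simp
    have pp: "p (p x) = x" by (rule pairingD(4)[OF c(9)])
    have "i' \<in> {i, j, k}" using t'.index(1) unfolding t.ijk .
    then consider "i' = j" | "i' = k" using ne by blast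
    then show False
    proof cases
      case 1
      then have "p x \<in> seg j" using cl x(1) by simp
      then show False using px seg_disjoint[OF t.index(2,3) t.index_neq(3)] by blast
    next
      case 2
      then have "x \<in> seg k" using cl px pp by metis
      then show False using x(1) seg_disjoint[OF t.index(2,3) t.index_neq(3)] by blast
    qed
  qed
  have S1: "t'.S1 = t.S1" using i by simp
  have S2: "t'.S2 = t.S2" using t.S12 t'.S12 t.disj12 t'.disj12 S1 by blast
  show "\<tau>' = \<tau>"
  proof
    fix x show "\<tau>' x = \<tau> x"
    proof (cases "x \<in> t.S2")
      case True
      then show ?thesis using p2[of x] p2'[of x] S2 by simp
    next
      case False
      then have "x \<notin> t'.S2" using S2 by simp
      then show ?thesis
        using permutes_not_in[OF pairingD(1)[OF c(6)] False] permutes_not_in[OF pairingD(1)[OF c'(6)]] by simp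
    qed
  qed
  show "\<pi>' = \<pi>"
  proof
    fix x show "\<pi>' x = \<pi> x"
    proof (cases "x \<in> t.S1")
      case True
      then show ?thesis using p1[of x] p1'[of x] S1 by simp
    next
      case False
      then have "x \<notin> t'.S1" using S1 by simp
      then show ?thesis
        using permutes_not_in[OF pairingD(1)[OF c(7)] False] permutes_not_in[OF pairingD(1)[OF c'(7)]] by simp
    qed
  qed
  have U: "C1' \<union> C2' = C1 \<union> C2" using c(5)[OF c'(4,3)] .
  have "C1' = (C1' \<union> C2') \<inter> t'.S2" "C2' = (C1' \<union> C2') \<inter> t'.S1" using c'(1,2) t'.disj12 by blast+
  moreover have "C1 = (C1 \<union> C2) \<inter> t.S2" "C2 = (C1 \<union> C2) \<inter> t.S1" using c(1,2) t.disj12 by blast+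
  ultimately show "C1' = C1" "C2' = C2" unfolding U S1 S2 by simp_all
qed

context index_triple
begin

text \<open>Replacing \<open>a\<close> or \<open>b\<close> by its partner, independently of each
  other, changes nothing, and \<open>ps11_unique\<close> allows nothing else.\<close>

lemma merge_fibre:
  assumes d: "(\<tau>, \<pi>, a, b) \<in> glue_data"
  shows "{d \<in> glue_data. merge d = merge (\<tau>, \<pi>, a, b)} = {\<tau>} \<times> {\<pi>} \<times> {a, \<pi> a} \<times> {b, \<tau> b}"
proof (intro set_eqI iffI)
  fix x assume x: "x \<in> {d \<in> glue_data. merge d = merge (\<tau>, \<pi>, a, b)}"
  obtain \<tau>' \<pi>' a' b' where x_eq: "x = (\<tau>', \<pi>', a', b')" by (metis prod_cases4)
  have d': "(\<tau>', \<pi>', a', b') \<in> glue_data" and eq: "merge (\<tau>', \<pi>', a', b') = merge (\<tau>, \<pi>, a, b)"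
    using x unfolding x_eq by simp_all
  note u = ps11_unique[OF index_triple_axioms index_triple_axioms ps11_merge[OF d] ps11_merge[OF d', unfolded eq]]
  then have "a' \<in> {a, \<pi> a}" "b' \<in> {b, \<tau> b}" by blast+
  then show "x \<in> {\<tau>} \<times> {\<pi>} \<times> {a, \<pi> a} \<times> {b, \<tau> b}" unfolding x_eq u(2,3) by blast
next
  note D = glue_dataD[OF d]
  have pp: "pairing S2 \<tau>" "pairing S1 \<pi>" using ps11_cycles(6,7)[OF ps11_merge[OF d]] .
  fix x assume "x \<in> {\<tau>} \<times> {\<pi>} \<times> {a, \<pi> a} \<times> {b, \<tau> b}"
  then obtain a' b' where x: "x = (\<tau>, \<pi>, a', b')" "a' = a \<or> a' = \<pi> a" "b' = b \<or> b' = \<tau> b" by blast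
  have sets: "{a', \<pi> a'} = {a, \<pi> a}" "{b', \<tau> b'} = {b, \<tau> b}"
    using x(2,3) pairingD(4)[OF pp(1)] pairingD(4)[OF pp(2)] by (auto simp: insert_commute)
  have "a' \<in> S1" "b' \<in> S2" using x(2,3) D(3,4) pairingD(2)[OF pp(1) D(4)] pairingD(2)[OF pp(2) D(3)] by auto
  then have "x \<in> glue_data" using D unfolding x(1) glue_data_def by (simp add: sets)
  moreover have "merge x = merge (\<tau>, \<pi>, a, b)" unfolding x(1) merge_def prod.case sets ..
  ultimately show "x \<in> {d \<in> glue_data. merge d = merge (\<tau>, \<pi>, a, b)}" by simp
qed

lemma card_glue_data_PS: "card glue_data = 4 * card PS"
  unfolding merge_image[symmetric]
proof (rule card_eq_card_fibre_mult[OF finite_glue_data])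
  fix d assume d: "d \<in> glue_data"
  obtain \<tau> \<pi> a b where d_eq: "d = (\<tau>, \<pi>, a, b)" by (metis prod_cases4)
  note D = glue_dataD[OF d[unfolded d_eq]]
  have pp: "pairing S2 \<tau>" "pairing S1 \<pi>" using ps11_cycles(6,7)[OF ps11_merge[OF d[unfolded d_eq]]] .
  have "card {a, \<pi> a} = 2" "card {b, \<tau> b} = 2"
    using pairingD(3)[OF pp(1) D(4)] pairingD(3)[OF pp(2) D(3)] by (simp_all add: card_insert_if)
  then show "card {d' \<in> glue_data. merge d' = merge d} = 4"
    unfolding d_eq merge_fibre[OF d[unfolded d_eq]] card_cartesian_product by simp
qed

lemma card_UC_PS: "card UC = 2 * card PS"
  using card_glue_data_UC card_glue_data_PS by simp

lemma finite_UC: "finite UC" using finite_glue_data unfolding glued_image[symmetric] by simp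

lemma finite_PS: "finite PS" using finite_glue_data unfolding merge_image[symmetric] by simp

end


section \<open>Counting\<close>

context three_cycles
begin

section \<open>Symmetry in the two unicircuit indices and uniqueness of the tree index\<close>

lemma index_tripleI:
  assumes "{i, j, k} = {1, 2, 3}"
  shows "index_triple m i j k"
  using three_cycles_axioms assms by (intro index_triple.intro index_triple_axioms.intro)

lemma NC2_annular_commute:
  assumes "j \<in> {1, 2, 3}" "k \<in> {1, 2, 3}" "j \<noteq> k"
  shows "NC2_annular m j k = NC2_annular m k j"
proof (intro set_eqI)
  fix \<tau>
  show "\<tau> \<in> NC2_annular m j k \<longleftrightarrow> \<tau> \<in> NC2_annular m k j"
    unfolding NC2_annular_iff[OF assms] NC2_annular_iff[OF assms(2,1) assms(3)[symmetric]]
    by (simp only: Un_commute[of "seg k"] through_strings_commute[of m k])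
qed

lemma ps11_commute:
  assumes "{i, j, k} = {1, 2, 3}"
  shows "ps11 m j k i \<tau> \<pi> C1 C2 V p \<longleftrightarrow> ps11 m k j i \<tau> \<pi> C1 C2 V p"
proof -
  interpret index_triple m i j k by (rule index_tripleI[OF assms])
  have "{j, k, i} = {k, j, i}" by blast
  then show ?thesis
    unfolding ps11_def NC2_annular_commute[OF index(2,3) index_neq(3)] Un_commute[of "seg j" "seg k"] by (simp only:)
qed

lemma UC_commute:
  assumes "{i, j, k} = {1, 2, 3}"
  shows "index_triple.UC m i j k = index_triple.UC m i k j"
proof -
  have ikj: "{i, k, j} = {1, 2, 3}" using assms by (simp only: insert_commute)
  interpret index_triple m i j k by (rule index_tripleI[OF assms])
  interpret t': index_triple m i k j by (rule index_tripleI[OF ikj])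
  have "(\<exists>e \<in> seg j. \<exists>f \<in> seg k. c = {e, f}) \<longleftrightarrow> (\<exists>e \<in> seg k. \<exists>f \<in> seg j. c = {e, f})" for c
    by (metis insert_commute)
  then have "double_unicircuit m P j k \<longleftrightarrow> double_unicircuit m P k j" for P
    unfolding double_unicircuit_def insert_commute[of j k] by simp
  moreover have "joined_along_edge m P i j k \<longleftrightarrow> joined_along_edge m P i k j" for P
    unfolding joined_along_edge_def insert_commute[of j k] Un_commute[of "seg j" "seg k"] ..
  ultimately show ?thesis unfolding UC_def t'.UC_def by simp
qed

lemma PS_commute:
  assumes "{i, j, k} = {1, 2, 3}"
  shows "index_triple.PS m i j k = index_triple.PS m i k j"
proof -
  have ikj: "{i, k, j} = {1, 2, 3}" using assms by (simp only: insert_commute)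
  interpret index_triple m i j k by (rule index_tripleI[OF assms])
  interpret t': index_triple m i k j by (rule index_tripleI[OF ikj])
  show ?thesis
    unfolding PS_def t'.PS_def ps11_commute[OF assms] through_strings_commute[of m j k] ..
qed

text \<open>In a unicircuit graph on the segments \<open>j, k\<close>, some edge of either segment is paired with an edge
  of the other one, so neither segment can carry a double tree.\<close>

lemma UC_unique:
  assumes t: "{i, j, k} = {1, 2, 3}" "{i', j', k'} = {1, 2, 3}"
    and P: "P \<in> index_triple.UC m i j k" "P \<in> index_triple.UC m i' j' k'"
  shows "i' = i"
proof (rule ccontr)
  assume ne: "i' \<noteq> i"
  interpret t: index_triple m i j k by (rule index_tripleI[OF t(1)])
  interpret t': index_triple m i' j' k' by (rule index_tripleI[OF t(2)])
  obtain \<tau> where ok: "t.annular_ok \<tau>" and r2: "restrict_partition P t.S2 = t.Q2 \<tau>"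
    using t.UC_restrict[OF P(1)] by metis
  obtain \<pi> where \<pi>: "\<pi> \<in> NC2 m i'" and r1: "restrict_partition P t'.S1 = t'.Q1 \<pi>"
    using t'.UC_restrict[OF P(2)] by metis
  interpret d1: darts t'.S1 \<gamma> \<pi> "t'.Q1 \<pi>" by (rule t'.NC2_darts[OF \<pi>])
  interpret d2: darts t.S2 \<gamma> \<tau> "t.Q2 \<tau>" by (rule t.annular_ok_darts[OF ok])
  have part: "partition_on t.N P" using P(1) by (simp add: t.UC_def)
  have "i' \<in> {i, j, k}" using t'.index(1) unfolding t(1) .
  then have i': "i' = j \<or> i' = k" using ne by blast
  then have sub: "t'.S1 \<subseteq> t.S2" by blast
  have subN: "t.S2 \<subseteq> t.N" "t'.S1 \<subseteq> t.N" using sub t.S12 by blast+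
  obtain z where z: "z \<in> seg j" "\<tau> z \<in> seg k" using t.annular_ok_darts(4)[OF ok] by blast
  have disj: "seg j \<inter> seg k = {}" by (rule seg_disjoint[OF t.index(2,3) t.index_neq(3)])
  have "\<exists>x \<in> t'.S1. \<tau> x \<notin> t'.S1"
    using i'
  proof
    assume "i' = j"
    then show ?thesis using z disj by blast
  next
    assume "i' = k"
    then show ?thesis using z disj d2.\<tau>_\<tau>[of z] by (intro bexI[of _ "\<tau> z"]) auto
  qed
  then obtain x where x: "x \<in> t'.S1" "\<tau> x \<notin> t'.S1" by blast
  define y where "y = \<pi> x"
  have y: "y \<in> t'.S1" "\<pi> y = x" using d1.\<tau>_S[OF x(1)] d1.\<tau>_\<tau> by (simp_all add: y_def)
  have xy: "x \<in> t.S2" "y \<in> t.S2" using x(1) y(1) sub by blast+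
  \<comment> \<open>Both graphs are quotients by restrictions of the same P, so an equality of
    blocks in the tree carries over to the unicircuit graph.\<close>
  have eq: "d2.blk (\<tau> u) = d2.blk (\<pi> u)" if u: "u \<in> t'.S1" for u
  proof -
    have g: "\<gamma> u \<in> t'.S1" "\<gamma> u \<in> t.S2" "u \<in> t.S2" "\<pi> u \<in> t'.S1" "\<pi> u \<in> t.S2"
      using u d1.\<gamma>_S d1.\<tau>_S[OF u] sub by blast+
    have "block_of P (\<gamma> u) = block_of P (\<pi> u)"
      using d1.block_\<gamma>[OF u] block_of_restrict_eq_iff[OF part subN(2) g(1,4)] unfolding r1 by simp
    then have "d2.blk (\<gamma> u) = d2.blk (\<pi> u)"
      using block_of_restrict_eq_iff[OF part subN(1) g(2,5)] unfolding r2 by simp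
    then show ?thesis using d2.block_\<gamma>[OF g(3)] by simp
  qed
  \<comment> \<open>Thus x and \<open>\<pi> x\<close> are parallel edges of the unicircuit graph.
    Simplicity then forces \<open>\<pi> x\<close> to be \<open>\<tau> x\<close>, which lies outside
    the segment of x.\<close>
  have "{d2.blk x, d2.blk (\<tau> x)} = {d2.blk y, d2.blk (\<tau> y)}"
    using eq[OF x(1)] eq[OF y(1)] y(2) unfolding y_def[symmetric] by (simp add: insert_commute)
  then have "y = x \<or> y = \<tau> x" by (rule d2.simpleD[OF t.annular_ok_darts(2)[OF ok] xy])
  then show False using d1.\<tau>_neq[OF x(1)] x(2) y(1) by (auto simp: y_def)
qed

section \<open>Decomposition over the index of the tree\<close>

lemma triple_cases:
  fixes i j k :: nat
  assumes "{i, j, k} = {1, 2, 3}"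
  shows "(i, j, k) \<in> {(1, 2, 3), (2, 1, 3), (3, 1, 2)} \<or> (i, k, j) \<in> {(1, 2, 3), (2, 1, 3), (3, 1, 2)}"
proof -
  interpret index_triple m i j k by (rule index_tripleI[OF assms])
  show ?thesis using index index_neq by auto
qed

text \<open>One representative for each index of the tree, as the other two indices play symmetric
  roles.\<close>

definition triples :: "(nat \<times> nat \<times> nat) set" where
  "triples = {(1, 2, 3), (2, 1, 3), (3, 1, 2)}"

lemma triplesD: "(i, j, k) \<in> triples \<Longrightarrow> {i, j, k} = {1, 2, 3}"
  by (auto simp: triples_def)

lemma triples_eqI: "(i, j, k) \<in> triples \<Longrightarrow> (i, j', k') \<in> triples \<Longrightarrow> (i, j, k) = (i, j', k')"
  by (auto simp: triples_def)

abbreviation "UCt \<equiv> \<lambda>(i, j, k). index_triple.UC m i j k"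
abbreviation "PSt \<equiv> \<lambda>(i, j, k). index_triple.PS m i j k"

lemma UC_2_4_eq: "UC_2_4 m = (\<Union>t \<in> triples. UCt t)"
proof (intro set_eqI iffI)
  fix P assume "P \<in> UC_2_4 m"
  then obtain i j k where ijk: "{i, j, k} = {1, 2, 3}" and P: "partition_on {1..m 1 + m 2 + m 3} P"
    "double_tree (quotient_cycle_graph m P {i})" "double_unicircuit m P j k" "joined_along_edge m P i j k"
    unfolding UC_2_4_def unicircuit_type_2_4_def by blast
  interpret index_triple m i j k by (rule index_tripleI[OF ijk])
  have "P \<in> UC" using P unfolding UC_def by blast
  moreover have "(i, j, k) \<in> triples \<or> (i, k, j) \<in> triples" using triple_cases[OF ijk] unfolding triples_def .
  ultimately show "P \<in> (\<Union>t \<in> triples. UCt t)" using UC_commute[OF ijk] by fastforce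
next
  fix P assume "P \<in> (\<Union>t \<in> triples. UCt t)"
  then obtain i j k where t: "(i, j, k) \<in> triples" "P \<in> index_triple.UC m i j k" by auto
  interpret index_triple m i j k by (rule index_tripleI[OF triplesD[OF t(1)]])
  show "P \<in> UC_2_4 m" using t(2) ijk unfolding UC_def UC_2_4_def unicircuit_type_2_4_def by blast
qed

text \<open>The exchange of the two annular indices left open by \<open>ps11_unique\<close> does not
  affect the through strings.\<close>

lemma ps11_unique':
  assumes "ps11 m j k i \<tau> \<pi> C1 C2 V p" "ps11 m j' k' i' \<tau>' \<pi>' C1' C2' V p"
  shows "i' = i" "\<tau>' = \<tau>" "C1' = C1" "through_strings m j' k' \<tau>' = through_strings m j k \<tau>"
proof -
  have t: "{i, j, k} = {1, 2, 3}" "{i', j', k'} = {1, 2, 3}"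
    using assms unfolding ps11_def by (simp_all only: insert_commute)
  interpret t: index_triple m i j k by (rule index_tripleI[OF t(1)])
  interpret t': index_triple m i' j' k' by (rule index_tripleI[OF t(2)])
  note u = ps11_unique[OF t.index_triple_axioms t'.index_triple_axioms assms]
  show "i' = i" "\<tau>' = \<tau>" "C1' = C1" by (rule u)+
  have "j' = j \<and> k' = k \<or> j' = k \<and> k' = j"
    using u(1) t.index t.index_neq t'.index t'.index_neq by auto
  then show "through_strings m j' k' \<tau>' = through_strings m j k \<tau>"
    using u(2) through_strings_commute[of m j k] by auto
qed

text \<open>Each subtracted set asks for some decomposition of the pair. By
  \<open>ps11_unique'\<close> all decompositions agree in C1 and in the through strings, so a single
  one satisfying the conditions of \<open>PS\<close> keeps the pair out of both sets.\<close>

lemma PS_difference: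
  "PS11_NC2 m - PS11_NC2_two m - PS11_NC2_through m = (\<Union>t \<in> triples. PSt t)"
proof (intro set_eqI iffI)
  fix Vp assume Vp: "Vp \<in> PS11_NC2 m - PS11_NC2_two m - PS11_NC2_through m"
  obtain V p where Vp_eq: "Vp = (V, p)" by (cases Vp)
  obtain i j k \<tau> \<pi> C1 C2 where ps: "ps11 m j k i \<tau> \<pi> C1 C2 V p"
    using Vp unfolding Vp_eq PS11_NC2_def by blast
  have ijk: "{i, j, k} = {1, 2, 3}" using ps unfolding ps11_def by (simp only: insert_commute)
  interpret index_triple m i j k by (rule index_tripleI[OF ijk])
  have "card (through_strings m j k \<tau>) \<noteq> 2"
    using Vp ps unfolding Vp_eq PS11_NC2_two_def by blast
  moreover have "through_strings m j k \<tau> \<noteq> {C1}"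
  proof
    assume "through_strings m j k \<tau> = {C1}"
    then have "card (through_strings m j k \<tau>) = 1 \<and> C1 \<in> through_strings m j k \<tau>" by simp
    then show False using Vp ps unfolding Vp_eq PS11_NC2_through_def by blast
  qed
  ultimately have "Vp \<in> PS" using ps unfolding Vp_eq PS_def by blast
  moreover have "(i, j, k) \<in> triples \<or> (i, k, j) \<in> triples" using triple_cases[OF ijk] unfolding triples_def .
  ultimately show "Vp \<in> (\<Union>t \<in> triples. PSt t)" using PS_commute[OF ijk] by fastforce
next
  fix Vp assume "Vp \<in> (\<Union>t \<in> triples. PSt t)"
  then obtain i j k where t: "(i, j, k) \<in> triples" "Vp \<in> index_triple.PS m i j k" by auto
  interpret index_triple m i j k by (rule index_tripleI[OF triplesD[OF t(1)]])
  obtain V p \<tau> \<pi> C1 C2 where Vp: "Vp = (V, p)" "ps11 m j k i \<tau> \<pi> C1 C2 V p"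
    "card (through_strings m j k \<tau>) \<noteq> 2" "through_strings m j k \<tau> \<noteq> {C1}"
    using t(2) unfolding PS_def by blast
  have "Vp \<notin> PS11_NC2_two m"
  proof
    assume "Vp \<in> PS11_NC2_two m"
    then obtain i' j' k' \<tau>' \<pi>' C1' C2' where "ps11 m j' k' i' \<tau>' \<pi>' C1' C2' V p"
      "card (through_strings m j' k' \<tau>') = 2"
      unfolding Vp(1) PS11_NC2_two_def by blast
    then show False using ps11_unique'(4)[OF Vp(2)] Vp(3) by metis
  qed
  moreover have "Vp \<notin> PS11_NC2_through m"
  proof
    assume "Vp \<in> PS11_NC2_through m"
    then obtain i' j' k' \<tau>' \<pi>' C1' C2' where "ps11 m j' k' i' \<tau>' \<pi>' C1' C2' V p"
      "card (through_strings m j' k' \<tau>') = 1" "C1' \<in> through_strings m j' k' \<tau>'"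
      unfolding Vp(1) PS11_NC2_through_def by blast
    then have "card (through_strings m j k \<tau>) = 1" "C1 \<in> through_strings m j k \<tau>"
      using ps11_unique'(3,4)[OF Vp(2)] by metis+
    then show False using Vp(4) by (metis card_1_singletonE singletonD)
  qed
  moreover have "Vp \<in> PS11_NC2 m" using Vp(2) unfolding Vp(1) PS11_NC2_def by blast
  ultimately show "Vp \<in> PS11_NC2 m - PS11_NC2_two m - PS11_NC2_through m" by blast
qed

lemma finite_PS11_NC2: "finite (PS11_NC2 m)"
proof (rule finite_subset)
  let ?N = "{1..m 1 + m 2 + m 3}"
  show "PS11_NC2 m \<subseteq> {V. partition_on ?N V} \<times> {p. p permutes ?N}"
  proof
    fix Vp assume "Vp \<in> PS11_NC2 m"
    then obtain V p i j k \<tau> \<pi> C1 C2 where Vp: "Vp = (V, p)" and ps: "ps11 m j k i \<tau> \<pi> C1 C2 V p"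
      unfolding PS11_NC2_def by blast
    have "{i, j, k} = {1, 2, 3}" using ps unfolding ps11_def by (simp only: insert_commute)
    then interpret index_triple m i j k by (rule index_tripleI)
    have "p permutes ?N" using pairingD(1)[OF ps11_cycles(9)[OF ps]] .
    moreover have "partition_on ?N V" using ps unfolding ps11_def by blast
    ultimately show "Vp \<in> {V. partition_on ?N V} \<times> {p. p permutes ?N}" unfolding Vp by blast
  qed
  show "finite ({V. partition_on ?N V} \<times> {p. p permutes ?N})"
    by (intro finite_cartesian_product finite_permutations finitely_many_partition_on) simp_all
qed

text \<open>The subtracted sets are disjoint, since a pair has a definite number of through strings,
  and both are subsets, so the cardinalities simply subtract.\<close>

lemma card_PS_difference:
  "int (card (\<Union>t \<in> triples. PSt t)) =
     int (card (PS11_NC2 m)) - int (card (PS11_NC2_two m)) - int (card (PS11_NC2_through m))"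
proof -
  have sub: "PS11_NC2_two m \<subseteq> PS11_NC2 m" "PS11_NC2_through m \<subseteq> PS11_NC2 m"
    unfolding PS11_NC2_two_def PS11_NC2_through_def PS11_NC2_def by blast+
  have disj: "PS11_NC2_two m \<inter> PS11_NC2_through m = {}"
  proof (rule ccontr)
    assume "\<not> ?thesis"
    then obtain V p where Vp: "(V, p) \<in> PS11_NC2_two m" "(V, p) \<in> PS11_NC2_through m" by auto
    obtain i j k \<tau> \<pi> C1 C2 where 1: "ps11 m j k i \<tau> \<pi> C1 C2 V p" "card (through_strings m j k \<tau>) = 2"
      using Vp(1) unfolding PS11_NC2_two_def by blast
    obtain i' j' k' \<tau>' \<pi>' C1' C2' where 2: "ps11 m j' k' i' \<tau>' \<pi>' C1' C2' V p" "card (through_strings m j' k' \<tau>') = 1"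
      using Vp(2) unfolding PS11_NC2_through_def by blast
    show False using ps11_unique'(4)[OF 1(1) 2(1)] 1(2) 2(2) by simp
  qed
  have "PS11_NC2 m - PS11_NC2_two m - PS11_NC2_through m = PS11_NC2 m - (PS11_NC2_two m \<union> PS11_NC2_through m)"
    by blast
  moreover have "card (PS11_NC2_two m \<union> PS11_NC2_through m) = card (PS11_NC2_two m) + card (PS11_NC2_through m)"
    using sub finite_PS11_NC2 disj by (intro card_Un_disjoint) (auto intro: finite_subset)
  moreover have "card (PS11_NC2_two m \<union> PS11_NC2_through m) \<le> card (PS11_NC2 m)"
    using sub finite_PS11_NC2 by (intro card_mono) auto
  moreover have "card (PS11_NC2 m - (PS11_NC2_two m \<union> PS11_NC2_through m))
      = card (PS11_NC2 m) - card (PS11_NC2_two m \<union> PS11_NC2_through m)"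
    using sub finite_PS11_NC2 by (intro card_Diff_subset) (auto intro: finite_subset)
  ultimately show ?thesis unfolding PS_difference[symmetric] by simp
qed

text \<open>Both unions are disjoint because the index of the tree is determined, so the identities
  for the three indices add up.\<close>

lemma card_UC_2_4: "card (UC_2_4 m) = 2 * card (\<Union>t \<in> triples. PSt t)"
proof -
  have fin: "finite triples" by (simp add: triples_def)
  have each: "finite (UCt t) \<and> finite (PSt t) \<and> card (UCt t) = 2 * card (PSt t)" if t: "t \<in> triples" for t
  proof -
    obtain i j k where t_eq: "t = (i, j, k)" by (cases t)
    interpret index_triple m i j k by (rule index_tripleI[OF triplesD[OF t[unfolded t_eq]]])
    show ?thesis unfolding t_eq prod.case using finite_UC finite_PS card_UC_PS by blast
  qed
  have UC_disj: "UCt t \<inter> UCt t' = {}" if t: "t \<in> triples" "t' \<in> triples" "t \<noteq> t'" for t t'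
  proof (rule ccontr)
    assume "UCt t \<inter> UCt t' \<noteq> {}"
    then obtain P where P: "P \<in> UCt t" "P \<in> UCt t'" by blast
    obtain i j k i' j' k' where eq: "t = (i, j, k)" "t' = (i', j', k')" by (metis prod_cases3)
    have "i' = i" using UC_unique[OF triplesD triplesD] t(1,2) P unfolding eq prod.case by blast
    then show False using triples_eqI t unfolding eq by blast
  qed
  have PS_disj: "PSt t \<inter> PSt t' = {}" if t: "t \<in> triples" "t' \<in> triples" "t \<noteq> t'" for t t'
  proof (rule ccontr)
    assume "PSt t \<inter> PSt t' \<noteq> {}"
    then obtain Vp where Vp: "Vp \<in> PSt t" "Vp \<in> PSt t'" by blast
    obtain i j k i' j' k' where eq: "t = (i, j, k)" "t' = (i', j', k')" by (metis prod_cases3)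
    interpret t: index_triple m i j k by (rule index_tripleI[OF triplesD[OF t(1)[unfolded eq]]])
    interpret t': index_triple m i' j' k' by (rule index_tripleI[OF triplesD[OF t(2)[unfolded eq]]])
    obtain V p \<tau> \<pi> C1 C2 where 1: "Vp = (V, p)" "ps11 m j k i \<tau> \<pi> C1 C2 V p"
      using Vp(1) unfolding eq prod.case t.PS_def by blast
    obtain \<tau>' \<pi>' C1' C2' where 2: "ps11 m j' k' i' \<tau>' \<pi>' C1' C2' V p"
      using Vp(2) unfolding eq prod.case t'.PS_def 1(1) by blast
    have "i' = i" by (rule ps11_unique'(1)[OF 1(2) 2])
    then show False using triples_eqI t unfolding eq by blast
  qed
  have "card (UC_2_4 m) = (\<Sum>t \<in> triples. card (UCt t))"
    unfolding UC_2_4_eq using fin each UC_disj by (intro card_UN_disjoint) blast+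
  also have "\<dots> = 2 * (\<Sum>t \<in> triples. card (PSt t))"
    unfolding sum_distrib_left using each by (intro sum.cong) blast+
  also have "(\<Sum>t \<in> triples. card (PSt t)) = card (\<Union>t \<in> triples. PSt t)"
    using fin each PS_disj by (intro card_UN_disjoint[symmetric]) blast+
  finally show ?thesis .
qed

end

theorem lemma8p32:
  fixes m :: "nat \<Rightarrow> nat"
  assumes "m 1 \<ge> 1" and "m 2 \<ge> 1" and "m 3 \<ge> 1"
  shows "int (card (UC_2_4 m)) =
           2 * int (card (PS11_NC2 m)) - 2 * int (card (PS11_NC2_two m))
             - 2 * int (card (PS11_NC2_through m))"
proof -
  interpret three_cycles m by unfold_locales (use assms in auto)
  show ?thesis using card_UC_2_4 card_PS_difference by simp
qed

end
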